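(* Let $T\ge1$. For each $t=1,\dots,T$, let $\mathcal X_t$ be a Suslin space with its Borel $\sigma$-algebra, $\widehat{\mathbb P}_t$ a Borel probability measure on $\mathcal X_t$, $c:\mathcal X_t\times\mathcal X_t\to[0,\infty]$ a measurable transport cost with $c(x,x)=0$ for all $x$, and $$\mathfrak M_t=\{\mathbb P\in\mathcal P(\mathcal X_t):\mathcal K_c(\widehat{\mathbb P}_t,\mathbb P)\le\rho_t\},$$ where $\rho_t>0$ for $t\ge2$, while $\rho_1=0$ and $\widehat{\mathbb P}_1=\boldsymbol\delta_{x_1}$ is a Dirac measure at some $x_1\in\mathcal X_1$ (there is no uncertainty in the first stage, and the initial decision is $u_0=\varnothing$). Assume that for each $t$: - $f_t:\mathbb R^{d_t}\times\mathcal X_t\to\mathbb R$ is bounded from below and random lower semi-continuous; - the multifunction $\mathcal U_t:\mathbb R^{d_{t-1}}\times\mathcal X_t\rightrightarrows\mathbb R^{d_t}$ is measurable; for each $x_t\in\mathcal X_t$, $\mathcal U_t(\cdot,x_t)$ is non-empty valued and has closed graph; and there is a bounded set containing $\mathcal U_t(u_{t-1},x_t)$ for all $u_{t-1}$ and $x_t$. Define $Q_T(u_{T-1},x_T)=\inf_{u\in\mathcal U_T(u_{T-1},x_T)}f_T(u,x_T)$ and, for $t=T-1,\dots,1$, $$Q_t(u_{t-1},x_t)=\inf_{u\in\mathcal U_t(u_{t-1},x_t)}\Big\{f_t(u,x_t)+\sup_{\mathbb P\in\mathfrak M_{t+1}}\mathbb E_{x_{t+1}\sim\mathbb P}[Q_{t+1}(u,x_{t+1})]\Big\}.$$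 Then for every $t=1,\dots,T-1$, $$Q_t(u_{t-1},x_t)=\inf_{u\in\mathcal U_t(u_{t-1},x_t),\ \lambda\ge0}\Big\{f_t(u,x_t)+\lambda\rho_{t+1}+\mathbb E_{\hat x_{t+1}\sim\widehat{\mathbb P}_{t+1}}\Big[\sup_{x\in\mathcal X_{t+1}}\{Q_{t+1}(u,x)-\lambda c(\hat x_{t+1},x)\}\Big]\Big\}.$$
   Context: A Hausdorff topological space is Suslin (analytic) if it is the continuous image of a Borel set in a Polish space. $\mathcal P(\mathcal X_t)$ is the set of Borel probability measures on $\mathcal X_t$. The Kantorovich transport cost is $\mathcal K_c(\widehat{\mathbb P},\mathbb P)=\inf_\gamma\mathbb E_{(\hat x,x)\sim\gamma}[c(\hat x,x)]$, the infimum being over all probability measures $\gamma$ on the product space with marginals $\widehat{\mathbb P}$ and $\mathbb P$. A multifunction is a set-valued function. A function $f_t:\mathbb R^{d_t}\times\mathcal X_t\to\mathbb R$ is random lower semi-continuous if the epigraph multifunction $x_t\mapsto\mathrm{epi}\,f_t(\cdot,x_t)$ is measurable and closed valued. Convention: $0\cdot\infty=\infty$. Expectations of functions under $\widehat{\mathbb P}_{t+1}$ that are only measurable with respect to the completion are taken with respect to the completed measure. *)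

theory Defs
  imports "HOL-Analysis.Analysis" "HOL-Probability.Probability"
begin

definition borel_of :: "'a topology \<Rightarrow> 'a measure" where
  "borel_of X = sigma (topspace X) {U. openin X U}"

definition Polish_space :: "'a topology \<Rightarrow> bool" where
  "Polish_space P \<longleftrightarrow> completely_metrizable_space P \<and> separable_space P"

text \<open>HOL cannot quantify over the carrier type of the Polish space. Nothing is lost by taking
  carriers to be arbitrary sets of reals (with an arbitrary, unrelated topology), since a Polish
  space has at most continuum many points.\<close>

definition Suslin_space :: "'a topology \<Rightarrow> bool" where
  "Suslin_space X \<longleftrightarrow> Hausdorff_space X \<and>
     (\<exists>(P :: real topology) B g. Polish_space P \<and> B \<in> sets (borel_of P) \<and>
        continuous_map (subtopology P B) X g \<and> g ` B = topspace X)"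

text \<open>Measurability of a multifunction from a measurable space into a topological space:
  the inverse image of every open set is measurable.\<close>

definition measurable_multifunction ::
    "'a measure \<Rightarrow> 'b topology \<Rightarrow> ('a \<Rightarrow> 'b set) \<Rightarrow> bool" where
  "measurable_multifunction M Y S \<longleftrightarrow>
     (\<forall>x\<in>space M. S x \<subseteq> topspace Y) \<and>
     (\<forall>V. openin Y V \<longrightarrow> {x \<in> space M. S x \<inter> V \<noteq> {}} \<in> sets M)"

definition epi :: "'u set \<Rightarrow> ('u \<Rightarrow> real) \<Rightarrow> ('u \<times> real) set" where
  "epi D h = {(u, \<alpha>). u \<in> D \<and> h u \<le> \<alpha>}"

definition random_lsc :: "nat \<Rightarrow> 'a measure \<Rightarrow> ((nat \<Rightarrow> real) \<Rightarrow> 'a \<Rightarrow> real) \<Rightarrow> bool" where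
  "random_lsc n M f \<longleftrightarrow>
     measurable_multifunction M (prod_topology (Euclidean_space n) euclideanreal)
       (\<lambda>x. epi (topspace (Euclidean_space n)) (\<lambda>u. f u x)) \<and>
     (\<forall>x\<in>space M. closedin (prod_topology (Euclidean_space n) euclideanreal)
       (epi (topspace (Euclidean_space n)) (\<lambda>u. f u x)))"

definition couplings :: "'a measure \<Rightarrow> 'b measure \<Rightarrow> ('a \<times> 'b) measure set" where
  "couplings M N = {\<gamma>. prob_space \<gamma> \<and> sets \<gamma> = sets (M \<Otimes>\<^sub>M N) \<and>
     distr \<gamma> M fst = M \<and> distr \<gamma> N snd = N}"

definition Kantorovich :: "('a \<Rightarrow> 'a \<Rightarrow> ennreal) \<Rightarrow> 'a measure \<Rightarrow> 'a measure \<Rightarrow> ennreal" where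
  "Kantorovich c M N = (INF \<gamma>\<in>couplings M N. \<integral>\<^sup>+ z. c (fst z) (snd z) \<partial>\<gamma>)"

definition ambiguity_set ::
    "'a topology \<Rightarrow> ('a \<Rightarrow> 'a \<Rightarrow> ennreal) \<Rightarrow> 'a measure \<Rightarrow> real \<Rightarrow> 'a measure set" where
  "ambiguity_set X c Phat \<rho> =
     {P. prob_space P \<and> sets P = sets (borel_of X) \<and> Kantorovich c Phat P \<le> ennreal \<rho>}"

text \<open>Extended-valued expectation with respect to the completed measure, as the integral of the
  positive part minus that of the negative part (e2ennreal truncates negative values to 0).\<close>

definition expect :: "'a measure \<Rightarrow> ('a \<Rightarrow> ereal) \<Rightarrow> ereal" where
  "expect M g = enn2ereal (\<integral>\<^sup>+ x. e2ennreal (g x) \<partial>completion M)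
              - enn2ereal (\<integral>\<^sup>+ x. e2ennreal (- g x) \<partial>completion M)"

text \<open>The value of q - l * c. By the convention that 0 times infinity is infinity, l * c is
  infinite whenever c is, even for l = 0; subtracting it then gives minus infinity, also when q
  is infinite (in HOL, subtracting infinity from infinity in ereal would give infinity). Thus
  points at infinite transport cost are never selected by the supremum.\<close>

definition penalized :: "ereal \<Rightarrow> real \<Rightarrow> ennreal \<Rightarrow> ereal" where
  "penalized q l c = (if c = \<infinity> then -\<infinity> else q - ereal l * enn2ereal c)"

end

theory Submission
  imports Defs
begin

text \<open>
  The recursion reduces to one duality per stage, for a fixed function \<open>q\<close> that is Borel and bounded
  below: these two properties, together with lower semicontinuity in the decision, propagate backwards
  because the constraint sets are compact.

  Weak duality integrates \<open>q y \<le> penalized value + l * cost\<close> against a coupling. For the converse, the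
  pairs (cost, gain) of the plans with first marginal \<open>\<mu>\<close> form a convex set, and since \<open>\<rho> > 0\<close> it has a
  supporting line above \<open>\<rho>\<close>; its slope is the multiplier \<open>l\<close>. The supremum over plans of
  \<open>gain - l * cost\<close> is the expectation of the pointwise supremum, by a measurable selection. A Suslin
  space is a measurable image of \<open>nat \<Rightarrow> nat\<close>, so projection and selection are only needed for
  product-measurable subsets of \<open>M \<times> (nat \<Rightarrow> nat)\<close>; there a capacity argument cuts the tree of
  finite sequences down to a finitely branching one, in which a leftmost branch is measurable.
\<close>

subsection \<open>Measurable projection and selection\<close>

text \<open>The main obstacle is measurability. Projection and selection are applied to sets that
  combine the gain with the cost, so the gain has to be Borel; yet the supremum over
  \<open>y\<close> in the dual is a projection, and is only measurable for the completion. The value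
  functions escape this loss: an infimum of a lower semicontinuous function over compact sets is
  attained, so its sublevel sets can be described by countably many small open sets.

  The role of \<open>\<rho> > 0\<close> is that of a Slater condition. Leaving all mass in place
  costs 0, so that plan lies strictly below the budget. It bounds the slopes of the supporting line,
  and mixing with it shows that plans of finite cost have finite gain once the primal value is
  finite.

  All integrals are taken in \<open>ennreal\<close>, after a lower bound \<open>B\<close> has been
  added to the value function. Truncation at 0 loses nothing in the supremum over \<open>y\<close>,
  since \<open>y = x\<close> costs nothing and already contributes a non-negative amount.\<close>

lemma finite_prefix_UN_sets:
  fixes F :: "(nat \<Rightarrow> nat) \<Rightarrow> 'a set"
  assumes sets: "\<And>\<omega>. F \<omega> \<in> sets M"
    and dep: "\<And>\<omega> \<omega>'. (\<And>i. i < n \<Longrightarrow> \<omega> i = \<omega>' i) \<Longrightarrow> F \<omega> = F \<omega>'"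
  shows "(\<Union>\<omega>\<in>W. F \<omega>) \<in> sets M"
proof -
  \<comment> \<open>Words of length \<open>n\<close>, padded with 0, represent the whole family;
    there are countably many of them even when \<open>W\<close> is uncountable.\<close>
  define h :: "nat list \<Rightarrow> nat \<Rightarrow> nat" where "h l = (\<lambda>i. if i < n then l ! i else 0)" for l
  have F: "F \<omega> = F (h (map \<omega> [0..<n]))" for \<omega>
    by (rule dep) (simp add: h_def)
  have "(\<Union>\<omega>\<in>W. F \<omega>) = (\<Union>l\<in>(\<lambda>\<omega>. map \<omega> [0..<n]) ` W. F (h l))"
    using F by auto
  also have "\<dots> \<in> sets M"
    using sets by (intro sets.countable_UN'') auto
  finally show ?thesis .
qed

text \<open>Outer measure is continuous along increasing unions of arbitrary sets, so bounds
  \<open>m i\<close> on the coordinates can be fixed one after another while the outer measure stays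
  above \<open>a\<close>, before anything is known about measurability of the projection. Under
  these bounds every level set \<open>L k\<close> is measurable with measure at least
  \<open>a\<close>; finiteness of the measure passes this to their intersection, whose points have
  full branches by compactness. \<open>b k\<close> counts the coordinates that \<open>H k\<close>
  reads.\<close>

lemma (in finite_measure) tree_selection:
  fixes H :: "nat \<Rightarrow> (nat \<Rightarrow> nat) \<Rightarrow> 'a set" and b :: "nat \<Rightarrow> nat"
  assumes sets_H: "\<And>k \<omega>. H k \<omega> \<in> sets M"
    and dep: "\<And>k \<omega> \<omega>'. (\<And>i. i < b k \<Longrightarrow> \<omega> i = \<omega>' i) \<Longrightarrow> H k \<omega> = H k \<omega>'"
    and "mono b"
    and a: "a < outer_measure_of M {x. \<exists>\<omega>. \<forall>k. x \<in> H k \<omega>}"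
  obtains L s where "L \<in> sets M" "a \<le> emeasure M L"
    "\<And>i. (\<lambda>x. s x i) \<in> M \<rightarrow>\<^sub>M count_space UNIV" "\<And>x k. x \<in> L \<Longrightarrow> x \<in> H k (s x)"
proof -
  have H_space: "H k \<omega> \<subseteq> space M" for k \<omega>
    using sets_H by (rule sets.sets_into_space)
  \<comment> \<open>Only the first \<open>n\<close> coordinates are bounded; the others stay free
    for later stages.\<close>
  define S where "S m n = {x. \<exists>\<omega>. (\<forall>i<n. \<omega> i \<le> m i) \<and> (\<forall>k. x \<in> H k \<omega>)}" for m :: "nat \<Rightarrow> nat" and n :: nat
  have S_sp: "S m n \<subseteq> space M" for m n
    using H_space[of 0] unfolding S_def by blast
  have "\<exists>F. \<forall>n. a < outer_measure_of M (S (F n) n) \<and> (\<exists>j. F (Suc n) = (F n)(n := j))"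
  proof (rule dependent_nat_choice)
    show "\<exists>m. a < outer_measure_of M (S m 0)"
      using a by (simp add: S_def)
  next
    fix m n assume *: "a < outer_measure_of M (S m n)"
    have "S m n = (\<Union>j. S (m(n := j)) (Suc n))"
    proof (safe, goal_cases)
      case (1 x)
      then obtain \<omega> where \<omega>: "\<forall>i<n. \<omega> i \<le> m i" "\<forall>k. x \<in> H k \<omega>"
        by (auto simp: S_def)
      then have "x \<in> S (m(n := \<omega> n)) (Suc n)"
        unfolding S_def by (intro CollectI exI[of _ \<omega>]) (auto simp: less_Suc_eq)
      then show ?case by blast
    next
      case (2 x j)
      then obtain \<omega> where \<omega>: "\<forall>i<Suc n. \<omega> i \<le> (m(n := j)) i" "\<forall>k. x \<in> H k \<omega>"
        by (auto simp: S_def)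
      have "\<omega> i \<le> m i" if "i < n" for i
        using \<omega>(1)[rule_format, of i] that by simp
      with \<omega>(2) show ?case
        unfolding S_def by blast
    qed
    moreover have "(SUP j. outer_measure_of M (S (m(n := j)) (Suc n))) = outer_measure_of M (\<Union>j. S (m(n := j)) (Suc n))"
    proof (rule SUP_outer_measure_of_incseq)
      show "incseq (\<lambda>j. S (m(n := j)) (Suc n))"
      proof (intro monoI subsetI)
        fix j j' x assume j: "(j::nat) \<le> j'" and "x \<in> S (m(n := j)) (Suc n)"
        then obtain \<omega> where \<omega>: "\<forall>i<Suc n. \<omega> i \<le> (m(n := j)) i" "\<forall>k. x \<in> H k \<omega>"
          by (auto simp: S_def)
        have "\<omega> i \<le> (m(n := j')) i" if "i < Suc n" for i
          using \<omega>(1)[rule_format, OF that] j by (cases "i = n") auto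
        with \<omega>(2) show "x \<in> S (m(n := j')) (Suc n)"
          unfolding S_def by blast
      qed
    qed (use S_sp in auto)
    ultimately have "a < (SUP j. outer_measure_of M (S (m(n := j)) (Suc n)))"
      using * by simp
    then obtain j where "a < outer_measure_of M (S (m(n := j)) (Suc n))"
      unfolding less_SUP_iff by blast
    then show "\<exists>m'. a < outer_measure_of M (S m' (Suc n)) \<and> (\<exists>j. m' = m(n := j))"
      by blast
  qed
  then obtain F where F: "\<And>n. a < outer_measure_of M (S (F n) n)"
    and F_Suc: "\<And>n. \<exists>j. F (Suc n) = (F n)(n := j)"
    by blast
  \<comment> \<open>Stage \<open>n\<close> changes only the bound at \<open>n\<close>, so the
    diagonal agrees with \<open>F n\<close> below \<open>n\<close>.\<close>
  define m where "m i = F (Suc i) i" for i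
  have F_m: "i < n \<Longrightarrow> F n i = m i" for i n
  proof (induction n)
    case (Suc n)
    then show ?case
      using F_Suc[of n] by (cases "i = n") (auto simp: m_def)
  qed simp
  have S_F: "S (F n) n = S m n" for n
    unfolding S_def using F_m by simp
  define W where "W = {\<omega>. \<forall>i. \<omega> i \<le> m i}"
  \<comment> \<open>Cumulative intersections make the conditions decreasing in \<open>k\<close>, so
    that failures at finitely many levels can be moved to one common level.\<close>
  define D where "D k \<omega> = (\<Inter>j\<in>{..k}. H j \<omega>)" for k \<omega>
  have sets_D: "D k \<omega> \<in> sets M" for k \<omega>
    unfolding D_def using sets_H by (intro sets.finite_INT) auto
  have dep_D: "D k \<omega> = D k \<omega>'" if "\<And>i. i < b k \<Longrightarrow> \<omega> i = \<omega>' i" for k \<omega> \<omega>'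
  proof -
    have "H j \<omega> = H j \<omega>'" if "j \<le> k" for j
      using monoD[OF \<open>mono b\<close> that] \<open>\<And>i. i < b k \<Longrightarrow> \<omega> i = \<omega>' i\<close> by (intro dep) simp
    then show ?thesis by (simp add: D_def)
  qed
  text \<open>The nodes \<open>l\<close> lying, for \<open>x\<close>, on an infinite branch bounded by \<open>m\<close> (by Koenig's lemma).\<close>
  define T where "T l = {x\<in>space M. \<forall>k. \<exists>\<omega>\<in>W. (\<forall>i<length l. \<omega> i = l ! i) \<and> x \<in> D k \<omega>}" for l
  have sets_T[measurable]: "T l \<in> sets M" for l
  proof -
    have "T l = (\<Inter>k. \<Union>\<omega>\<in>{\<omega>\<in>W. \<forall>i<length l. \<omega> i = l ! i}. D k \<omega>)"
      using sets.sets_into_space[OF sets_D] unfolding T_def by blast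
    also have "\<dots> \<in> sets M"
      using finite_prefix_UN_sets[of "D k" M "b k" for k, OF sets_D dep_D]
      by (intro sets.countable_INT) auto
    finally show ?thesis .
  qed
  have T_step: "\<exists>i. x \<in> T (l @ [i])" if x: "x \<in> T l" for x l
  proof (rule ccontr)
    assume no: "\<not> ?thesis"
    have "\<exists>k. \<forall>\<omega>\<in>W. (\<forall>j<length (l @ [i]). \<omega> j = (l @ [i]) ! j) \<longrightarrow> x \<notin> D k \<omega>" for i
    proof -
      have "x \<notin> T (l @ [i])" using no by blast
      moreover have "x \<in> space M" using x by (simp add: T_def)
      ultimately show ?thesis unfolding T_def mem_Collect_eq by blast
    qed
    then obtain K where K: "\<And>i \<omega>. \<omega> \<in> W \<Longrightarrow> (\<forall>j<length (l @ [i]). \<omega> j = (l @ [i]) ! j) \<Longrightarrow> x \<notin> D (K i) \<omega>"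
      by metis
    \<comment> \<open>The bound \<open>m\<close> leaves finitely many children. If each child
      \<open>i\<close> dies at its level \<open>K i\<close>, all are dead at the maximum, against
      \<open>x \<in> T l\<close>.\<close>
    define k where "k = Max (K ` {..m (length l)})"
    obtain \<omega> where \<omega>: "\<omega> \<in> W" "\<forall>i<length l. \<omega> i = l ! i" "x \<in> D k \<omega>"
      using x unfolding T_def by blast
    have "\<omega> (length l) \<le> m (length l)"
      using \<omega>(1) by (simp add: W_def)
    then have "K (\<omega> (length l)) \<le> k"
      unfolding k_def by (intro Max_ge) auto
    then have "x \<in> D (K (\<omega> (length l))) \<omega>"
      using \<omega>(3) by (auto simp: D_def)
    moreover have "\<forall>j<length (l @ [\<omega> (length l)]). \<omega> j = (l @ [\<omega> (length l)]) ! j"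
      using \<omega>(2) by (auto simp: nth_append less_Suc_eq)
    ultimately show False using K[OF \<omega>(1)] by blast
  qed
  \<comment> \<open>\<open>p n x\<close> is the prefix of length \<open>n\<close> of the leftmost
    infinite branch. It is measurable because it takes countably many values and each extension is a
    \<open>LEAST\<close> over measurable sets. Outside \<open>T []\<close> it has no
    meaning.\<close>
  define p where "p = rec_nat (\<lambda>x. []) (\<lambda>n q x. q x @ [LEAST i. x \<in> T (q x @ [i])])"
  have p_0: "p 0 x = []" and p_Suc: "p (Suc n) x = p n x @ [LEAST i. x \<in> T (p n x @ [i])]" for n x
    by (auto simp: p_def)
  have p_meas: "p n \<in> M \<rightarrow>\<^sub>M count_space UNIV" for n
  proof (induction n)
    case 0
    then show ?case by (simp add: p_0[abs_def])
  next
    case (Suc n)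
    have "(\<lambda>x. l @ [LEAST i. x \<in> T (l @ [i])]) \<in> M \<rightarrow>\<^sub>M count_space UNIV" for l
    proof -
      have "(\<lambda>x. LEAST i. x \<in> T (l @ [i])) \<in> M \<rightarrow>\<^sub>M count_space UNIV"
        by measurable
      then show ?thesis
        by (rule measurable_compose) simp
    qed
    from measurable_compose_countable[OF this Suc] show ?case
      by (simp add: p_Suc[abs_def])
  qed
  have p_len: "length (p n x) = n" for n x
    by (induction n) (auto simp: p_0 p_Suc)
  define s where "s x i = p (Suc i) x ! i" for x i
  have p_s: "i < n \<Longrightarrow> p n x ! i = s x i" for n i x
  proof (induction n)
    case (Suc n)
    then show ?case
      by (cases "i = n") (auto simp: s_def p_Suc[of n] nth_append p_len)
  qed simp
  have p_T: "x \<in> T (p n x)" if "x \<in> T []" for x n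
  proof (induction n)
    case 0
    then show ?case using that by (simp add: p_0)
  next
    case (Suc n)
    from LeastI_ex[OF T_step[OF this]] show ?case by (simp add: p_Suc)
  qed
  show ?thesis
  proof
    show "T [] \<in> sets M" by simp
    show "(\<lambda>x. s x i) \<in> M \<rightarrow>\<^sub>M count_space UNIV" for i
      unfolding s_def using p_meas[of "Suc i"] by (rule measurable_compose) simp
    show "x \<in> H k (s x)" if x: "x \<in> T []" for x k
    proof -
      obtain \<omega> where \<omega>: "\<forall>i<length (p (b k) x). \<omega> i = p (b k) x ! i" "x \<in> D k \<omega>"
        using p_T[OF x, of "b k"] unfolding T_def by blast
      then have "x \<in> H k \<omega>" by (auto simp: D_def)
      also have "H k \<omega> = H k (s x)"
        using \<omega>(1) by (intro dep) (simp add: p_len p_s)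
      finally show ?thesis .
    qed
    define L where "L k = (\<Union>\<omega>\<in>W. D k \<omega>)" for k
    have sets_L: "L k \<in> sets M" for k
      unfolding L_def using sets_D dep_D by (rule finite_prefix_UN_sets)
    have aL: "a \<le> emeasure M (L k)" for k
    proof -
      have "S m (b k) \<subseteq> L k"
      proof
        fix x assume "x \<in> S m (b k)"
        then obtain \<omega> where \<omega>: "\<forall>i<b k. \<omega> i \<le> m i" "\<forall>k. x \<in> H k \<omega>"
          by (auto simp: S_def)
        \<comment> \<open>The bounds hold only below \<open>b k\<close>; zeroing the remaining
          coordinates puts the branch into \<open>W\<close>, and \<open>D k\<close> does not see the
          change.\<close>
        define \<omega>' where "\<omega>' i = (if i < b k then \<omega> i else 0)" for i
        have "x \<in> D k \<omega>" using \<omega>(2) by (simp add: D_def)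
        also have "D k \<omega> = D k \<omega>'" by (rule dep_D) (simp add: \<omega>'_def)
        finally show "x \<in> L k"
          using \<omega>(1) unfolding L_def by (intro UN_I[of \<omega>']) (auto simp: W_def \<omega>'_def)
      qed
      then have "outer_measure_of M (S m (b k)) \<le> outer_measure_of M (L k)"
        by (rule outer_measure_of_mono)
      then show ?thesis
        using F[of "b k"] sets_L by (simp add: S_F)
    qed
    have "decseq L"
    proof (rule decseq_SucI)
      show "L (Suc k) \<subseteq> L k" for k
        unfolding L_def D_def atMost_Suc by blast
    qed
    then have eq: "(INF k. emeasure M (L k)) = emeasure M (\<Inter>k. L k)"
      using sets_L by (intro INF_emeasure_decseq) auto
    have L_T: "(\<Inter>k. L k) = T []"
    proof (intro set_eqI iffI)
      fix x assume "x \<in> (\<Inter>k. L k)"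
      moreover from this have "x \<in> space M"
        using sets.sets_into_space[OF sets_L[of 0]] by blast
      ultimately show "x \<in> T []" unfolding L_def T_def by auto
    next
      fix x assume "x \<in> T []"
      then show "x \<in> (\<Inter>k. L k)" unfolding L_def T_def by auto
    qed
    have "a \<le> (INF k. emeasure M (L k))"
      using aL by (rule INF_greatest)
    then show "a \<le> emeasure M (T [])"
      by (simp only: eq L_T)
  qed
qed

section \<open>The Suslin operation and product-measurable sets\<close>

abbreviation baire_measure :: "(nat \<Rightarrow> nat) measure" where
  "baire_measure \<equiv> PiM UNIV (\<lambda>_. count_space UNIV)"

text \<open>Sets obtained by the Suslin operation from sets in \<open>M\<close>, with cylinders in the second
  coordinate.\<close>

definition tree_relation :: "'a measure \<Rightarrow> ('a \<times> (nat \<Rightarrow> nat)) set \<Rightarrow> bool" where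
  "tree_relation M A \<longleftrightarrow> (\<exists>G. (\<forall>k \<sigma> \<tau>. G k \<sigma> \<tau> \<in> sets M) \<and>
     (\<forall>k \<sigma> \<sigma>' \<tau> \<tau>'. (\<forall>i<k. \<sigma> i = \<sigma>' i \<and> \<tau> i = \<tau>' i) \<longrightarrow> G k \<sigma> \<tau> = G k \<sigma>' \<tau>') \<and>
     A = {(x, \<sigma>). \<exists>\<tau> :: nat \<Rightarrow> nat. \<forall>k :: nat. x \<in> G k \<sigma> \<tau>})"

text \<open>The \<open>j\<close>-th set may read any number \<open>n j\<close> of coordinates. The
  normal form is reached by delay: \<open>G' k\<close> collects the finitely many \<open>j\<close>
  with both \<open>j\<close> and \<open>n j\<close> at most \<open>k\<close>, and every
  \<open>j\<close> has been collected at \<open>k = max j (n j)\<close>.\<close>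

lemma tree_relationI:
  fixes G :: "nat \<Rightarrow> (nat \<Rightarrow> nat) \<Rightarrow> (nat \<Rightarrow> nat) \<Rightarrow> 'a set" and n :: "nat \<Rightarrow> nat"
  assumes sets_G: "\<And>j \<sigma> \<tau>. G j \<sigma> \<tau> \<in> sets M"
    and dep: "\<And>j \<sigma> \<sigma>' \<tau> \<tau>'. (\<And>i. i < n j \<Longrightarrow> \<sigma> i = \<sigma>' i \<and> \<tau> i = \<tau>' i) \<Longrightarrow> G j \<sigma> \<tau> = G j \<sigma>' \<tau>'"
    and A: "\<And>x \<sigma>. (x, \<sigma>) \<in> A \<longleftrightarrow> (\<exists>\<tau>. \<forall>j. x \<in> G j \<sigma> \<tau>)"
  shows "tree_relation M A"
proof -
  define G' where "G' k \<sigma> \<tau> = space M \<inter> (\<Inter>j\<in>{j. j \<le> k \<and> n j \<le> k}. G j \<sigma> \<tau>)" for k \<sigma> \<tau>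
  have "G' k \<sigma> \<tau> \<in> sets M" for k \<sigma> \<tau>
    unfolding G'_def using sets_G by (cases "{j. j \<le> k \<and> n j \<le> k} = {}") (auto intro!: sets.Int sets.finite_INT)
  moreover have "G' k \<sigma> \<tau> = G' k \<sigma>' \<tau>'" if "\<forall>i<k. \<sigma> i = \<sigma>' i \<and> \<tau> i = \<tau>' i" for k \<sigma> \<sigma>' \<tau> \<tau>'
  proof -
    have "G j \<sigma> \<tau> = G j \<sigma>' \<tau>'" if "n j \<le> k" for j
      using that \<open>\<forall>i<k. _\<close> by (intro dep) auto
    then show ?thesis by (auto simp: G'_def)
  qed
  moreover have "(\<forall>k. x \<in> G' k \<sigma> \<tau>) \<longleftrightarrow> (\<forall>j. x \<in> G j \<sigma> \<tau>)" for x \<sigma> \<tau>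
  proof
    assume *: "\<forall>k. x \<in> G' k \<sigma> \<tau>"
    have "x \<in> G j \<sigma> \<tau>" for j
      using *[rule_format, of "max j (n j)"] by (auto simp: G'_def)
    then show "\<forall>j. x \<in> G j \<sigma> \<tau>" ..
  next
    assume "\<forall>j. x \<in> G j \<sigma> \<tau>"
    moreover from this have "x \<in> space M"
      using sets.sets_into_space[OF sets_G[of 0 \<sigma> \<tau>]] by blast
    ultimately show "\<forall>k. x \<in> G' k \<sigma> \<tau>"
      by (auto simp: G'_def)
  qed
  ultimately show ?thesis
    unfolding tree_relation_def using A by (intro exI[of _ G']) (simp add: set_eq_iff)
qed

lemma tree_relation_familyE:
  assumes "\<And>n. tree_relation M (A n)"
  obtains G :: "'n \<Rightarrow> nat \<Rightarrow> (nat \<Rightarrow> nat) \<Rightarrow> (nat \<Rightarrow> nat) \<Rightarrow> 'a set"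
  where "\<And>n k \<sigma> \<tau>. G n k \<sigma> \<tau> \<in> sets M"
    "\<And>n k \<sigma> \<sigma>' \<tau> \<tau>'. (\<And>i. i < k \<Longrightarrow> \<sigma> i = \<sigma>' i \<and> \<tau> i = \<tau>' i) \<Longrightarrow> G n k \<sigma> \<tau> = G n k \<sigma>' \<tau>'"
    "\<And>n x \<sigma>. (x, \<sigma>) \<in> A n \<longleftrightarrow> (\<exists>\<tau>. \<forall>k. x \<in> G n k \<sigma> \<tau>)"
proof -
  have "\<forall>n. \<exists>G. (\<forall>k \<sigma> \<tau>. G k \<sigma> \<tau> \<in> sets M) \<and>
     (\<forall>k \<sigma> \<sigma>' \<tau> \<tau>'. (\<forall>i<k. \<sigma> i = \<sigma>' i \<and> \<tau> i = \<tau>' i) \<longrightarrow> G k \<sigma> \<tau> = G k \<sigma>' \<tau>') \<and>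
     A n = {(x, \<sigma>). \<exists>\<tau> :: nat \<Rightarrow> nat. \<forall>k :: nat. x \<in> G k \<sigma> \<tau>}"
    using assms unfolding tree_relation_def by (rule allI)
  from choice[OF this] obtain G where G: "\<And>n. (\<forall>k \<sigma> \<tau>. G n k \<sigma> \<tau> \<in> sets M) \<and>
     (\<forall>k \<sigma> \<sigma>' \<tau> \<tau>'. (\<forall>i<k. \<sigma> i = \<sigma>' i \<and> \<tau> i = \<tau>' i) \<longrightarrow> G n k \<sigma> \<tau> = G n k \<sigma>' \<tau>') \<and>
     A n = {(x, \<sigma>). \<exists>\<tau> :: nat \<Rightarrow> nat. \<forall>k :: nat. x \<in> G n k \<sigma> \<tau>}"
    by blast
  show thesis
    by (rule that[of G]) (use G in \<open>simp_all\<close>)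
qed

lemma tree_relation_coordinate:
  assumes "E \<in> sets M"
  shows "tree_relation M {(x, \<sigma>). x \<in> E \<and> R (\<sigma> i)}"
  using assms by (intro tree_relationI[where G = "\<lambda>_ \<sigma> _. if R (\<sigma> i) then E else {}" and n = "\<lambda>_. Suc i"]) auto

text \<open>A single witness \<open>\<tau>\<close> carries one witness for each \<open>n\<close>,
  stored at the positions \<open>prod_encode (n, i)\<close>; the conditions, indexed by
  \<open>n\<close> and \<open>k\<close>, are enumerated by the same pairing.\<close>

lemma tree_relation_INT:
  fixes A :: "nat \<Rightarrow> _"
  assumes "\<And>n. tree_relation M (A n)"
  shows "tree_relation M (\<Inter>n. A n)"
proof -
  obtain G :: "nat \<Rightarrow> nat \<Rightarrow> (nat \<Rightarrow> nat) \<Rightarrow> (nat \<Rightarrow> nat) \<Rightarrow> _ set" where G: "\<And>n k \<sigma> \<tau>. G n k \<sigma> \<tau> \<in> sets M"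
     "\<And>n k \<sigma> \<sigma>' \<tau> \<tau>'. (\<And>i. i < k \<Longrightarrow> \<sigma> i = \<sigma>' i \<and> \<tau> i = \<tau>' i) \<Longrightarrow> G n k \<sigma> \<tau> = G n k \<sigma>' \<tau>'"
     "\<And>n x \<sigma>. (x, \<sigma>) \<in> A n \<longleftrightarrow> (\<exists>\<tau>. \<forall>k. x \<in> G n k \<sigma> \<tau>)"
    using tree_relation_familyE[of M A, OF assms] by blast
  define c where "c j \<tau> = (\<lambda>i. \<tau> (prod_encode (j, i)))" for j and \<tau> :: "nat \<Rightarrow> nat"
  show ?thesis
  proof (rule tree_relationI)
    show "G (fst (prod_decode m)) (snd (prod_decode m)) \<sigma> (c (fst (prod_decode m)) \<tau>) \<in> sets M" for m \<sigma> \<tau>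
      by (rule G(1))
    \<comment> \<open>The reading bound covers the first \<open>k\<close> coordinates of
      \<open>\<sigma>\<close> and every position \<open>prod_encode (n, i)\<close> with
      \<open>i < k\<close>; the sum of successors is a crude bound for the largest of these.\<close>
    show "G (fst (prod_decode m)) (snd (prod_decode m)) \<sigma> (c (fst (prod_decode m)) \<tau>) =
        G (fst (prod_decode m)) (snd (prod_decode m)) \<sigma>' (c (fst (prod_decode m)) \<tau>')"
      if eq: "\<And>i. i < (case prod_decode m of (n, k) \<Rightarrow> k + (\<Sum>i<k. Suc (prod_encode (n, i)))) \<Longrightarrow> \<sigma> i = \<sigma>' i \<and> \<tau> i = \<tau>' i"
      for m \<sigma> \<sigma>' \<tau> \<tau>'
    proof (rule G(2))
      fix i assume i: "i < snd (prod_decode m)"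
      obtain n k where nk: "prod_decode m = (n, k)" by force
      have "Suc (prod_encode (n, i)) \<le> (\<Sum>i<k. Suc (prod_encode (n, i)))"
        using i nk by (intro member_le_sum) auto
      then show "\<sigma> i = \<sigma>' i \<and> c (fst (prod_decode m)) \<tau> i = c (fst (prod_decode m)) \<tau>' i"
        using eq[of i] eq[of "prod_encode (n, i)"] i by (simp add: nk c_def)
    qed
    fix x \<sigma>
    show "(x, \<sigma>) \<in> (\<Inter>n. A n) \<longleftrightarrow>
      (\<exists>\<tau>. \<forall>m. x \<in> G (fst (prod_decode m)) (snd (prod_decode m)) \<sigma> (c (fst (prod_decode m)) \<tau>))"
    proof
      assume "(x, \<sigma>) \<in> (\<Inter>n. A n)"
      then have "\<forall>n. \<exists>\<tau>. \<forall>k. x \<in> G n k \<sigma> \<tau>"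
        by (simp add: G(3))
      then obtain t where t: "\<And>n k. x \<in> G n k \<sigma> (t n)"
        by metis
      define \<tau> where "\<tau> m = t (fst (prod_decode m)) (snd (prod_decode m))" for m
      have "c n \<tau> = t n" for n
        by (simp add: c_def \<tau>_def)
      then show "\<exists>\<tau>. \<forall>m. x \<in> G (fst (prod_decode m)) (snd (prod_decode m)) \<sigma> (c (fst (prod_decode m)) \<tau>)"
        using t by (intro exI[of _ \<tau>]) simp
    next
      assume "\<exists>\<tau>. \<forall>m. x \<in> G (fst (prod_decode m)) (snd (prod_decode m)) \<sigma> (c (fst (prod_decode m)) \<tau>)"
      then obtain \<tau> where \<tau>: "x \<in> G (fst (prod_decode m)) (snd (prod_decode m)) \<sigma> (c (fst (prod_decode m)) \<tau>)" for m
        by blast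
      have "x \<in> G n k \<sigma> (c n \<tau>)" for n k
        using \<tau>[of "prod_encode (n, k)"] by simp
      then show "(x, \<sigma>) \<in> (\<Inter>n. A n)"
        by (auto simp: G(3))
    qed
  qed
qed

text \<open>The first entry of the witness names the index \<open>n\<close> and the shifted rest is
  a witness for \<open>A n\<close>; hence one more coordinate is read.\<close>

lemma tree_relation_UN:
  fixes A :: "nat \<Rightarrow> _"
  assumes "\<And>n. tree_relation M (A n)"
  shows "tree_relation M (\<Union>n. A n)"
proof -
  obtain G :: "nat \<Rightarrow> nat \<Rightarrow> (nat \<Rightarrow> nat) \<Rightarrow> (nat \<Rightarrow> nat) \<Rightarrow> _ set" where G: "\<And>n k \<sigma> \<tau>. G n k \<sigma> \<tau> \<in> sets M"
     "\<And>n k \<sigma> \<sigma>' \<tau> \<tau>'. (\<And>i. i < k \<Longrightarrow> \<sigma> i = \<sigma>' i \<and> \<tau> i = \<tau>' i) \<Longrightarrow> G n k \<sigma> \<tau> = G n k \<sigma>' \<tau>'"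
     "\<And>n x \<sigma>. (x, \<sigma>) \<in> A n \<longleftrightarrow> (\<exists>\<tau>. \<forall>k. x \<in> G n k \<sigma> \<tau>)"
    using tree_relation_familyE[of M A, OF assms] by blast
  show ?thesis
  proof (rule tree_relationI[where G = "\<lambda>k \<sigma> \<tau>. G (\<tau> 0) k \<sigma> (\<lambda>i. \<tau> (Suc i))" and n = Suc])
    show "G (\<tau> 0) k \<sigma> (\<lambda>i. \<tau> (Suc i)) \<in> sets M" for k \<sigma> \<tau>
      by (rule G(1))
    show "G (\<tau> 0) k \<sigma> (\<lambda>i. \<tau> (Suc i)) = G (\<tau>' 0) k \<sigma>' (\<lambda>i. \<tau>' (Suc i))"
      if eq: "\<And>i. i < Suc k \<Longrightarrow> \<sigma> i = \<sigma>' i \<and> \<tau> i = \<tau>' i" for k \<sigma> \<sigma>' and \<tau> \<tau>' :: "nat \<Rightarrow> nat"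
      using eq[of 0] eq by (auto intro!: G(2))
    fix x \<sigma>
    show "(x, \<sigma>) \<in> (\<Union>n. A n) \<longleftrightarrow> (\<exists>\<tau>. \<forall>k. x \<in> G (\<tau> 0) k \<sigma> (\<lambda>i. \<tau> (Suc i)))"
    proof
      assume "(x, \<sigma>) \<in> (\<Union>n. A n)"
      then obtain n \<tau> where "\<forall>k. x \<in> G n k \<sigma> \<tau>"
        by (auto simp: G(3))
      then show "\<exists>\<tau>. \<forall>k. x \<in> G (\<tau> 0) k \<sigma> (\<lambda>i. \<tau> (Suc i))"
        by (intro exI[of _ "case_nat n \<tau>"]) simp
    qed (auto simp: G(3))
  qed
qed

text \<open>Relations of this form need not be closed under complements. A sigma-algebra is obtained
  from those whose complement has the form as well: union and intersection then exchange
  roles.\<close>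

lemma tree_relation_sets_pair:
  assumes "A \<in> sets (M \<Otimes>\<^sub>M baire_measure)"
  shows "tree_relation M A"
proof -
  let ?\<Omega> = "space M \<times> (UNIV :: (nat \<Rightarrow> nat) set)"
  define \<T> where "\<T> = {A. A \<subseteq> ?\<Omega> \<and> tree_relation M A \<and> tree_relation M (?\<Omega> - A)}"
  have coord: "{(x, \<sigma>). x \<in> E \<and> R (\<sigma> i)} \<in> \<T>" if E: "E \<in> sets M" for E i and R :: "nat \<Rightarrow> bool"
  proof -
    have "?\<Omega> - {(x, \<sigma>). x \<in> E \<and> R (\<sigma> i)} = (\<Union>n::nat. if n = 0 then {(x, \<sigma>). x \<in> space M - E \<and> True}
        else {(x, \<sigma>). x \<in> space M \<and> \<not> R (\<sigma> i)})"
      using sets.sets_into_space[OF E] by (auto split: if_splits)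
    also have "tree_relation M \<dots>"
      using tree_relation_coordinate[of "space M - E" M "\<lambda>_. True" i] E
        tree_relation_coordinate[of "space M" M "\<lambda>n. \<not> R n" i]
      by (intro tree_relation_UN) auto
    finally show ?thesis
      using tree_relation_coordinate[OF E, of R i] sets.sets_into_space[OF E] by (auto simp: \<T>_def)
  qed
  have "sigma_algebra ?\<Omega> \<T>"
  proof (unfold sigma_algebra_iff2, intro conjI ballI allI impI)
    show "\<T> \<subseteq> Pow ?\<Omega>" by (auto simp: \<T>_def)
    show "{} \<in> \<T>" using coord[of "{}"] by simp
    show "?\<Omega> - A \<in> \<T>" if "A \<in> \<T>" for A
      using that by (auto simp: \<T>_def double_diff)
    fix A :: "nat \<Rightarrow> _" assume A: "range A \<subseteq> \<T>"
    then have A: "A n \<subseteq> ?\<Omega>" "tree_relation M (A n)" "tree_relation M (?\<Omega> - A n)" for n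
      by (auto simp: \<T>_def)
    have "tree_relation M (\<Inter>n. ?\<Omega> - A n)"
      using A(3) by (rule tree_relation_INT)
    also have "(\<Inter>n. ?\<Omega> - A n) = ?\<Omega> - (\<Union>n. A n)" by auto
    finally show "(\<Union>n. A n) \<in> \<T>"
      using A(1) tree_relation_UN[of M A, OF A(2)] by (auto simp: \<T>_def)
  qed
  then interpret sigma_algebra ?\<Omega> \<T> .
  \<comment> \<open>Both projections are measurable for \<open>N\<close>, so the identity is
    measurable into the product and every product-measurable set lies in
    \<open>\<T>\<close>.\<close>
  define N where "N = sigma ?\<Omega> \<T>"
  have N: "space N = ?\<Omega>" "sets N = \<T>"
    using sigma_sets_eq space_closed by (simp_all add: N_def space_measure_of sets_measure_of)
  have "fst \<in> N \<rightarrow>\<^sub>M M"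
  proof (rule measurableI)
    fix E assume E: "E \<in> sets M"
    have "fst -` E \<inter> space N = {(x, \<sigma>). x \<in> E \<and> True}"
      using sets.sets_into_space[OF E] by (auto simp: N)
    then show "fst -` E \<inter> space N \<in> sets N"
      using coord[OF E, of "\<lambda>_. True" 0] by (simp add: N)
  qed (auto simp: N)
  moreover have "snd \<in> N \<rightarrow>\<^sub>M baire_measure"
  proof (rule measurable_PiM_single')
    fix i :: nat
    show "(\<lambda>z. snd z i) \<in> N \<rightarrow>\<^sub>M count_space UNIV"
    proof (rule measurableI)
      fix B :: "nat set"
      have "(\<lambda>z. snd z i) -` B \<inter> space N = {(x, \<sigma>). x \<in> space M \<and> \<sigma> i \<in> B}"
        by (auto simp: N)
      then show "(\<lambda>z. snd z i) -` B \<inter> space N \<in> sets N"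
        using coord[OF sets.top, of "\<lambda>n. n \<in> B" i] by (simp add: N)
    qed simp
  qed simp
  ultimately have "(\<lambda>z. (fst z, snd z)) \<in> N \<rightarrow>\<^sub>M M \<Otimes>\<^sub>M baire_measure"
    by (rule measurable_Pair)
  from measurable_sets[OF this assms] have "A \<inter> space N \<in> \<T>"
    by (simp add: N vimage_def)
  moreover have "A \<subseteq> space N"
    using sets.sets_into_space[OF assms] by (auto simp: N space_pair_measure)
  ultimately show ?thesis
    by (simp add: \<T>_def Int_absorb2)
qed

text \<open>A single use of \<open>tree_selection\<close> covers the projection only up to a mass
  below its outer measure. Countably many selectors exhaust a measurable hull \<open>E\<close> up to
  a null set, which gives at once measurability for the completion and a selector on almost all of
  the projection.\<close>

theorem (in finite_measure) measurable_projection_selection: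
  assumes A: "A \<in> sets (M \<Otimes>\<^sub>M baire_measure)"
  shows "fst ` A \<in> sets (completion M)"
    and "\<exists>L\<in>sets M. \<exists>s\<in>M \<rightarrow>\<^sub>M baire_measure. fst ` A - L \<in> null_sets (completion M) \<and> (\<forall>x\<in>L. (x, s x) \<in> A)"
proof -
  obtain G :: "nat \<Rightarrow> (nat \<Rightarrow> nat) \<Rightarrow> (nat \<Rightarrow> nat) \<Rightarrow> 'a set" where
    G1: "\<forall>k \<sigma> \<tau>. G k \<sigma> \<tau> \<in> sets M" and
    G2: "\<forall>k \<sigma> \<sigma>' \<tau> \<tau>'. (\<forall>i<k. \<sigma> i = \<sigma>' i \<and> \<tau> i = \<tau>' i) \<longrightarrow> G k \<sigma> \<tau> = G k \<sigma>' \<tau>'" and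
    G3: "A = {(x, \<sigma>). \<exists>\<tau>. \<forall>k. x \<in> G k \<sigma> \<tau>}"
    using tree_relation_sets_pair[OF A] unfolding tree_relation_def by (elim exE conjE) (rule that)
  have G: "G k \<sigma> \<tau> \<in> sets M"
    "(\<And>i. i < k \<Longrightarrow> \<sigma> i = \<sigma>' i \<and> \<tau> i = \<tau>' i) \<Longrightarrow> G k \<sigma> \<tau> = G k \<sigma>' \<tau>'"
    "(x, \<sigma>) \<in> A \<longleftrightarrow> (\<exists>\<tau>. \<forall>k. x \<in> G k \<sigma> \<tau>)" for k \<sigma> \<sigma>' \<tau> \<tau>' x
    using G1 G2[rule_format, of k \<sigma> \<sigma>' \<tau> \<tau>'] by (auto simp: G3)
  \<comment> \<open>A point \<open>\<sigma>\<close> and its Suslin witness \<open>\<tau>\<close> are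
    interleaved into one branch, \<open>\<sigma>\<close> on the even positions; \<open>H k\<close>
    therefore reads \<open>2 * k\<close> coordinates.\<close>
  define H where "H k \<omega> = G k (\<lambda>i. \<omega> (2 * i)) (\<lambda>i. \<omega> (2 * i + 1))" for k and \<omega> :: "nat \<Rightarrow> nat"
  have S: "fst ` A = {x. \<exists>\<omega>. \<forall>k. x \<in> H k \<omega>}"
  proof (intro set_eqI iffI)
    fix x assume "x \<in> fst ` A"
    then obtain \<sigma> where "(x, \<sigma>) \<in> A" by auto
    then obtain \<tau> where \<tau>: "\<forall>k. x \<in> G k \<sigma> \<tau>"
      using G(3) by blast
    define \<omega> where "\<omega> i = (if even i then \<sigma> (i div 2) else \<tau> (i div 2))" for i
    have "\<forall>k. x \<in> H k \<omega>" using \<tau> by (simp add: H_def \<omega>_def)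
    then show "x \<in> {x. \<exists>\<omega>. \<forall>k. x \<in> H k \<omega>}" by blast
  next
    fix x assume "x \<in> {x. \<exists>\<omega>. \<forall>k. x \<in> H k \<omega>}"
    then obtain \<omega> where "\<forall>k. x \<in> H k \<omega>" by blast
    then have "(x, \<lambda>i. \<omega> (2 * i)) \<in> A" unfolding G(3) H_def by blast
    then show "x \<in> fst ` A" by force
  qed
  let ?S = "fst ` A"
  have S_sp: "?S \<subseteq> space M"
    using sets.sets_into_space[OF A] by (auto simp: space_pair_measure)
  obtain E where E: "E \<in> sets M" "?S \<subseteq> E" "outer_measure_of M ?S = emeasure M E"
    using outer_measure_of_attain[OF S_sp] by blast
  define P where "P n L s \<longleftrightarrow> L \<in> sets M \<and> ennreal (measure M E - 1 / real (Suc n)) \<le> emeasure M L \<and> s \<in> M \<rightarrow>\<^sub>M baire_measure \<and>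
      (\<forall>x\<in>L. (x, s x) \<in> A)" for n L s
  have "\<exists>L s. P n L s" for n
  proof (cases "0 < measure M E - 1 / real (Suc n)")
    case True
    then have "ennreal (measure M E - 1 / real (Suc n)) < outer_measure_of M ?S"
      unfolding E(3) emeasure_eq_measure by (subst ennreal_less_iff) auto
    then have a: "ennreal (measure M E - 1 / real (Suc n)) < outer_measure_of M {x. \<exists>\<omega>. \<forall>k. x \<in> H k \<omega>}"
      by (simp only: S)
    have H: "H k \<omega> \<in> sets M" "(\<And>i. i < 2 * k \<Longrightarrow> \<omega> i = \<omega>' i) \<Longrightarrow> H k \<omega> = H k \<omega>'" for k \<omega> \<omega>'
      unfolding H_def by (rule G(1), rule G(2)) simp
    have "mono (\<lambda>k :: nat. 2 * k)" by (simp add: mono_def)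
    from tree_selection[of H "\<lambda>k. 2 * k", OF H this a]
    obtain L s where L: "L \<in> sets M" "ennreal (measure M E - 1 / real (Suc n)) \<le> emeasure M L"
      "\<And>i. (\<lambda>x. s x i) \<in> M \<rightarrow>\<^sub>M count_space UNIV" "\<And>x k. x \<in> L \<Longrightarrow> x \<in> H k (s x)"
      by blast
    have "(\<lambda>x i. s x (2 * i)) \<in> M \<rightarrow>\<^sub>M baire_measure"
      using L(3) by (intro measurable_PiM_single') auto
    moreover have "(x, \<lambda>i. s x (2 * i)) \<in> A" if "x \<in> L" for x
      using L(4)[OF that] unfolding G(3) H_def by blast
    ultimately show ?thesis
      using L(1,2) unfolding P_def by blast
  next
    \<comment> \<open>A non-positive target has \<open>ennreal\<close> value 0 and is met by the
      empty set.\<close>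
    case False
    then show ?thesis
      by (intro exI[of _ "{}"] exI[of _ "\<lambda>_ _. 0"]) (auto simp: P_def ennreal_neg intro!: measurable_PiM_single')
  qed
  then obtain L s where "\<And>n. P n (L n) (s n)"
    by metis
  then have L: "\<And>n. L n \<in> sets M" "\<And>n. ennreal (measure M E - 1 / real (Suc n)) \<le> emeasure M (L n)"
    "\<And>n. s n \<in> M \<rightarrow>\<^sub>M baire_measure" "\<And>n x. x \<in> L n \<Longrightarrow> (x, s n x) \<in> A"
    unfolding P_def by blast+
  define LU where "LU = (\<Union>n. L n)"
  have LU: "LU \<in> sets M" "LU \<subseteq> ?S"
  proof -
    show "LU \<in> sets M" unfolding LU_def using L(1) by blast
    have "x \<in> ?S" if "x \<in> L n" for x n
      using imageI[OF L(4)[OF that], of fst] by simp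
    then show "LU \<subseteq> ?S" unfolding LU_def by blast
  qed
  have "measure M E \<le> measure M LU"
  proof (rule LIMSEQ_le_const2)
    show "(\<lambda>n. measure M E - 1 / real (Suc n)) \<longlonglongrightarrow> measure M E"
      using tendsto_diff[OF tendsto_const LIMSEQ_inverse_real_of_nat, of "measure M E"]
      by (simp add: inverse_eq_divide)
    have "measure M E - 1 / real (Suc n) \<le> measure M LU" for n
    proof -
      note L(2)[of n]
      also have "emeasure M (L n) \<le> emeasure M LU"
        using LU(1) by (intro emeasure_mono) (auto simp: LU_def)
      finally show ?thesis by (simp add: emeasure_eq_measure)
    qed
    then show "\<exists>N. \<forall>n\<ge>N. measure M E - 1 / real (Suc n) \<le> measure M LU" by blast
  qed
  moreover have "measure M (E - LU) = measure M E - measure M LU"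
    using LU E by (intro finite_measure_Diff) auto
  ultimately have "measure M (E - LU) = 0"
    using measure_nonneg[of M "E - LU"] by linarith
  then have null: "E - LU \<in> null_sets M"
    using LU E by (intro null_setsI) (auto simp: emeasure_eq_measure)
  then have null_c: "?S - LU \<in> null_sets (completion M)"
    using E(2) by (intro null_sets_completion_subset[of "?S - LU" "E - LU" M] null_sets_completionI Diff_mono order_refl)
  have "LU \<union> (?S - LU) \<in> sets (completion M)"
    using LU(1) by (intro sets.Un sets_completionI_sets null_setsD2[OF null_c])
  also have "LU \<union> (?S - LU) = ?S" using LU by auto
  finally show "?S \<in> sets (completion M)" .
  \<comment> \<open>The first index covering \<open>x\<close> decides which of the countably many
    selectors is used; off \<open>LU\<close> the value is arbitrary.\<close>
  define t where "t x = s (LEAST n. x \<in> L n) x" for x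
  have "(\<lambda>x. LEAST n. x \<in> L n) \<in> M \<rightarrow>\<^sub>M count_space UNIV"
    using L(1) by measurable
  with L(3) have "t \<in> M \<rightarrow>\<^sub>M baire_measure"
    unfolding t_def by (rule measurable_compose_countable)
  moreover have "(x, t x) \<in> A" if "x \<in> LU" for x
  proof -
    have "x \<in> L (LEAST n. x \<in> L n)"
      using that unfolding LU_def by (auto intro: LeastI)
    then show ?thesis unfolding t_def by (rule L(4))
  qed
  ultimately show "\<exists>L\<in>sets M. \<exists>s\<in>M \<rightarrow>\<^sub>M baire_measure. ?S - L \<in> null_sets (completion M) \<and> (\<forall>x\<in>L. (x, s x) \<in> A)"
    using LU(1) null_c by blast
qed

subsection \<open>Suslin spaces as images of the Baire space\<close>

lemma space_borel_of [simp]: "space (borel_of X) = topspace X"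
  by (simp add: borel_of_def space_measure_of_conv)

lemma sets_borel_of_openin: "openin X V \<Longrightarrow> V \<in> sets (borel_of X)"
  unfolding borel_of_def by (subst sets_measure_of) (auto dest: openin_subset)

lemma measurable_borel_ofI:
  assumes "\<And>x. x \<in> space M \<Longrightarrow> g x \<in> topspace X"
    and "\<And>V. openin X V \<Longrightarrow> g -` V \<inter> space M \<in> sets M"
  shows "g \<in> M \<rightarrow>\<^sub>M borel_of X"
  unfolding borel_of_def using assms by (intro measurable_measure_of) (auto dest: openin_subset)

lemma coordinates_sets_baire: "{\<sigma>. R (\<sigma> i) (\<sigma> j)} \<in> sets baire_measure"
proof -
  have 1: "{\<sigma>. R' (\<sigma> i)} \<in> sets baire_measure" for i and R' :: "nat \<Rightarrow> bool"
    using measurable_sets[OF measurable_component_singleton[of i UNIV "\<lambda>_. count_space UNIV"], of "Collect R'"]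
    by (simp add: vimage_def space_PiM)
  have "{\<sigma>. R (\<sigma> i) (\<sigma> j)} = (\<Union>n. {\<sigma>. \<sigma> i = n} \<inter> {\<sigma>. R n (\<sigma> j)})"
    by auto
  also have "\<dots> \<in> sets baire_measure"
    using 1 by (intro sets.countable_UN'' sets.Int) auto
  finally show ?thesis .
qed

text \<open>A point is coded by indices into a dense sequence with successive distances at most
  \<open>(1/2) ^ k\<close>. Completeness gives the limit, and membership of the limit in an open set
  is witnessed by a ball around one term, which is a condition on a single coordinate.\<close>

lemma Polish_space_parametrization:
  assumes "Polish_space P" and "topspace P \<noteq> {}"
  obtains q where "q \<in> baire_measure \<rightarrow>\<^sub>M borel_of P" "range q = topspace P"
proof -
  obtain M d where "Metric_space M d" and complete: "Metric_space.mcomplete M d"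
    and P: "P = Metric_space.mtopology M d"
    using assms unfolding Polish_space_def completely_metrizable_space_def by blast
  then interpret Metric_space M d by simp
  obtain C where C: "countable C" "C \<subseteq> M" "mtopology closure_of C = M"
    using assms unfolding Polish_space_def separable_space_def P by auto
  have "C \<noteq> {}" using C(3) assms(2) by (auto simp: P)
  define e where "e = from_nat_into C"
  have e_M: "e n \<in> M" for n
    using from_nat_into[OF \<open>C \<noteq> {}\<close>] C(2) unfolding e_def by blast
  have e_dense: "\<exists>n. d p (e n) < \<epsilon>" if "p \<in> M" "\<epsilon> > 0" for p \<epsilon>
  proof -
    have "p \<in> mtopology closure_of C" using that C(3) by simp
    then have "\<exists>y\<in>C. y \<in> mball p \<epsilon>"
      using that(2) unfolding metric_closure_of by blast
    then obtain y where "y \<in> C" "y \<in> mball p \<epsilon>" by blast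
    then show ?thesis
      using from_nat_into_surj[OF C(1), of y] unfolding e_def by (auto simp: in_mball)
  qed
  define D where "D = {\<sigma>. \<forall>k. d (e (\<sigma> k)) (e (\<sigma> (Suc k))) \<le> (1/2) ^ k}"
  have "D = (\<Inter>k. {\<sigma>. d (e (\<sigma> k)) (e (\<sigma> (Suc k))) \<le> (1/2) ^ k})"
    by (auto simp: D_def)
  also have "\<dots> \<in> sets baire_measure"
    using coordinates_sets_baire by (intro sets.countable_INT) auto
  finally have sets_D: "D \<in> sets baire_measure" .
  have step: "d (e (\<sigma> k)) (e (\<sigma> (k + m))) \<le> 2 * (1/2) ^ k - 2 * (1/2) ^ (k + m)" if "\<sigma> \<in> D" for \<sigma> k m
  proof (induction m)
    case 0
    then show ?case using e_M by simp
  next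
    case (Suc m)
    have "d (e (\<sigma> k)) (e (\<sigma> (k + Suc m))) \<le> d (e (\<sigma> k)) (e (\<sigma> (k + m))) + d (e (\<sigma> (k + m))) (e (\<sigma> (Suc (k + m))))"
      using e_M by (simp add: triangle)
    moreover have "d (e (\<sigma> (k + m))) (e (\<sigma> (Suc (k + m)))) \<le> (1/2) ^ (k + m)"
      using that by (simp add: D_def)
    ultimately show ?case using Suc by simp
  qed
  have step': "d (e (\<sigma> k)) (e (\<sigma> n)) \<le> 2 * (1/2) ^ k" if "\<sigma> \<in> D" "k \<le> n" for \<sigma> k n
  proof -
    have "0 \<le> (1/2 :: real) ^ n" by simp
    moreover have "d (e (\<sigma> k)) (e (\<sigma> n)) \<le> 2 * (1/2) ^ k - 2 * (1/2) ^ n"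
      using step[OF that(1), of k "n - k"] that(2) by simp
    ultimately show ?thesis by linarith
  qed
  have small: "\<exists>k. c * (1/2) ^ k < \<epsilon>" if "\<epsilon> > 0" "c > 0" for c \<epsilon> :: real
  proof -
    have "0 < \<epsilon> / c" using that by simp
    from real_arch_pow_inv[OF this, of "1/2"] obtain k where "(1/2) ^ k < \<epsilon> / c"
      by auto
    then show ?thesis using that by (auto simp: field_simps)
  qed
  have "\<exists>l. limitin mtopology (\<lambda>k. e (\<sigma> k)) l sequentially" if \<sigma>: "\<sigma> \<in> D" for \<sigma>
  proof -
    have "MCauchy (\<lambda>k. e (\<sigma> k))"
      unfolding MCauchy_def
    proof (intro conjI allI impI)
      show "range (\<lambda>k. e (\<sigma> k)) \<subseteq> M" using e_M by auto
      fix \<epsilon> :: real assume "\<epsilon> > 0"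
      then obtain N where N: "2 * (1/2) ^ N < \<epsilon>" using small[OF \<open>\<epsilon> > 0\<close>, of 2] by auto
      have "d (e (\<sigma> n)) (e (\<sigma> n')) < \<epsilon>" if "N \<le> n" "n \<le> n'" for n n'
      proof -
        have "d (e (\<sigma> n)) (e (\<sigma> n')) \<le> 2 * (1/2) ^ n" by (rule step'[OF \<sigma> that(2)])
        also have "\<dots> \<le> 2 * (1/2) ^ N"
          using that(1) by (intro mult_left_mono power_decreasing) auto
        finally show ?thesis using N by simp
      qed
      then show "\<exists>N. \<forall>n n'. N \<le> n \<longrightarrow> N \<le> n' \<longrightarrow> d (e (\<sigma> n)) (e (\<sigma> n')) < \<epsilon>"
        by (metis commute nle_le)
    qed
    then show ?thesis using complete unfolding mcomplete_def by blast
  qed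
  then obtain l where l: "\<And>\<sigma>. \<sigma> \<in> D \<Longrightarrow> limitin mtopology (\<lambda>k. e (\<sigma> k)) (l \<sigma>) sequentially"
    by metis
  have l_M: "l \<sigma> \<in> M" if "\<sigma> \<in> D" for \<sigma>
    using l[OF that] limitin_topspace by fastforce
  \<comment> \<open>The tail contributes at most \<open>2 * (1/2) ^ k\<close>; one further
    \<open>(1/2) ^ k\<close> absorbs the passage to the limit and keeps the inequality strict, as
    open balls require.\<close>
  have l_close: "d (e (\<sigma> k)) (l \<sigma>) < 3 * (1/2) ^ k" if \<sigma>: "\<sigma> \<in> D" for \<sigma> k
  proof -
    have "\<forall>\<^sub>F n in sequentially. e (\<sigma> n) \<in> M \<and> d (e (\<sigma> n)) (l \<sigma>) < (1/2) ^ k"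
      using l[OF \<sigma>] unfolding limitin_metric by (meson half_gt_zero zero_less_power zero_less_one)
    then obtain n where n: "n \<ge> k" "d (e (\<sigma> n)) (l \<sigma>) < (1/2) ^ k"
      unfolding eventually_sequentially by (meson nle_le)
    have "d (e (\<sigma> k)) (l \<sigma>) \<le> d (e (\<sigma> k)) (e (\<sigma> n)) + d (e (\<sigma> n)) (l \<sigma>)"
      by (intro triangle e_M l_M \<sigma>)
    then show ?thesis using step'[OF \<sigma> n(1)] n(2) by simp
  qed
  have l_onto: "\<exists>\<sigma>\<in>D. l \<sigma> = p" if p: "p \<in> M" for p
  proof -
    \<comment> \<open>With accuracy \<open>(1/2) ^ (k + 2)\<close>, two consecutive errors add up to
      less than \<open>(1/2) ^ k\<close>, so the approximating sequence lies in
      \<open>D\<close>.\<close>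
    have "\<forall>k. \<exists>n. d p (e n) < (1/2) ^ (k + 2)"
      by (intro allI e_dense p) simp
    then obtain \<sigma> where \<sigma>: "\<And>k. d p (e (\<sigma> k)) < (1/2) ^ (k + 2)" by metis
    have "d (e (\<sigma> k)) (e (\<sigma> (Suc k))) \<le> (1/2) ^ k" for k
    proof -
      have "d (e (\<sigma> k)) (e (\<sigma> (Suc k))) \<le> d (e (\<sigma> k)) p + d p (e (\<sigma> (Suc k)))"
        by (intro triangle e_M p)
      also have "\<dots> \<le> (1/2) ^ (k + 2) + (1/2) ^ (Suc k + 2)"
        using \<sigma>[of k] \<sigma>[of "Suc k"] by (simp add: commute)
      also have "\<dots> \<le> (1/2) ^ k" by (simp add: field_simps)
      finally show ?thesis .
    qed
    then have \<sigma>D: "\<sigma> \<in> D" by (simp add: D_def)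
    have "d (l \<sigma>) p \<le> \<epsilon>" if "\<epsilon> > 0" for \<epsilon>
    proof -
      obtain k where k: "4 * (1/2) ^ k < \<epsilon>" using small[OF \<open>\<epsilon> > 0\<close>, of 4] by auto
      have "d (l \<sigma>) p \<le> d (l \<sigma>) (e (\<sigma> k)) + d (e (\<sigma> k)) p"
        by (intro triangle e_M p l_M \<sigma>D)
      also have "\<dots> \<le> 3 * (1/2) ^ k + (1/2) ^ (k + 2)"
        using l_close[OF \<sigma>D, of k] \<sigma>[of k] by (simp add: commute)
      also have "\<dots> \<le> 4 * (1/2) ^ k" by (simp add: field_simps)
      finally show ?thesis using k by simp
    qed
    then have "d (l \<sigma>) p = 0"
      using nonneg[of "l \<sigma>" p] by (meson antisym dense_ge)
    then show ?thesis using \<sigma>D p l_M[OF \<sigma>D] by auto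
  qed
  obtain p0 where p0: "p0 \<in> M" using assms(2) by (auto simp: P)
  define q where "q \<sigma> = (if \<sigma> \<in> D then l \<sigma> else p0)" for \<sigma>
  show thesis
  proof (rule that)
    show "range q = topspace P"
    proof
      show "range q \<subseteq> topspace P" using l_M p0 by (auto simp: q_def P)
      show "topspace P \<subseteq> range q"
      proof
        fix p assume "p \<in> topspace P"
        then obtain \<sigma> where "\<sigma> \<in> D" "l \<sigma> = p" using l_onto[of p] by (auto simp: P)
        then show "p \<in> range q" by (intro range_eqI[of _ _ \<sigma>]) (simp add: q_def)
      qed
    qed
    show "q \<in> baire_measure \<rightarrow>\<^sub>M borel_of P"
    proof (rule measurable_borel_ofI)
      show "q \<sigma> \<in> topspace P" for \<sigma>
        using l_M p0 by (simp add: q_def P)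
      fix V assume V: "openin P V"
      define W where "W = (\<Union>k. {\<sigma>. mball (e (\<sigma> k)) (3 * (1/2) ^ k) \<subseteq> V})"
      have "l \<sigma> \<in> V \<longleftrightarrow> \<sigma> \<in> W" if \<sigma>: "\<sigma> \<in> D" for \<sigma>
      proof
        assume "l \<sigma> \<in> V"
        then obtain r where r: "r > 0" "mball (l \<sigma>) r \<subseteq> V"
          using V unfolding P openin_mtopology by blast
        \<comment> \<open>The factor 6 is the ball's radius factor 3 plus another 3 for the distance
          of its centre from the limit.\<close>
        obtain k where k: "6 * (1/2) ^ k < r" using small[OF r(1), of 6] by auto
        have "mball (e (\<sigma> k)) (3 * (1/2) ^ k) \<subseteq> mball (l \<sigma>) r"
        proof
          fix y assume "y \<in> mball (e (\<sigma> k)) (3 * (1/2) ^ k)"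
          then have y: "y \<in> M" "d (e (\<sigma> k)) y < 3 * (1/2) ^ k" by (auto simp: in_mball)
          have "d (l \<sigma>) y \<le> d (l \<sigma>) (e (\<sigma> k)) + d (e (\<sigma> k)) y"
            by (intro triangle e_M y l_M \<sigma>)
          also have "\<dots> < r"
            using y(2) l_close[OF \<sigma>, of k] k by (simp add: commute)
          finally show "y \<in> mball (l \<sigma>) r"
            using y(1) l_M[OF \<sigma>] by (simp add: in_mball)
        qed
        then show "\<sigma> \<in> W" using r(2) unfolding W_def by blast
      next
        assume "\<sigma> \<in> W"
        then obtain k where k: "mball (e (\<sigma> k)) (3 * (1/2) ^ k) \<subseteq> V"
          unfolding W_def by blast
        have "l \<sigma> \<in> mball (e (\<sigma> k)) (3 * (1/2) ^ k)"
          using l_close[OF \<sigma>] e_M l_M[OF \<sigma>] by (simp add: in_mball)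
        then show "l \<sigma> \<in> V" using k by blast
      qed
      then have "q -` V \<inter> space baire_measure = D \<inter> W \<union> (if p0 \<in> V then space baire_measure - D else {})"
        by (auto simp: q_def space_PiM split: if_splits)
      moreover have "W \<in> sets baire_measure"
        unfolding W_def using coordinates_sets_baire[of "\<lambda>i j. mball (e i) (3 * (1/2) ^ k) \<subseteq> V" for k]
        by (intro sets.countable_UN) auto
      ultimately show "q -` V \<inter> space baire_measure \<in> sets baire_measure"
        using sets_D by auto
    qed
  qed
qed

lemma Suslin_space_parametrization:
  assumes "Suslin_space X" and "topspace X \<noteq> {}"
  obtains p where "p \<in> baire_measure \<rightarrow>\<^sub>M borel_of X" "range p = topspace X"
proof -
  obtain P :: "real topology" and B g where P: "Polish_space P" and B: "B \<in> sets (borel_of P)"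
    and g: "continuous_map (subtopology P B) X g" "g ` B = topspace X"
    using assms(1) unfolding Suslin_space_def by blast
  have BP: "B \<subseteq> topspace P" using sets.sets_into_space[OF B] by simp
  have "B \<noteq> {}" using assms(2) g(2) by blast
  then have "topspace P \<noteq> {}" using BP by blast
  then obtain q where q: "q \<in> baire_measure \<rightarrow>\<^sub>M borel_of P" "range q = topspace P"
    using Polish_space_parametrization[OF P] by blast
  obtain x0 where x0: "x0 \<in> topspace X" using assms(2) by blast
  \<comment> \<open>\<open>g\<close> is controlled only on \<open>B\<close>. Sending the remaining
    codes to \<open>x0\<close> keeps the map measurable because \<open>B\<close> is Borel.\<close>
  define p where "p \<sigma> = (if q \<sigma> \<in> B then g (q \<sigma>) else x0)" for \<sigma>
  show thesis
  proof (rule that)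
    show range_p: "range p = topspace X"
    proof
      show "range p \<subseteq> topspace X" using g(2) x0 by (auto simp: p_def)
      show "topspace X \<subseteq> range p"
      proof
        fix x assume "x \<in> topspace X"
        then obtain b where b: "b \<in> B" "x = g b" using g(2) by blast
        then obtain \<sigma> where "q \<sigma> = b" using q(2) BP by (metis imageE subsetD)
        then show "x \<in> range p" using b by (intro range_eqI[of _ _ \<sigma>]) (simp add: p_def)
      qed
    qed
    show "p \<in> baire_measure \<rightarrow>\<^sub>M borel_of X"
    proof (rule measurable_borel_ofI)
      show "p \<sigma> \<in> topspace X" for \<sigma> using range_p by blast
      fix V assume "openin X V"
      from openin_continuous_map_preimage[OF g(1) this]
      obtain W where W: "openin P W" "{x \<in> topspace (subtopology P B). g x \<in> V} = W \<inter> B"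
        unfolding openin_subtopology by blast
      have "p -` V \<inter> space baire_measure = q -` (W \<inter> B) \<inter> space baire_measure \<union>
          (if x0 \<in> V then q -` (topspace P - B) \<inter> space baire_measure else {})"
      proof -
        have "p \<sigma> \<in> V \<longleftrightarrow> q \<sigma> \<in> W \<inter> B \<or> x0 \<in> V \<and> q \<sigma> \<in> topspace P - B" for \<sigma>
        proof -
          have "q \<sigma> \<in> topspace P" using q(2) by blast
          moreover have "q \<sigma> \<in> B \<and> g (q \<sigma>) \<in> V \<longleftrightarrow> q \<sigma> \<in> W \<inter> B"
            using W(2) BP by auto
          ultimately show ?thesis by (cases "q \<sigma> \<in> B") (auto simp: p_def)
        qed
        then show ?thesis by (auto simp: space_PiM)
      qed
      moreover have "W \<inter> B \<in> sets (borel_of P)" "topspace P - B \<in> sets (borel_of P)"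
        using W(1) B sets_borel_of_openin[of P] sets.compl_sets[OF B] by auto
      ultimately show "p -` V \<inter> space baire_measure \<in> sets baire_measure"
        using measurable_sets[OF q(1)] by (simp only:) (auto simp del: vimage_Int)
    qed
  qed
qed

subsection \<open>Duality for nonnegative functions\<close>

text \<open>The slope is the supremum of the chord slopes from \<open>(\<rho>, V)\<close> to points
  right of \<open>\<rho>\<close>, with 0 added to make it non-negative. A chord from a left point to
  a right point crosses abscissa \<open>\<rho>\<close> at height at most \<open>V\<close>, so every
  left slope dominates every right slope. The point \<open>(0, g0)\<close> lies on the left because
  \<open>\<rho> > 0\<close>, and makes the supremum finite.\<close>

lemma supporting_slope:
  fixes R :: "(real \<times> real) set"
  assumes mix: "\<And>r g r' g' p. (r, g) \<in> R \<Longrightarrow> (r', g') \<in> R \<Longrightarrow> 0 \<le> p \<Longrightarrow> p \<le> 1 \<Longrightarrow>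
      (p * r + (1 - p) * r', p * g + (1 - p) * g') \<in> R"
    and zero: "(0, g0) \<in> R" and "\<rho> > 0"
    and le: "\<And>r g. (r, g) \<in> R \<Longrightarrow> r \<le> \<rho> \<Longrightarrow> g \<le> V"
  obtains l where "l \<ge> 0" "\<And>r g. (r, g) \<in> R \<Longrightarrow> g + l * \<rho> \<le> V + l * r"
proof -
  define S where "S = insert 0 {(g - V) / (r - \<rho>) |r g. (r, g) \<in> R \<and> \<rho> < r}"
  have bound: "s \<le> (V - g) / (\<rho> - r)" if s: "s \<in> S" and rg: "(r, g) \<in> R" "r < \<rho>" for s r g
  proof (cases "s = 0")
    case True
    then show ?thesis using le[OF rg(1)] rg(2) by simp
  next
    case False
    then obtain r' g' where *: "s = (g' - V) / (r' - \<rho>)" "(r', g') \<in> R" "\<rho> < r'"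
      using s unfolding S_def by blast
    \<comment> \<open>The weight that places the mixture of the two points exactly at abscissa
      \<open>\<rho>\<close>.\<close>
    define p where "p = (r' - \<rho>) / (r' - r)"
    have p: "0 \<le> p" "p \<le> 1" "1 - p = (\<rho> - r) / (r' - r)"
      using * rg by (auto simp: p_def field_simps)
    have "p * r + (1 - p) * r' = \<rho>"
    proof -
      have "p * (r' - r) = r' - \<rho>" using * rg by (simp add: p_def)
      then show ?thesis by (simp add: algebra_simps)
    qed
    then have "p * g + (1 - p) * g' \<le> V"
      using le[OF mix[OF rg(1) *(2) p(1,2)]] by simp
    then have "(r' - r) * (p * g + (1 - p) * g') \<le> (r' - r) * V"
      using * rg by (intro mult_left_mono) auto
    moreover have "(r' - r) * (p * g + (1 - p) * g') = (r' - \<rho>) * g + (\<rho> - r) * g'"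
      using * rg unfolding p(3) by (simp add: p_def distrib_left)
    ultimately have "(g' - V) * (\<rho> - r) \<le> (V - g) * (r' - \<rho>)"
      by (simp add: algebra_simps)
    then show ?thesis
      using * rg unfolding *(1)
      by (simp add: pos_divide_le_eq pos_le_divide_eq times_divide_eq_left del: times_divide_eq_right)
  qed
  have bdd: "bdd_above S"
    using bound[OF _ zero] \<open>\<rho> > 0\<close> unfolding bdd_above_def by blast
  define l where "l = Sup S"
  show thesis
  proof (rule that)
    show "l \<ge> 0" unfolding l_def using bdd by (rule cSup_upper[rotated]) (simp add: S_def)
    fix r g assume rg: "(r, g) \<in> R"
    consider "r < \<rho>" | "r = \<rho>" | "\<rho> < r" by linarith
    then show "g + l * \<rho> \<le> V + l * r"
    proof cases
      case 1
      have "l \<le> (V - g) / (\<rho> - r)"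
        unfolding l_def
      proof (rule cSup_least)
        show "S \<noteq> {}" by (simp add: S_def)
      qed (rule bound[OF _ rg 1])
      then have "l * (\<rho> - r) \<le> V - g" using 1 by (simp add: pos_le_divide_eq)
      then show ?thesis by (simp add: algebra_simps)
    next
      case 2
      then show ?thesis using le[OF rg] by simp
    next
      case 3
      have "(g - V) / (r - \<rho>) \<le> l"
        unfolding l_def using rg 3 bdd by (intro cSup_upper) (auto simp: S_def)
      then have "g - V \<le> l * (r - \<rho>)" using 3 by (simp add: pos_divide_le_eq)
      then show ?thesis by (simp add: algebra_simps)
    qed
  qed
qed

locale transport_problem = prob_space \<mu> for \<mu> :: "'a measure" +
  fixes X :: "'a topology" and c :: "'a \<Rightarrow> 'a \<Rightarrow> ennreal" and G :: "'a \<Rightarrow> ennreal"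
  assumes Suslin: "Suslin_space X"
    and sets_mu [measurable_cong]: "sets \<mu> = sets (borel_of X)"
    and c_measurable: "(\<lambda>z. c (fst z) (snd z)) \<in> borel_measurable (borel_of X \<Otimes>\<^sub>M borel_of X)"
    and c_diag: "\<And>x. x \<in> topspace X \<Longrightarrow> c x x = 0"
    and G_measurable: "G \<in> borel_measurable (borel_of X)"

lemma transport_problemI:
  assumes "Suslin_space X" "prob_space \<mu>" "sets \<mu> = sets (borel_of X)"
    "(\<lambda>z. c (fst z) (snd z)) \<in> borel_measurable (borel_of X \<Otimes>\<^sub>M borel_of X)"
    "\<And>x. x \<in> topspace X \<Longrightarrow> c x x = 0"
    "G \<in> borel_measurable (borel_of X)"
  shows "transport_problem \<mu> X c G"
  using assms by (simp add: transport_problem_def transport_problem_axioms_def)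

context transport_problem
begin

lemma space_mu: "space \<mu> = topspace X"
  using sets_eq_imp_space_eq[OF sets_mu] by simp

lemma sets_pair_mu: "sets (\<mu> \<Otimes>\<^sub>M \<mu>) = sets (borel_of X \<Otimes>\<^sub>M borel_of X)"
  by (intro sets_pair_measure_cong sets_mu)

lemma c_meas [measurable]: "(\<lambda>z. c (fst z) (snd z)) \<in> borel_measurable (\<mu> \<Otimes>\<^sub>M \<mu>)"
  using c_measurable measurable_cong_sets[OF sets_pair_mu refl] by blast

lemma G_meas [measurable]: "G \<in> borel_measurable \<mu>"
  using G_measurable measurable_cong_sets[OF sets_mu refl] by blast

text \<open>The second factor is parametrised by \<open>p\<close>. As \<open>p\<close> is onto, the
  pulled-back set has the same projection, and a selector into sequences becomes one into
  \<open>X\<close> after composition with \<open>p\<close>.\<close>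

lemma selection:
  assumes A: "A \<in> sets (\<mu> \<Otimes>\<^sub>M \<mu>)"
  shows "fst ` A \<in> sets (completion \<mu>)"
    and "\<exists>L\<in>sets \<mu>. \<exists>s\<in>\<mu> \<rightarrow>\<^sub>M \<mu>. fst ` A - L \<in> null_sets (completion \<mu>) \<and> (\<forall>x\<in>L. (x, s x) \<in> A)"
proof -
  have "topspace X \<noteq> {}" using not_empty by (simp add: space_mu)
  then obtain p where "p \<in> baire_measure \<rightarrow>\<^sub>M borel_of X" and range_p: "range p = topspace X"
    using Suslin_space_parametrization[OF Suslin] by blast
  then have p[measurable]: "p \<in> baire_measure \<rightarrow>\<^sub>M \<mu>"
    using measurable_cong_sets[OF refl sets_mu] by blast
  define A' where "A' = (\<lambda>z. (fst z, p (snd z))) -` A \<inter> space (\<mu> \<Otimes>\<^sub>M baire_measure)"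
  have A': "A' \<in> sets (\<mu> \<Otimes>\<^sub>M baire_measure)"
    unfolding A'_def using A by (rule measurable_sets[rotated]) measurable
  have A_sp: "A \<subseteq> space \<mu> \<times> space \<mu>"
    using sets.sets_into_space[OF A] by (simp add: space_pair_measure)
  have fst: "fst ` A' = fst ` A"
  proof (intro set_eqI iffI)
    fix x assume "x \<in> fst ` A"
    then obtain y where y: "(x, y) \<in> A" by auto
    then have "y \<in> range p" using A_sp by (auto simp: range_p space_mu)
    then obtain \<sigma> where "y = p \<sigma>" by blast
    then have "(x, \<sigma>) \<in> A'" using y A_sp by (auto simp: A'_def space_pair_measure space_PiM)
    then show "x \<in> fst ` A'" by (metis fst_conv image_eqI)
  qed (auto simp: A'_def image_iff, metis fst_conv)
  show "fst ` A \<in> sets (completion \<mu>)"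
    using measurable_projection_selection(1)[OF A'] by (simp add: fst)
  obtain L s where "L \<in> sets \<mu>" and s: "s \<in> \<mu> \<rightarrow>\<^sub>M baire_measure"
    "fst ` A - L \<in> null_sets (completion \<mu>)" "\<forall>x\<in>L. (x, s x) \<in> A'"
    using measurable_projection_selection(2)[OF A'] unfolding fst by blast
  then show "\<exists>L\<in>sets \<mu>. \<exists>s\<in>\<mu> \<rightarrow>\<^sub>M \<mu>. fst ` A - L \<in> null_sets (completion \<mu>) \<and> (\<forall>x\<in>L. (x, s x) \<in> A)"
    using measurable_compose[OF s(1) p] by (intro bexI[of _ L] bexI[of _ "\<lambda>x. p (s x)"]) (auto simp: A'_def)
qed

text \<open>With \<open>G\<close> equal to \<open>q + B\<close> and \<open>l \<ge> 0\<close>, this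
  is the positive part of \<open>B\<close> plus the penalized value of \<open>q\<close>: subtraction
  in \<open>ennreal\<close> stops at 0, and infinite cost, whose penalized value is minus infinity,
  is sent to 0 as well.\<close>

definition gain :: "real \<Rightarrow> 'a \<Rightarrow> 'a \<Rightarrow> ennreal" where
  "gain l x y = (if c x y = \<infinity> then 0 else G y - ennreal l * c x y)"

definition psi :: "real \<Rightarrow> 'a \<Rightarrow> ennreal" where
  "psi l x = (SUP y\<in>topspace X. gain l x y)"

lemma gain_meas [measurable]: "(\<lambda>z. gain l (fst z) (snd z)) \<in> borel_measurable (\<mu> \<Otimes>\<^sub>M \<mu>)"
  unfolding gain_def by measurable

text \<open>A superlevel set of a supremum over \<open>y\<close> is the projection of a
  product-measurable set; projection yields measurability for the completion.\<close>

lemma psi_meas: "psi l \<in> borel_measurable (completion \<mu>)"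
proof (rule borel_measurableI_greater)
  fix a
  have "{x \<in> space \<mu>. a < psi l x} = fst ` {z \<in> space (\<mu> \<Otimes>\<^sub>M \<mu>). a < gain l (fst z) (snd z)}"
    by (auto simp: psi_def less_SUP_iff space_mu space_pair_measure image_iff; blast)
  also have "\<dots> \<in> sets (completion \<mu>)"
    by (intro selection(1)) measurable
  finally show "{x \<in> space (completion \<mu>). a < psi l x} \<in> sets (completion \<mu>)"
    by (simp only: space_completion)
qed

lemma psi_borel_version:
  obtains h where "h \<in> borel_measurable \<mu>" "AE x in \<mu>. psi l x = h x"
  using completion_ex_borel_measurable[OF psi_meas] by blast

lemma weak_duality:
  assumes P: "P \<in> ambiguity_set X c \<mu> \<rho>" and "\<rho> \<ge> 0" "l \<ge> 0"
  shows "(\<integral>\<^sup>+ y. G y \<partial>P) \<le> ennreal (l * \<rho>) + (\<integral>\<^sup>+ x. psi l x \<partial>\<mu>)"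
proof (rule ennreal_le_epsilon)
  fix e :: real assume "e > 0"
  \<comment> \<open>The infimum over couplings need not be attained, so a coupling of cost below
    \<open>\<rho> + e'\<close> is used. Dividing by \<open>l + 1\<close> rather than
    \<open>l\<close> also serves \<open>l = 0\<close>.\<close>
  define e' where "e' = e / (l + 1)"
  have e': "e' > 0" "l * e' \<le> e"
    using \<open>e > 0\<close> \<open>l \<ge> 0\<close> by (auto simp: e'_def field_simps)
  have sets_P[measurable_cong]: "sets P = sets \<mu>"
    using P sets_mu by (simp add: ambiguity_set_def)
  have "Kantorovich c \<mu> P \<le> ennreal \<rho>"
    using P by (simp add: ambiguity_set_def)
  also have "\<dots> < ennreal (\<rho> + e')"
    using \<open>\<rho> \<ge> 0\<close> e'(1) by (simp add: ennreal_less_iff)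
  finally obtain \<gamma> where \<gamma>: "\<gamma> \<in> couplings \<mu> P" and cost: "(\<integral>\<^sup>+ z. c (fst z) (snd z) \<partial>\<gamma>) < ennreal (\<rho> + e')"
    unfolding Kantorovich_def INF_less_iff by blast
  have sets_\<gamma>[measurable_cong]: "sets \<gamma> = sets (\<mu> \<Otimes>\<^sub>M \<mu>)"
    using \<gamma> sets_pair_measure_cong[OF refl sets_P] by (simp add: couplings_def)
  have marg: "distr \<gamma> \<mu> fst = \<mu>" "distr \<gamma> P snd = P"
    using \<gamma> by (auto simp: couplings_def)
  \<comment> \<open>\<open>psi l\<close> is measurable only for the completion of
    \<open>\<mu>\<close>. It is replaced by a Borel version, and the first marginal carries the
    almost sure equality over to the coupling.\<close>
  obtain h where h[measurable]: "h \<in> borel_measurable \<mu>" and psi_h: "AE x in \<mu>. psi l x = h x"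
    by (rule psi_borel_version)
  have AE_psi: "AE z in \<gamma>. psi l (fst z) = h (fst z)"
    by (rule AE_distrD[of fst \<gamma> \<mu>, unfolded marg(1), OF _ psi_h]) measurable
  \<comment> \<open>Finite total cost makes the cost finite almost everywhere, so that the
    exceptional case of \<open>gain\<close> does not occur and the subtraction in it can be
    undone.\<close>
  have AE_c: "AE z in \<gamma>. c (fst z) (snd z) \<noteq> \<infinity>"
    using cost by (intro nn_integral_noteq_infinite) auto
  have space_\<gamma>: "space \<gamma> = space \<mu> \<times> space \<mu>"
    using sets_eq_imp_space_eq[OF sets_\<gamma>] by (simp add: space_pair_measure)
  have "(\<integral>\<^sup>+ y. G y \<partial>P) = (\<integral>\<^sup>+ y. G y \<partial>distr \<gamma> P snd)"
    by (simp add: marg)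
  also have "\<dots> = (\<integral>\<^sup>+ z. G (snd z) \<partial>\<gamma>)"
    by (rule nn_integral_distr) measurable
  also have "\<dots> \<le> (\<integral>\<^sup>+ z. h (fst z) + ennreal l * c (fst z) (snd z) \<partial>\<gamma>)"
  proof (rule nn_integral_mono_AE)
    show "AE z in \<gamma>. G (snd z) \<le> h (fst z) + ennreal l * c (fst z) (snd z)"
      using AE_psi AE_c AE_space
    proof eventually_elim
      case (elim z)
      then have "snd z \<in> topspace X" by (auto simp: space_\<gamma> space_mu)
      then have "gain l (fst z) (snd z) \<le> psi l (fst z)"
        unfolding psi_def by (rule SUP_upper)
      then have "G (snd z) - ennreal l * c (fst z) (snd z) \<le> h (fst z)"
        using elim by (simp add: gain_def)
      moreover have "ennreal l * c (fst z) (snd z) \<noteq> \<infinity>"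
        using elim by (simp add: ennreal_mult_eq_top_iff)
      ultimately show ?case
        by (simp add: ennreal_minus_le_iff add.commute)
    qed
  qed
  also have "\<dots> = (\<integral>\<^sup>+ z. h (fst z) \<partial>\<gamma>) + ennreal l * (\<integral>\<^sup>+ z. c (fst z) (snd z) \<partial>\<gamma>)"
    by (simp add: nn_integral_add nn_integral_cmult)
  also have "(\<integral>\<^sup>+ z. h (fst z) \<partial>\<gamma>) = (\<integral>\<^sup>+ x. h x \<partial>distr \<gamma> \<mu> fst)"
    by (rule nn_integral_distr[symmetric]) measurable
  also have "\<dots> = (\<integral>\<^sup>+ x. psi l x \<partial>\<mu>)"
    unfolding marg using psi_h by (intro nn_integral_cong_AE) auto
  also have "ennreal l * (\<integral>\<^sup>+ z. c (fst z) (snd z) \<partial>\<gamma>) \<le> ennreal l * ennreal (\<rho> + e')"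
    using cost by (intro mult_left_mono) auto
  also have "\<dots> = ennreal (l * \<rho> + l * e')"
    using \<open>l \<ge> 0\<close> \<open>\<rho> \<ge> 0\<close> e' by (simp add: ennreal_mult[symmetric] distrib_left)
  also have "\<dots> \<le> ennreal (l * \<rho> + e)"
    using e' by (intro ennreal_leI) simp
  also have "\<dots> = ennreal (l * \<rho>) + ennreal e"
    using \<open>l \<ge> 0\<close> \<open>\<rho> \<ge> 0\<close> \<open>e > 0\<close> by (intro ennreal_plus) auto
  finally show "(\<integral>\<^sup>+ y. G y \<partial>P) \<le> ennreal (l * \<rho>) + (\<integral>\<^sup>+ x. psi l x \<partial>\<mu>) + ennreal e"
    by (simp add: ac_simps add_left_mono)
qed

text \<open>The adversary's distribution and its coupling with \<open>\<mu>\<close> are chosen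
  together: the free second marginal is the distribution. On this convex set cost and gain are both
  affine, whereas the Kantorovich cost hides an infimum.\<close>

definition plans :: "('a \<times> 'a) measure set" where
  "plans = {\<gamma>. prob_space \<gamma> \<and> sets \<gamma> = sets (\<mu> \<Otimes>\<^sub>M \<mu>) \<and> distr \<gamma> \<mu> fst = \<mu>}"

text \<open>The plan is itself a coupling of \<open>\<mu>\<close> with its second marginal, so its
  cost bounds the Kantorovich infimum.\<close>

lemma ambiguity_set_plan:
  assumes \<gamma>: "\<gamma> \<in> plans" and cost: "(\<integral>\<^sup>+ z. c (fst z) (snd z) \<partial>\<gamma>) \<le> ennreal \<rho>"
  shows "distr \<gamma> \<mu> snd \<in> ambiguity_set X c \<mu> \<rho>"
    and "(\<integral>\<^sup>+ y. G y \<partial>distr \<gamma> \<mu> snd) = (\<integral>\<^sup>+ z. G (snd z) \<partial>\<gamma>)"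
proof -
  have sets_\<gamma>[measurable_cong]: "sets \<gamma> = sets (\<mu> \<Otimes>\<^sub>M \<mu>)" and "prob_space \<gamma>"
    using \<gamma> by (auto simp: plans_def)
  let ?P = "distr \<gamma> \<mu> snd"
  have snd[measurable]: "snd \<in> \<gamma> \<rightarrow>\<^sub>M \<mu>" by measurable
  have "prob_space ?P"
    using \<open>prob_space \<gamma>\<close> snd by (rule prob_space.prob_space_distr)
  have "distr \<gamma> ?P snd = ?P"
    by (intro distr_cong) auto
  then have "\<gamma> \<in> couplings \<mu> ?P"
    using \<gamma> sets_pair_measure_cong[OF refl sets_distr[of \<gamma> \<mu> snd]] by (simp add: plans_def couplings_def)
  then have "Kantorovich c \<mu> ?P \<le> ennreal \<rho>"
    unfolding Kantorovich_def using cost by (rule INF_lower2)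
  then show "?P \<in> ambiguity_set X c \<mu> \<rho>"
    using \<open>prob_space ?P\<close> sets_mu by (simp add: ambiguity_set_def)
  show "(\<integral>\<^sup>+ y. G y \<partial>?P) = (\<integral>\<^sup>+ z. G (snd z) \<partial>\<gamma>)"
    by (rule nn_integral_distr) measurable
qed

section \<open>Plans carried by maps, and mixtures of plans\<close>

lemma graph_plan:
  assumes T[measurable]: "T \<in> \<mu> \<rightarrow>\<^sub>M \<mu>"
  shows "distr \<mu> (\<mu> \<Otimes>\<^sub>M \<mu>) (\<lambda>x. (x, T x)) \<in> plans"
    and "f \<in> borel_measurable (\<mu> \<Otimes>\<^sub>M \<mu>) \<Longrightarrow>
      (\<integral>\<^sup>+ z. f z \<partial>distr \<mu> (\<mu> \<Otimes>\<^sub>M \<mu>) (\<lambda>x. (x, T x))) = (\<integral>\<^sup>+ x. f (x, T x) \<partial>\<mu>)"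
proof -
  have "distr (distr \<mu> (\<mu> \<Otimes>\<^sub>M \<mu>) (\<lambda>x. (x, T x))) \<mu> fst = distr \<mu> \<mu> (\<lambda>x. x)"
    by (subst distr_distr) (auto simp: comp_def)
  also have "\<dots> = \<mu>" by (rule distr_id)
  finally show "distr \<mu> (\<mu> \<Otimes>\<^sub>M \<mu>) (\<lambda>x. (x, T x)) \<in> plans"
    by (simp add: plans_def prob_space_distr)
  show "(\<integral>\<^sup>+ z. f z \<partial>distr \<mu> (\<mu> \<Otimes>\<^sub>M \<mu>) (\<lambda>x. (x, T x))) = (\<integral>\<^sup>+ x. f (x, T x) \<partial>\<mu>)"
    if "f \<in> borel_measurable (\<mu> \<Otimes>\<^sub>M \<mu>)"
  proof (rule nn_integral_distr)
    show "(\<lambda>x. (x, T x)) \<in> \<mu> \<rightarrow>\<^sub>M \<mu> \<Otimes>\<^sub>M \<mu>" by measurable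
    show "f \<in> borel_measurable (distr \<mu> (\<mu> \<Otimes>\<^sub>M \<mu>) (\<lambda>x. (x, T x)))"
      using that by (simp only: measurable_distr_eq1)
  qed
qed

text \<open>Mass that stays in place pays only diagonal costs. This plan is the strictly feasible
  point behind the multiplier, and it also shows that the ambiguity set is non-empty.\<close>

lemma diagonal_plan: "\<exists>\<gamma>\<in>plans. (\<integral>\<^sup>+ z. c (fst z) (snd z) \<partial>\<gamma>) = 0"
proof
  show "distr \<mu> (\<mu> \<Otimes>\<^sub>M \<mu>) (\<lambda>x. (x, x)) \<in> plans" (is "?\<gamma> \<in> _")
    by (rule graph_plan(1)) simp
  have "(\<integral>\<^sup>+ z. c (fst z) (snd z) \<partial>?\<gamma>) = (\<integral>\<^sup>+ x. c x x \<partial>\<mu>)"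
    by (subst graph_plan(2)[of "\<lambda>x. x"]) auto
  also have "\<dots> = (\<integral>\<^sup>+ x. 0 \<partial>\<mu>)"
    by (intro nn_integral_cong) (simp add: c_diag space_mu)
  finally show "(\<integral>\<^sup>+ z. c (fst z) (snd z) \<partial>?\<gamma>) = 0" by simp
qed

lemma ambiguity_set_nonempty: "ambiguity_set X c \<mu> \<rho> \<noteq> {}"
  using diagonal_plan ambiguity_set_plan(1)[of _ \<rho>] by fastforce

text \<open>The convex combination is built as a two-stage experiment, a Bernoulli choice followed
  by one of the two plans. Integrals are then averages by \<open>nn_integral_bind\<close>; total
  mass and first marginal follow by integrating 1 and indicators.\<close>

lemma plans_mixture:
  assumes \<gamma>: "\<gamma> \<in> plans" "\<gamma>' \<in> plans" and p: "0 \<le> p" "p \<le> 1"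
  obtains \<delta> where "\<delta> \<in> plans"
    "\<And>f. f \<in> borel_measurable (\<mu> \<Otimes>\<^sub>M \<mu>) \<Longrightarrow>
      (\<integral>\<^sup>+ z. f z \<partial>\<delta>) = ennreal p * (\<integral>\<^sup>+ z. f z \<partial>\<gamma>) + ennreal (1 - p) * (\<integral>\<^sup>+ z. f z \<partial>\<gamma>')"
proof -
  let ?Z = "\<mu> \<Otimes>\<^sub>M \<mu>"
  define N where "N b = (if b then \<gamma> else \<gamma>')" for b
  define \<delta> where "\<delta> = measure_pmf (bernoulli_pmf p) \<bind> N"
  have N_sp: "N b \<in> space (prob_algebra ?Z)" for b
    using \<gamma> by (auto simp: N_def plans_def space_prob_algebra)
  have N: "N \<in> measure_pmf (bernoulli_pmf p) \<rightarrow>\<^sub>M prob_algebra ?Z"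
    using N_sp by simp
  have int: "(\<integral>\<^sup>+ z. f z \<partial>\<delta>) = ennreal p * (\<integral>\<^sup>+ z. f z \<partial>\<gamma>) + ennreal (1 - p) * (\<integral>\<^sup>+ z. f z \<partial>\<gamma>')"
    if f: "f \<in> borel_measurable ?Z" for f
  proof -
    have "(\<integral>\<^sup>+ z. f z \<partial>\<delta>) = (\<integral>\<^sup>+ b. \<integral>\<^sup>+ z. f z \<partial>N b \<partial>measure_pmf (bernoulli_pmf p))"
      unfolding \<delta>_def using f measurable_prob_algebraD[OF N] by (rule nn_integral_bind)
    also have "\<dots> = (\<Sum>b\<in>UNIV. (\<integral>\<^sup>+ z. f z \<partial>N b) * ennreal (pmf (bernoulli_pmf p) b))"
      by (rule nn_integral_measure_pmf_support) auto
    finally show ?thesis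
      using p by (simp add: N_def UNIV_bool mult.commute add.commute)
  qed
  have sets_\<delta>[measurable_cong]: "sets \<delta> = sets ?Z"
    unfolding \<delta>_def using measurable_prob_algebraD[OF N] by (rule sets_bind_measurable) simp
  have "prob_space \<delta>"
  proof
    have "emeasure \<delta> (space \<delta>) = (\<integral>\<^sup>+ z. 1 \<partial>\<delta>)" by simp
    also have "\<dots> = ennreal p * (\<integral>\<^sup>+ z. 1 \<partial>\<gamma>) + ennreal (1 - p) * (\<integral>\<^sup>+ z. 1 \<partial>\<gamma>')"
      by (rule int) simp
    also have "\<dots> = ennreal p + ennreal (1 - p)"
      using \<gamma> by (simp add: plans_def prob_space.emeasure_space_1)
    also have "\<dots> = 1"
      using p by (simp flip: ennreal_plus)
    finally show "emeasure \<delta> (space \<delta>) = 1" .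
  qed
  moreover have "distr \<delta> \<mu> fst = \<mu>"
  proof (rule measure_eqI)
    fix E assume "E \<in> sets (distr \<delta> \<mu> fst)"
    then have E[measurable]: "E \<in> sets \<mu>" by simp
    have marg: "(\<integral>\<^sup>+ z. indicator E (fst z) \<partial>\<kappa>) = emeasure \<mu> E" if "\<kappa> \<in> plans" for \<kappa>
    proof -
      have [measurable_cong]: "sets \<kappa> = sets ?Z" and "distr \<kappa> \<mu> fst = \<mu>"
        using that by (auto simp: plans_def)
      have "(\<integral>\<^sup>+ z. indicator E (fst z) \<partial>\<kappa>) = (\<integral>\<^sup>+ x. indicator E x \<partial>distr \<kappa> \<mu> fst)"
        by (rule nn_integral_distr[symmetric]) measurable
      then show ?thesis using \<open>distr \<kappa> \<mu> fst = \<mu>\<close> by simp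
    qed
    have "emeasure (distr \<delta> \<mu> fst) E = (\<integral>\<^sup>+ x. indicator E x \<partial>distr \<delta> \<mu> fst)"
      by simp
    also have "\<dots> = (\<integral>\<^sup>+ z. indicator E (fst z) \<partial>\<delta>)"
      by (rule nn_integral_distr) measurable
    also have "\<dots> = ennreal p * emeasure \<mu> E + ennreal (1 - p) * emeasure \<mu> E"
      by (subst int) (auto simp: marg \<gamma>)
    also have "\<dots> = (ennreal p + ennreal (1 - p)) * emeasure \<mu> E"
      by (simp add: distrib_right)
    also have "ennreal p + ennreal (1 - p) = 1"
      using p by (simp flip: ennreal_plus)
    finally show "emeasure (distr \<delta> \<mu> fst) E = emeasure \<mu> E" by simp
  qed simp
  ultimately have "\<delta> \<in> plans" using sets_\<delta> by (simp add: plans_def)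
  then show thesis using int by (rule that)
qed

text \<open>\<open>psi l\<close> may be infinite and its supremum need not be attained, hence the
  truncation at \<open>N\<close> and the slack \<open>\<epsilon>\<close>. The inequality is kept
  additive: its solution set is product-measurable, projects onto almost all of the space, and can
  be integrated without subtracting possibly infinite terms.\<close>

lemma approximate_selection:
  assumes h[measurable]: "h \<in> borel_measurable \<mu>" and psi_h: "AE x in \<mu>. psi l x = h x"
    and "l \<ge> 0" "\<epsilon> > 0"
  obtains L s where "L \<in> sets \<mu>" "s \<in> \<mu> \<rightarrow>\<^sub>M \<mu>" "AE x in \<mu>. x \<in> L"
    "\<And>x. x \<in> L \<Longrightarrow> c x (s x) \<noteq> \<infinity>"
    "\<And>x. x \<in> L \<Longrightarrow> min (h x) (of_nat N) + ennreal l * c x (s x) \<le> G (s x) + ennreal \<epsilon>"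
proof -
  define A where "A = {z \<in> space (\<mu> \<Otimes>\<^sub>M \<mu>). c (fst z) (snd z) \<noteq> \<infinity> \<and>
    min (h (fst z)) (of_nat N) + ennreal l * c (fst z) (snd z) \<le> G (snd z) + ennreal \<epsilon>}"
  have A: "A \<in> sets (\<mu> \<Otimes>\<^sub>M \<mu>)"
    unfolding A_def by measurable
  obtain L s where L: "L \<in> sets \<mu>" "s \<in> \<mu> \<rightarrow>\<^sub>M \<mu>" "fst ` A - L \<in> null_sets (completion \<mu>)"
    "\<And>x. x \<in> L \<Longrightarrow> (x, s x) \<in> A"
    using selection(2)[OF A] by blast
  have fst_A: "x \<in> fst ` A" if x: "x \<in> space \<mu>" and eq: "psi l x = h x" for x
  proof -
    define m where "m = min (h x) (of_nat N)"
    have "m \<le> of_nat N" by (simp add: m_def)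
    also have "\<dots> < \<infinity>" by (simp add: of_nat_less_top)
    finally obtain a where a: "m = ennreal a" "a \<ge> 0" by (cases m) auto
    show ?thesis
    \<comment> \<open>In the first case \<open>y = x\<close> serves, because
      \<open>c x x = 0\<close>. Otherwise \<open>m\<close> exceeds \<open>\<epsilon>\<close>, so the
      truncated difference \<open>m - \<epsilon>\<close> is strictly below \<open>psi l x\<close>
      and some \<open>y\<close> beats it.\<close>
    proof (cases "m \<le> G x + ennreal \<epsilon>")
      case True
      then have "(x, x) \<in> A"
        using x c_diag[of x] by (simp add: A_def m_def space_pair_measure space_mu)
      then show ?thesis by force
    next
      case False
      then have "ennreal \<epsilon> < m" by (metis add_increasing2 le_less_linear not_less order_less_imp_le zero_le add.commute)
      then have m_diff: "m - ennreal \<epsilon> = ennreal (a - \<epsilon>)" and "\<epsilon> < a"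
        using \<open>\<epsilon> > 0\<close> by (auto simp: a ennreal_minus ennreal_less_iff)
      then have "m - ennreal \<epsilon> < m"
        using \<open>\<epsilon> > 0\<close> by (simp add: a ennreal_less_iff)
      also have "m \<le> psi l x" by (simp add: m_def eq)
      finally obtain y where y: "y \<in> topspace X" "m - ennreal \<epsilon> < gain l x y"
        by (auto simp: psi_def less_SUP_iff)
      have c_fin: "c x y \<noteq> \<infinity>"
        using y(2) by (auto simp: gain_def split: if_splits)
      then have "m - ennreal \<epsilon> < G y - ennreal l * c x y" and lc: "ennreal l * c x y \<noteq> \<infinity>"
        using y(2) by (auto simp: gain_def ennreal_mult_eq_top_iff)
      moreover from lc obtain b where b: "ennreal l * c x y = ennreal b" "b \<ge> 0"
        by (cases "ennreal l * c x y") auto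
      ultimately have "m + ennreal l * c x y \<le> G y + ennreal \<epsilon>"
        using \<open>\<epsilon> > 0\<close> \<open>\<epsilon> < a\<close> unfolding m_diff
        by (cases "G y") (auto simp: a ennreal_minus ennreal_less_iff simp flip: ennreal_plus)
      then have "(x, y) \<in> A"
        using x y c_fin by (simp add: A_def m_def space_pair_measure space_mu)
      then show ?thesis by force
    qed
  qed
  have "AE x in completion \<mu>. x \<notin> fst ` A - L"
    using L(3) by (rule AE_not_in)
  then have "AE x in \<mu>. x \<notin> fst ` A - L"
    by (simp only: AE_completion_iff)
  then have "AE x in \<mu>. x \<in> L"
    using psi_h AE_space by eventually_elim (use fst_A in auto)
  then show thesis
    using L by (intro that[of L s]) (auto simp: A_def)
qed

text \<open>The supporting line is available only for real pairs, so finite cost must first be shown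
  to force finite gain. Afterwards the approximations are removed from the inside out: the cost
  cutoff \<open>K\<close> by monotone convergence, then the slack \<open>\<epsilon>\<close>, and
  finally the truncation \<open>N\<close> of \<open>psi l\<close>.\<close>

lemma strong_duality:
  assumes "\<rho> > 0"
    and fin: "(SUP P\<in>ambiguity_set X c \<mu> \<rho>. \<integral>\<^sup>+ y. G y \<partial>P) < \<infinity>"
  shows "\<exists>l\<ge>0. ennreal (l * \<rho>) + (\<integral>\<^sup>+ x. psi l x \<partial>\<mu>) \<le> (SUP P\<in>ambiguity_set X c \<mu> \<rho>. \<integral>\<^sup>+ y. G y \<partial>P)"
proof -
  define V where "V = enn2real (SUP P\<in>ambiguity_set X c \<mu> \<rho>. \<integral>\<^sup>+ y. G y \<partial>P)"
  have V: "(SUP P\<in>ambiguity_set X c \<mu> \<rho>. \<integral>\<^sup>+ y. G y \<partial>P) = ennreal V" "V \<ge> 0"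
    using fin by (auto simp: V_def)
  let ?cost = "\<lambda>\<gamma>. \<integral>\<^sup>+ z. c (fst z) (snd z) \<partial>\<gamma>" and ?gain = "\<lambda>\<gamma>. \<integral>\<^sup>+ z. G (snd z) \<partial>\<gamma>"
  have gain_V: "?gain \<gamma> \<le> ennreal V" if "\<gamma> \<in> plans" "?cost \<gamma> \<le> ennreal \<rho>" for \<gamma>
    using SUP_upper[OF ambiguity_set_plan(1)[OF that], of "\<lambda>P. \<integral>\<^sup>+ y. G y \<partial>P"] ambiguity_set_plan(2)[OF that]
    by (simp add: V)
  obtain \<gamma>0 where \<gamma>0: "\<gamma>0 \<in> plans" "?cost \<gamma>0 = 0"
    using diagonal_plan by blast
  have gain_fin: "?gain \<gamma> < \<infinity>" if \<gamma>: "\<gamma> \<in> plans" and cost_fin: "?cost \<gamma> < \<infinity>" for \<gamma>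
  proof -
    obtain r where r: "r \<ge> 0" "?cost \<gamma> = ennreal r"
      using cost_fin by (cases "?cost \<gamma>") auto
    \<comment> \<open>Mixing with the zero-cost plan at this weight brings the cost down to
      \<open>p * r\<close>, within the budget, and keeps the positive fraction \<open>p\<close> of
      the gain of \<open>\<gamma>\<close>, which must therefore be finite.\<close>
    define p where "p = \<rho> / (\<rho> + r)"
    have p: "0 < p" "p \<le> 1" "p * r \<le> \<rho>"
    proof -
      show "0 < p" "p \<le> 1" using r(1) \<open>\<rho> > 0\<close> by (auto simp: p_def)
      have "p * r = \<rho> * (r / (\<rho> + r))" by (simp add: p_def)
      also have "\<dots> \<le> \<rho> * 1" using r(1) \<open>\<rho> > 0\<close> by (intro mult_left_mono) auto
      finally show "p * r \<le> \<rho>" by simp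
    qed
    obtain \<delta> where \<delta>: "\<delta> \<in> plans"
      "\<And>f. f \<in> borel_measurable (\<mu> \<Otimes>\<^sub>M \<mu>) \<Longrightarrow>
        (\<integral>\<^sup>+ z. f z \<partial>\<delta>) = ennreal p * (\<integral>\<^sup>+ z. f z \<partial>\<gamma>) + ennreal (1 - p) * (\<integral>\<^sup>+ z. f z \<partial>\<gamma>0)"
      using plans_mixture[OF \<gamma> \<gamma>0(1), of p] p by auto
    have "?cost \<delta> = ennreal (p * r)"
      using p(1) r(1) by (simp add: \<delta>(2)[OF c_meas] \<gamma>0(2) r(2) ennreal_mult)
    then have "?gain \<delta> \<le> ennreal V"
      using p(3) by (intro gain_V \<delta>(1)) (simp add: ennreal_leI)
    moreover have "ennreal p * ?gain \<gamma> \<le> ?gain \<delta>"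
      by (subst \<delta>(2)) auto
    ultimately have "ennreal p * ?gain \<gamma> < \<infinity>"
      by (simp add: order.strict_trans1)
    then show ?thesis
      using p(1) by (auto simp: ennreal_mult_less_top)
  qed
  define R where "R = {(r, g). 0 \<le> r \<and> 0 \<le> g \<and> (\<exists>\<gamma>\<in>plans. ?cost \<gamma> = ennreal r \<and> ?gain \<gamma> = ennreal g)}"
  have R_plan: "(enn2real (?cost \<gamma>), enn2real (?gain \<gamma>)) \<in> R" if "\<gamma> \<in> plans" "?cost \<gamma> < \<infinity>" for \<gamma>
    using that gain_fin[OF that] by (auto simp: R_def intro!: bexI[of _ \<gamma>])
  have R_mix: "(p * r + (1 - p) * r', p * g + (1 - p) * g') \<in> R"
    if R: "(r, g) \<in> R" "(r', g') \<in> R" and p: "0 \<le> p" "p \<le> 1" for r g r' g' p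
  proof -
    obtain \<gamma> \<gamma>' where \<gamma>: "\<gamma> \<in> plans" "?cost \<gamma> = ennreal r" "?gain \<gamma> = ennreal g"
      and \<gamma>': "\<gamma>' \<in> plans" "?cost \<gamma>' = ennreal r'" "?gain \<gamma>' = ennreal g'"
      and pos: "0 \<le> r" "0 \<le> g" "0 \<le> r'" "0 \<le> g'"
      using R unfolding R_def by blast
    obtain \<delta> where \<delta>: "\<delta> \<in> plans"
      "\<And>f. f \<in> borel_measurable (\<mu> \<Otimes>\<^sub>M \<mu>) \<Longrightarrow>
        (\<integral>\<^sup>+ z. f z \<partial>\<delta>) = ennreal p * (\<integral>\<^sup>+ z. f z \<partial>\<gamma>) + ennreal (1 - p) * (\<integral>\<^sup>+ z. f z \<partial>\<gamma>')"
      using plans_mixture[OF \<gamma>(1) \<gamma>'(1) p] by blast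
    have "?cost \<delta> = ennreal (p * r + (1 - p) * r')"
      using p pos by (simp add: \<delta>(2)[OF c_meas] \<gamma> \<gamma>' ennreal_mult ennreal_plus)
    moreover have "?gain \<delta> = ennreal (p * g + (1 - p) * g')"
      using p pos by (subst \<delta>(2)) (auto simp: \<gamma> \<gamma>' ennreal_mult ennreal_plus)
    ultimately show ?thesis
      using \<delta>(1) p pos by (auto simp: R_def)
  qed
  have R_le: "g \<le> V" if rg: "(r, g) \<in> R" and "r \<le> \<rho>" for r g
  proof -
    obtain \<gamma> where \<gamma>: "\<gamma> \<in> plans" "?cost \<gamma> = ennreal r" "?gain \<gamma> = ennreal g"
      using rg unfolding R_def by blast
    then show ?thesis
      using gain_V[OF \<gamma>(1)] \<open>r \<le> \<rho>\<close> V(2) by (simp add: ennreal_leI)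
  qed
  have zero: "(0, enn2real (?gain \<gamma>0)) \<in> R"
    using R_plan[OF \<gamma>0(1)] \<gamma>0(2) by simp
  obtain l where l: "l \<ge> 0" "\<And>r g. (r, g) \<in> R \<Longrightarrow> g + l * \<rho> \<le> V + l * r"
    by (rule supporting_slope[of R, OF R_mix zero \<open>\<rho> > 0\<close> R_le]) blast+
  obtain h where h[measurable]: "h \<in> borel_measurable \<mu>" and psi_h: "AE x in \<mu>. psi l x = h x"
    by (rule psi_borel_version)
  have bound: "(\<integral>\<^sup>+ x. min (h x) (of_nat N) \<partial>\<mu>) + ennreal (l * \<rho>) \<le> ennreal V + ennreal \<epsilon>" if "\<epsilon> > 0" for N :: nat and \<epsilon>
  proof -
    obtain L s where L[measurable]: "L \<in> sets \<mu>" "s \<in> \<mu> \<rightarrow>\<^sub>M \<mu>" and AE_L: "AE x in \<mu>. x \<in> L"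
      and c_fin: "\<And>x. x \<in> L \<Longrightarrow> c x (s x) \<noteq> \<infinity>"
      and sel: "\<And>x. x \<in> L \<Longrightarrow> min (h x) (of_nat N) + ennreal l * c x (s x) \<le> G (s x) + ennreal \<epsilon>"
      using approximate_selection[OF h psi_h l(1) \<open>\<epsilon> > 0\<close>] by blast
    have c_s[measurable]: "(\<lambda>x. c x (s x)) \<in> borel_measurable \<mu>"
      using measurable_compose[OF _ c_meas, of "\<lambda>x. (x, s x)" \<mu>] by simp
    text \<open>Truncating the selection where its cost exceeds \<open>K\<close> gives a plan of finite cost, so that
      \<open>l * cost\<close> can be cancelled.\<close>
    define S where "S K = {x \<in> space \<mu>. x \<in> L \<and> c x (s x) \<le> of_nat K}" for K :: nat
    have S[measurable]: "S K \<in> sets \<mu>" for K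
      unfolding S_def by measurable
    let ?m = "\<lambda>K x. indicator (S K) x * min (h x) (of_nat N)"
    have "(\<integral>\<^sup>+ x. ?m K x \<partial>\<mu>) + ennreal (l * \<rho>) \<le> ennreal V + ennreal \<epsilon>" for K
    proof -
      \<comment> \<open>Off \<open>S K\<close> the mass stays put at no cost, so the cost of the
        plan is at most \<open>K\<close>; there the integrand \<open>?m K\<close> is 0 and the
        integrated inequality is trivial.\<close>
      define T where "T x = (if x \<in> S K then s x else x)" for x
      have T[measurable]: "T \<in> \<mu> \<rightarrow>\<^sub>M \<mu>"
        unfolding T_def by measurable
      have c_T[measurable]: "(\<lambda>x. c x (T x)) \<in> borel_measurable \<mu>"
        using measurable_compose[OF _ c_meas, of "\<lambda>x. (x, T x)" \<mu>] by simp
      let ?\<gamma> = "distr \<mu> (\<mu> \<Otimes>\<^sub>M \<mu>) (\<lambda>x. (x, T x))"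
      have cost: "?cost ?\<gamma> = (\<integral>\<^sup>+ x. c x (T x) \<partial>\<mu>)"
        by (subst graph_plan(2)[OF T]) auto
      have gain: "?gain ?\<gamma> = (\<integral>\<^sup>+ x. G (T x) \<partial>\<mu>)"
        by (subst graph_plan(2)[OF T]) auto
      have "?cost ?\<gamma> \<le> (\<integral>\<^sup>+ x. of_nat K \<partial>\<mu>)"
        unfolding cost by (intro nn_integral_mono) (auto simp: T_def S_def c_diag space_mu)
      also have "\<dots> < \<infinity>"
        by (simp add: emeasure_space_1 of_nat_less_top)
      finally have fin: "?cost ?\<gamma> < \<infinity>" .
      obtain r where r: "?cost ?\<gamma> = ennreal r" "0 \<le> r"
        using fin by (cases "?cost ?\<gamma>") auto
      obtain g where g: "?gain ?\<gamma> = ennreal g" "0 \<le> g"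
        using gain_fin[OF graph_plan(1)[OF T] fin] by (cases "?gain ?\<gamma>") auto
      have "(r, g) \<in> R"
        using r g graph_plan(1)[OF T] by (auto simp: R_def)
      then have lin: "g + l * \<rho> \<le> V + l * r" by (rule l(2))
      have "(\<integral>\<^sup>+ x. ?m K x \<partial>\<mu>) \<le> (\<integral>\<^sup>+ x. of_nat N \<partial>\<mu>)"
        by (intro nn_integral_mono) (auto simp: indicator_def)
      also have "\<dots> < \<infinity>"
        by (simp add: emeasure_space_1 of_nat_less_top)
      finally obtain a where a: "(\<integral>\<^sup>+ x. ?m K x \<partial>\<mu>) = ennreal a" "0 \<le> a"
        by (cases "\<integral>\<^sup>+ x. ?m K x \<partial>\<mu>") auto
      have "(\<integral>\<^sup>+ x. ?m K x + ennreal l * c x (T x) \<partial>\<mu>) \<le> (\<integral>\<^sup>+ x. G (T x) + ennreal \<epsilon> \<partial>\<mu>)"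
        using sel by (intro nn_integral_mono) (auto simp: T_def S_def c_diag space_mu indicator_def)
      also have "\<dots> = ennreal g + ennreal \<epsilon>"
        using gain g by (simp add: nn_integral_add emeasure_space_1)
      also have "(\<integral>\<^sup>+ x. ?m K x + ennreal l * c x (T x) \<partial>\<mu>) = ennreal a + ennreal l * ennreal r"
        using cost r a by (simp add: nn_integral_add nn_integral_cmult)
      finally have "a + l * r \<le> g + \<epsilon>"
        using a(2) l(1) r(2) g(2) \<open>\<epsilon> > 0\<close> by (simp flip: ennreal_plus ennreal_mult)
      \<comment> \<open>Adding the two linear inequalities cancels \<open>g\<close> and the finite
        number \<open>l * r\<close>.\<close>
      with lin have "a + l * \<rho> \<le> V + \<epsilon>" by simp
      then show ?thesis
        unfolding a(1) using a(2) l(1) \<open>\<rho> > 0\<close> V(2) \<open>\<epsilon> > 0\<close> by (simp add: ennreal_leI flip: ennreal_plus)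
    qed
    \<comment> \<open>The selected points have finite cost, so almost every \<open>x\<close> lies in
      \<open>S K\<close> for large \<open>K\<close> and the full integral is recovered.\<close>
    moreover have "(\<integral>\<^sup>+ x. min (h x) (of_nat N) \<partial>\<mu>) = (SUP K. \<integral>\<^sup>+ x. ?m K x \<partial>\<mu>)"
    proof -
      have "(\<integral>\<^sup>+ x. min (h x) (of_nat N) \<partial>\<mu>) = (\<integral>\<^sup>+ x. (SUP K. ?m K x) \<partial>\<mu>)"
      proof (rule nn_integral_cong_AE)
        show "AE x in \<mu>. min (h x) (of_nat N) = (SUP K. ?m K x)"
          using AE_L AE_space
        proof eventually_elim
          case (elim x)
          then have "c x (s x) < (SUP K. of_nat K)"
            using c_fin[of x] by (simp add: ennreal_SUP_of_nat_eq_top less_top)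
          then obtain K where K: "c x (s x) \<le> of_nat K"
            by (auto simp: less_SUP_iff dest: less_imp_le)
          show ?case
          proof (rule antisym)
            show "min (h x) (of_nat N) \<le> (SUP K. ?m K x)"
              using elim K by (intro SUP_upper2[of K]) (auto simp: S_def)
            show "(SUP K. ?m K x) \<le> min (h x) (of_nat N)"
              by (rule SUP_least) (simp add: indicator_def)
          qed
        qed
      qed
      also have "\<dots> = (SUP K. \<integral>\<^sup>+ x. ?m K x \<partial>\<mu>)"
      proof (rule nn_integral_monotone_convergence_SUP)
        have "S K \<subseteq> S K'" if "K \<le> K'" for K K'
        proof -
          have "of_nat K \<le> (of_nat K' :: ennreal)" using that by simp
          then show ?thesis by (auto simp: S_def intro: order_trans)
        qed
        then show "incseq ?m"
          by (auto simp: incseq_def le_fun_def indicator_def)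
      qed measurable
      finally show ?thesis .
    qed
    ultimately show ?thesis
      by (simp add: ennreal_SUP_add_left[symmetric] SUP_least)
  qed
  have bound': "(\<integral>\<^sup>+ x. min (h x) (of_nat N) \<partial>\<mu>) + ennreal (l * \<rho>) \<le> ennreal V" for N :: nat
    by (rule ennreal_le_epsilon) (rule bound)
  \<comment> \<open>The truncations exhaust \<open>psi l\<close> also where it is infinite, since
    the bound just obtained is uniform in \<open>N\<close>, it passes to the whole integral.\<close>
  have "(\<integral>\<^sup>+ x. psi l x \<partial>\<mu>) = (\<integral>\<^sup>+ x. (SUP N. min (h x) (of_nat N)) \<partial>\<mu>)"
  proof (rule nn_integral_cong_AE)
    show "AE x in \<mu>. psi l x = (SUP N. min (h x) (of_nat N))"
      using psi_h
    proof eventually_elim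
      case (elim x)
      have "h x \<le> (SUP N. min (h x) (of_nat N))"
        unfolding le_SUP_iff
      proof (intro allI impI)
        fix y assume "y < h x"
        moreover from this top_greatest have "y < top" by (rule less_le_trans)
        then have "y < (SUP N. of_nat N)" by (simp only: ennreal_SUP_of_nat_eq_top)
        ultimately show "\<exists>N\<in>UNIV. y < min (h x) (of_nat N)"
          by (auto simp: less_SUP_iff)
      qed
      moreover have "(SUP N. min (h x) (of_nat N)) \<le> h x"
        by (rule SUP_least) simp
      ultimately show ?case using elim by simp
    qed
  qed
  also have "\<dots> = (SUP N. \<integral>\<^sup>+ x. min (h x) (of_nat N) \<partial>\<mu>)"
    by (rule nn_integral_monotone_convergence_SUP)
       (auto simp: incseq_def le_fun_def min.coboundedI2 intro: min.mono)
  finally have "(\<integral>\<^sup>+ x. psi l x \<partial>\<mu>) + ennreal (l * \<rho>) \<le> ennreal V"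
    using bound' by (simp add: ennreal_SUP_add_left[symmetric] SUP_least)
  then show ?thesis
    unfolding V(1) using l(1) by (intro exI[of _ l]) (simp add: add.commute)
qed

theorem duality:
  assumes "\<rho> > 0"
  shows "(SUP P\<in>ambiguity_set X c \<mu> \<rho>. \<integral>\<^sup>+ y. G y \<partial>P) = (INF l\<in>{0..}. ennreal (l * \<rho>) + (\<integral>\<^sup>+ x. psi l x \<partial>\<mu>))"
proof (rule antisym)
  show "(SUP P\<in>ambiguity_set X c \<mu> \<rho>. \<integral>\<^sup>+ y. G y \<partial>P) \<le> (INF l\<in>{0..}. ennreal (l * \<rho>) + (\<integral>\<^sup>+ x. psi l x \<partial>\<mu>))"
    using assms by (intro SUP_least INF_greatest weak_duality) auto
  show "(INF l\<in>{0..}. ennreal (l * \<rho>) + (\<integral>\<^sup>+ x. psi l x \<partial>\<mu>)) \<le> (SUP P\<in>ambiguity_set X c \<mu> \<rho>. \<integral>\<^sup>+ y. G y \<partial>P)"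
  proof (cases "(SUP P\<in>ambiguity_set X c \<mu> \<rho>. \<integral>\<^sup>+ y. G y \<partial>P) < \<infinity>")
    case True
    from strong_duality[OF assms this] show ?thesis
      by (auto intro: INF_lower2)
  next
    case False
    then have "(SUP P\<in>ambiguity_set X c \<mu> \<rho>. \<integral>\<^sup>+ y. G y \<partial>P) = top"
      by (simp only: not_less infinity_ennreal_def top_unique)
    then show ?thesis by (simp only: top_greatest)
  qed
qed

end

subsection \<open>Duality for expectations of functions bounded below\<close>

text \<open>\<open>enn2ereal\<close> is an order isomorphism onto the non-negative extended reals.
  The empty supremum is excluded because it is 0 on one side and minus infinity on the
  other.\<close>

lemma enn2ereal_SUP:
  assumes "A \<noteq> {}"
  shows "enn2ereal (SUP i\<in>A. f i) = (SUP i\<in>A. enn2ereal (f i))"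
proof (rule antisym)
  let ?S = "SUP i\<in>A. enn2ereal (f i)"
  have "0 \<le> ?S"
    using assms by (auto intro: SUP_upper2)
  have "f i \<le> e2ennreal ?S" if "i \<in> A" for i
    using e2ennreal_mono[OF SUP_upper[OF that, of "\<lambda>i. enn2ereal (f i)"]] by simp
  then have "(SUP i\<in>A. f i) \<le> e2ennreal ?S" by (rule SUP_least)
  then have "enn2ereal (SUP i\<in>A. f i) \<le> enn2ereal (e2ennreal ?S)"
    by (simp only: less_eq_ennreal.rep_eq)
  with \<open>0 \<le> ?S\<close> show "enn2ereal (SUP i\<in>A. f i) \<le> ?S"
    by (simp only: enn2ereal_e2ennreal)
  show "?S \<le> enn2ereal (SUP i\<in>A. f i)"
    by (rule SUP_least) (simp add: SUP_upper flip: less_eq_ennreal.rep_eq)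
qed

lemma enn2ereal_INF: "enn2ereal (INF i\<in>A. f i) = (INF i\<in>A. enn2ereal (f i))"
proof (rule antisym)
  let ?I = "INF i\<in>A. enn2ereal (f i)"
  have "0 \<le> ?I" by (rule INF_greatest) simp
  have "e2ennreal ?I \<le> f i" if "i \<in> A" for i
    using e2ennreal_mono[OF INF_lower[OF that, of "\<lambda>i. enn2ereal (f i)"]] by simp
  then have "e2ennreal ?I \<le> (INF i\<in>A. f i)" by (rule INF_greatest)
  then have "enn2ereal (e2ennreal ?I) \<le> enn2ereal (INF i\<in>A. f i)"
    by (simp only: less_eq_ennreal.rep_eq)
  with \<open>0 \<le> ?I\<close> show "?I \<le> enn2ereal (INF i\<in>A. f i)"
    by (simp only: enn2ereal_e2ennreal)
  show "enn2ereal (INF i\<in>A. f i) \<le> ?I"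
    by (rule INF_greatest) (simp add: INF_lower flip: less_eq_ennreal.rep_eq)
qed

lemma le_enn2ereal_e2ennreal: "x \<le> enn2ereal (e2ennreal x)"
  by (cases "0 \<le> x") (auto simp: enn2ereal_e2ennreal intro: order_trans[of _ 0])

text \<open>With subtraction truncated at 0, \<open>(g - B) + B = g + (B - g)\<close> pointwise.
  Integration relates the two halves of \<open>expect\<close>; the negative half is at most
  \<open>B\<close>, so their difference is meaningful even when \<open>g\<close> has infinite
  integral.\<close>

lemma expect_shift:
  assumes M: "prob_space M" and g[measurable]: "g \<in> borel_measurable (completion M)" and "B \<ge> 0"
    and f: "\<And>x. x \<in> space M \<Longrightarrow> f x = enn2ereal (g x) - ereal B"
  shows "expect M f = enn2ereal (\<integral>\<^sup>+ x. g x \<partial>M) - ereal B"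
proof -
  let ?C = "completion M"
  have e: "e2ennreal (f x) = g x - ennreal B" "e2ennreal (- f x) = ennreal B - g x"
    "g x - ennreal B + ennreal B = g x + (ennreal B - g x)" if "x \<in> space M" for x
  proof -
    show "e2ennreal (f x) = g x - ennreal B"
      using \<open>B \<ge> 0\<close> by (cases "g x") (auto simp: f[OF that] enn2ereal_ennreal ennreal_minus e2ennreal_ereal)
    show "e2ennreal (- f x) = ennreal B - g x"
      using \<open>B \<ge> 0\<close> by (cases "g x") (auto simp: f[OF that] enn2ereal_ennreal ennreal_minus e2ennreal_ereal e2ennreal_neg)
    show "g x - ennreal B + ennreal B = g x + (ennreal B - g x)"
    proof (cases "g x")
      case (real r)
      then show ?thesis
        using \<open>B \<ge> 0\<close> by (cases "B \<le> r") (auto simp: ennreal_minus ennreal_neg simp flip: ennreal_plus)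
    qed simp
  qed
  have one: "emeasure ?C (space M) = 1"
    using prob_space.emeasure_space_1[OF M] by simp
  have pos: "(\<integral>\<^sup>+ x. e2ennreal (f x) \<partial>?C) = (\<integral>\<^sup>+ x. g x - ennreal B \<partial>?C)"
    and neg: "(\<integral>\<^sup>+ x. e2ennreal (- f x) \<partial>?C) = (\<integral>\<^sup>+ x. ennreal B - g x \<partial>?C)"
    by (auto intro!: nn_integral_cong simp: e)
  have "(\<integral>\<^sup>+ x. g x - ennreal B \<partial>?C) + ennreal B = (\<integral>\<^sup>+ x. g x - ennreal B + ennreal B \<partial>?C)"
    by (simp add: nn_integral_add one)
  also have "\<dots> = (\<integral>\<^sup>+ x. g x + (ennreal B - g x) \<partial>?C)"
    by (auto intro!: nn_integral_cong simp: e)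
  also have "\<dots> = (\<integral>\<^sup>+ x. g x \<partial>?C) + (\<integral>\<^sup>+ x. ennreal B - g x \<partial>?C)"
    by (rule nn_integral_add) measurable
  finally have sum: "(\<integral>\<^sup>+ x. g x - ennreal B \<partial>?C) + ennreal B = (\<integral>\<^sup>+ x. g x \<partial>M) + (\<integral>\<^sup>+ x. ennreal B - g x \<partial>?C)"
    by (simp add: nn_integral_completion)
  have "(\<integral>\<^sup>+ x. ennreal B - g x \<partial>?C) \<le> (\<integral>\<^sup>+ x. ennreal B \<partial>?C)"
    by (intro nn_integral_mono) simp
  also have "\<dots> = ennreal B" by (simp add: one)
  finally have "(\<integral>\<^sup>+ x. ennreal B - g x \<partial>?C) \<noteq> \<infinity>"
    by (auto simp: top_unique)
  then obtain b where b: "(\<integral>\<^sup>+ x. ennreal B - g x \<partial>?C) = ennreal b" "b \<ge> 0"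
    by (cases "\<integral>\<^sup>+ x. ennreal B - g x \<partial>?C") auto
  show ?thesis
    unfolding expect_def pos neg
    using sum \<open>B \<ge> 0\<close> b(2) unfolding b(1)
    by (cases "\<integral>\<^sup>+ x. g x - ennreal B \<partial>?C"; cases "\<integral>\<^sup>+ x. g x \<partial>M")
       (auto simp: enn2ereal_ennreal simp flip: ennreal_plus)
qed

lemma expect_lower_bounded:
  assumes M: "prob_space M" and q[measurable]: "q \<in> borel_measurable M" and "B \<ge> 0"
    and lower: "\<And>y. y \<in> space M \<Longrightarrow> ereal (- B) \<le> q y"
  shows "expect M q = enn2ereal (\<integral>\<^sup>+ y. e2ennreal (q y + ereal B) \<partial>M) - ereal B"
proof (rule expect_shift[OF M _ \<open>B \<ge> 0\<close>])
  have "(\<lambda>y. e2ennreal (q y + ereal B)) \<in> borel_measurable M" by measurable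
  then show "(\<lambda>y. e2ennreal (q y + ereal B)) \<in> borel_measurable (completion M)"
    by (rule measurable_completion)
  fix y assume "y \<in> space M"
  from lower[OF this] have "0 \<le> q y + ereal B" by (cases "q y") auto
  then show "q y = enn2ereal (e2ennreal (q y + ereal B)) - ereal B"
    by (cases "q y") (simp_all add: enn2ereal_e2ennreal)
qed

theorem expect_duality:
  fixes q :: "'a \<Rightarrow> ereal"
  assumes Suslin: "Suslin_space X" and mu: "prob_space \<mu>" and sets_mu: "sets \<mu> = sets (borel_of X)"
    and c: "(\<lambda>z. c (fst z) (snd z)) \<in> borel_measurable (borel_of X \<Otimes>\<^sub>M borel_of X)"
    and c_diag: "\<And>x. x \<in> topspace X \<Longrightarrow> c x x = 0"
    and q[measurable]: "q \<in> borel_measurable (borel_of X)"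
    and lower: "\<And>y. y \<in> topspace X \<Longrightarrow> ereal (- B) \<le> q y" and "B \<ge> 0" and "\<rho> > 0"
  shows "(SUP P\<in>ambiguity_set X c \<mu> \<rho>. expect P q) =
    (INF l\<in>{0..}. ereal (l * \<rho>) + expect \<mu> (\<lambda>x. SUP y\<in>topspace X. penalized (q y) l (c x y)))"
proof -
  define G where "G y = e2ennreal (q y + ereal B)" for y
  have q_G: "q y = enn2ereal (G y) - ereal B" if "y \<in> topspace X" for y
  proof -
    have "0 \<le> q y + ereal B"
      using lower[OF that] by (cases "q y") auto
    then show ?thesis
      by (cases "q y") (simp_all add: G_def enn2ereal_e2ennreal)
  qed
  interpret transport_problem \<mu> X c G
  proof (rule transport_problemI[OF Suslin mu sets_mu c c_diag])
    show "G \<in> borel_measurable (borel_of X)"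
      unfolding G_def by measurable
  qed
  have expect_P: "expect P q = enn2ereal (\<integral>\<^sup>+ y. G y \<partial>P) - ereal B" if "P \<in> ambiguity_set X c \<mu> \<rho>" for P
  proof -
    have P: "prob_space P" "sets P = sets (borel_of X)"
      using that by (auto simp: ambiguity_set_def)
    have "q \<in> borel_measurable P"
      using q measurable_cong_sets[OF P(2) refl] by blast
    moreover have "ereal (- B) \<le> q y" if "y \<in> space P" for y
      using that sets_eq_imp_space_eq[OF P(2)] by (intro lower) simp
    ultimately show ?thesis
      unfolding G_def using P(1) \<open>B \<ge> 0\<close> by (intro expect_lower_bounded)
  qed
  have pen_gain: "e2ennreal (penalized (q y) l (c x y) + ereal B) = gain l x y"
    if y: "y \<in> topspace X" and "l \<ge> 0" for x y l
  proof (cases "c x y")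
    case top
    then show ?thesis by (simp add: penalized_def gain_def e2ennreal_neg)
  next
    case (real r)
    then have "penalized (q y) l (c x y) + ereal B = enn2ereal (G y) - enn2ereal (ennreal l * c x y)"
      using \<open>l \<ge> 0\<close> by (cases "G y") (auto simp: penalized_def q_G[OF y] enn2ereal_ennreal simp flip: ennreal_mult)
    then show ?thesis using real by (simp add: gain_def)
  qed
  \<comment> \<open>Clipping at \<open>- B\<close> leaves this supremum unchanged: it is at least
    \<open>q x\<close>, reached at \<open>y = x\<close> with cost 0, and \<open>q x\<close> is at
    least \<open>- B\<close>.\<close>
  have phi: "(SUP y\<in>topspace X. penalized (q y) l (c x y)) = enn2ereal (psi l x) - ereal B" (is "?phi = _")
    if x: "x \<in> topspace X" and "l \<ge> 0" for x l
  proof -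
    have "q x = penalized (q x) l (c x x)"
      by (simp add: penalized_def c_diag[OF x] zero_ennreal.rep_eq)
    also have "\<dots> \<le> ?phi" using x by (rule SUP_upper)
    finally have "ereal (- B) \<le> ?phi" using lower[OF x] by (rule order_trans[rotated])
    then have pos: "0 \<le> ?phi + ereal B" by (cases ?phi) auto
    have "?phi + ereal B = enn2ereal (psi l x)"
    proof (rule antisym)
      have "penalized (q y) l (c x y) \<le> enn2ereal (psi l x) - ereal B" if y: "y \<in> topspace X" for y
      proof -
        have "penalized (q y) l (c x y) + ereal B \<le> enn2ereal (e2ennreal (penalized (q y) l (c x y) + ereal B))"
          by (rule le_enn2ereal_e2ennreal)
        also have "\<dots> \<le> enn2ereal (psi l x)"
          unfolding pen_gain[OF y \<open>l \<ge> 0\<close>] using y by (simp add: psi_def SUP_upper flip: less_eq_ennreal.rep_eq)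
        finally show ?thesis by (simp add: ereal_le_minus)
      qed
      then have "?phi \<le> enn2ereal (psi l x) - ereal B" by (rule SUP_least)
      then show "?phi + ereal B \<le> enn2ereal (psi l x)" by (simp add: ereal_le_minus)
      have "gain l x y \<le> e2ennreal (?phi + ereal B)" if y: "y \<in> topspace X" for y
        unfolding pen_gain[OF y \<open>l \<ge> 0\<close>, symmetric] using y
        by (intro e2ennreal_mono add_right_mono SUP_upper)
      then have "psi l x \<le> e2ennreal (?phi + ereal B)"
        unfolding psi_def by (rule SUP_least)
      then have "enn2ereal (psi l x) \<le> enn2ereal (e2ennreal (?phi + ereal B))"
        by (simp only: less_eq_ennreal.rep_eq)
      with pos show "enn2ereal (psi l x) \<le> ?phi + ereal B"
        by (simp only: enn2ereal_e2ennreal)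
    qed
    then show ?thesis by (cases ?phi; cases "enn2ereal (psi l x)") auto
  qed
  have expect_phi: "expect \<mu> (\<lambda>x. SUP y\<in>topspace X. penalized (q y) l (c x y)) =
      enn2ereal (\<integral>\<^sup>+ x. psi l x \<partial>\<mu>) - ereal B" if "l \<ge> 0" for l
    using mu psi_meas \<open>B \<ge> 0\<close> phi[OF _ that] by (rule expect_shift) (simp add: space_mu)
  have "(SUP P\<in>ambiguity_set X c \<mu> \<rho>. expect P q) =
      (SUP P\<in>ambiguity_set X c \<mu> \<rho>. enn2ereal (\<integral>\<^sup>+ y. G y \<partial>P) - ereal B)"
    by (rule SUP_cong) (auto simp: expect_P)
  \<comment> \<open>Non-emptiness of the ambiguity set is used twice, for moving the constant out of
    the supremum and for exchanging the supremum with \<open>enn2ereal\<close>.\<close>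
  also have "\<dots> = enn2ereal (SUP P\<in>ambiguity_set X c \<mu> \<rho>. \<integral>\<^sup>+ y. G y \<partial>P) - ereal B"
    using ambiguity_set_nonempty by (simp add: SUP_ereal_minus_left enn2ereal_SUP)
  also have "\<dots> = (INF l\<in>{0..}. enn2ereal (ennreal (l * \<rho>) + (\<integral>\<^sup>+ x. psi l x \<partial>\<mu>))) + - ereal B"
    unfolding duality[OF \<open>\<rho> > 0\<close>] enn2ereal_INF by (simp add: minus_ereal_def)
  also have "\<dots> = (INF l\<in>{0..}. enn2ereal (ennreal (l * \<rho>) + (\<integral>\<^sup>+ x. psi l x \<partial>\<mu>)) + - ereal B)"
    by (rule INF_ereal_add_left[symmetric]) auto
  also have "\<dots> = (INF l\<in>{0..}. ereal (l * \<rho>) + expect \<mu> (\<lambda>x. SUP y\<in>topspace X. penalized (q y) l (c x y)))"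
  proof (rule INF_cong)
    fix l :: real assume "l \<in> {0..}"
    then have l: "l \<ge> 0" by simp
    have "enn2ereal (ennreal (l * \<rho>)) = ereal (l * \<rho>)"
      using l \<open>\<rho> > 0\<close> by (simp add: enn2ereal_ennreal)
    then show "enn2ereal (ennreal (l * \<rho>) + (\<integral>\<^sup>+ x. psi l x \<partial>\<mu>)) + - ereal B =
        ereal (l * \<rho>) + expect \<mu> (\<lambda>x. SUP y\<in>topspace X. penalized (q y) l (c x y))"
      unfolding expect_phi[OF l] by (simp add: plus_ennreal.rep_eq minus_ereal_def add.assoc)
  qed simp
  finally show ?thesis .
qed

subsection \<open>Lower semicontinuity and measurability of the value functions\<close>

text \<open>The sequential form is chosen because Fatou's lemma and the extraction of convergent
  subsequences both speak of sequences.\<close>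

definition seq_lsc_on :: "'u::topological_space set \<Rightarrow> ('u \<Rightarrow> ereal) \<Rightarrow> bool" where
  "seq_lsc_on S h \<longleftrightarrow> (\<forall>z u. (\<forall>k. z k \<in> S) \<longrightarrow> u \<in> S \<longrightarrow> z \<longlonglongrightarrow> u \<longrightarrow> h u \<le> liminf (\<lambda>k. h (z k)))"

lemma seq_lsc_onD:
  "seq_lsc_on S h \<Longrightarrow> (\<And>k. z k \<in> S) \<Longrightarrow> u \<in> S \<Longrightarrow> z \<longlonglongrightarrow> u \<Longrightarrow> h u \<le> liminf (\<lambda>k. h (z k))"
  unfolding seq_lsc_on_def by blast

text \<open>The lower bounds exclude a sum of opposite infinities.\<close>

lemma liminf_add_ge:
  fixes f g :: "nat \<Rightarrow> ereal"
  assumes "\<And>k. ereal a \<le> f k" "\<And>k. ereal b \<le> g k"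
  shows "liminf f + liminf g \<le> liminf (\<lambda>k. f k + g k)"
proof (rule ereal_liminf_add_mono)
  have "ereal a \<le> liminf f" "ereal b \<le> liminf g"
    using assms by (auto intro!: Liminf_bounded)
  then show "\<not> (liminf f = \<infinity> \<and> liminf g = - \<infinity> \<or> liminf f = - \<infinity> \<and> liminf g = \<infinity>)"
    by auto
qed

text \<open>If the infimum dropped below \<open>a\<close> along the sequence, points
  \<open>w k\<close> with \<open>F (w k) < a\<close> would have a subsequence converging in
  \<open>K\<close>. The closed graph makes its limit feasible, and lower semicontinuity gives the
  limit a value at most \<open>a\<close>.\<close>

lemma seq_lsc_on_INF:
  fixes U :: "'v::topological_space \<Rightarrow> 'u::metric_space set"
  assumes K: "compact K" and U_K: "\<And>v. v \<in> S \<Longrightarrow> U v \<subseteq> K" and U_D: "\<And>v. v \<in> S \<Longrightarrow> U v \<subseteq> D"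
    and graph: "\<And>v z u w. (\<And>k. z k \<in> S) \<Longrightarrow> v \<in> S \<Longrightarrow> z \<longlonglongrightarrow> v \<Longrightarrow> (\<And>k. w k \<in> U (z k)) \<Longrightarrow> w \<longlonglongrightarrow> u \<Longrightarrow> u \<in> U v"
    and F: "seq_lsc_on D F"
  shows "seq_lsc_on S (\<lambda>v. INF u\<in>U v. F u)"
  unfolding seq_lsc_on_def
proof (intro allI impI)
  fix z v assume z: "\<forall>k. z k \<in> S" and v: "v \<in> S" and lim: "z \<longlonglongrightarrow> v"
  show "(INF u\<in>U v. F u) \<le> liminf (\<lambda>k. INF u\<in>U (z k). F u)" (is "_ \<le> liminf ?m")
  proof (rule ccontr)
    assume "\<not> ?thesis"
    then obtain a where a: "liminf ?m < a" "a < (INF u\<in>U v. F u)"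
      using dense not_le by metis
    obtain r where r: "strict_mono r" "(?m \<circ> r) \<longlonglongrightarrow> liminf ?m"
      using liminf_subseq_lim by blast
    have "\<forall>\<^sub>F k in sequentially. (?m \<circ> r) k < a"
      using r(2) a(1) by (rule order_tendstoD(2))
    then obtain N where N: "\<And>k. N \<le> k \<Longrightarrow> ?m (r k) < a"
      unfolding eventually_sequentially comp_def by blast
    define q where "q k = r (k + N)" for k
    have "strict_mono q"
      using r(1) by (auto simp: q_def strict_mono_def)
    have "\<exists>w\<in>U (z (q k)). F w < a" for k
      using N[of "k + N"] unfolding q_def INF_less_iff by simp
    then obtain w where w: "\<And>k. w k \<in> U (z (q k))" "\<And>k. F (w k) < a" by metis
    have "\<forall>k. w k \<in> K" using w(1) U_K z by blast
    then obtain u p where p: "strict_mono p" "(w \<circ> p) \<longlonglongrightarrow> u"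
      using K unfolding compact_eq_seq_compact_metric seq_compact_def by metis
    have "strict_mono (q \<circ> p)" using \<open>strict_mono q\<close> p(1) by (rule strict_mono_o)
    then have "(z \<circ> (q \<circ> p)) \<longlonglongrightarrow> v" by (rule LIMSEQ_subseq_LIMSEQ[OF lim])
    then have u: "u \<in> U v"
      using z v w(1) p(2) by (intro graph[of "z \<circ> (q \<circ> p)" v "w \<circ> p" u]) auto
    have "F u \<le> liminf (\<lambda>k. F ((w \<circ> p) k))"
      using F p(2) u v w(1) U_D z by (intro seq_lsc_onD[of D F "w \<circ> p"]) auto
    also have "\<dots> \<le> liminf (\<lambda>k. a)"
      using w(2) by (intro Liminf_mono always_eventually) (auto intro: less_imp_le)
    finally have "F u \<le> a" by (simp add: Liminf_const)
    moreover have "(INF u\<in>U v. F u) \<le> F u" using u by (rule INF_lower)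
    ultimately show False using a(2) by simp
  qed
qed

lemma seq_lsc_on_add:
  assumes f: "seq_lsc_on D f" "\<And>u. u \<in> D \<Longrightarrow> ereal a \<le> f u"
    and h: "seq_lsc_on D h" "\<And>u. u \<in> D \<Longrightarrow> ereal b \<le> h u"
  shows "seq_lsc_on D (\<lambda>u. f u + h u)"
  unfolding seq_lsc_on_def
proof (intro allI impI)
  fix z u assume z: "\<forall>k. z k \<in> D" "u \<in> D" "z \<longlonglongrightarrow> u"
  have "f u + h u \<le> liminf (\<lambda>k. f (z k)) + liminf (\<lambda>k. h (z k))"
    using z by (intro add_mono seq_lsc_onD[OF f(1)] seq_lsc_onD[OF h(1)]) auto
  also have "\<dots> \<le> liminf (\<lambda>k. f (z k) + h (z k))"
    using z f(2) h(2) by (intro liminf_add_ge) auto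
  finally show "f u + h u \<le> liminf (\<lambda>k. f (z k) + h (z k))" .
qed

section \<open>Euclidean decision spaces and random lower semicontinuity\<close>

lemma Euclidean_space_eq: "Euclidean_space n = top_of_set (topspace (Euclidean_space n))"
  by (simp add: Euclidean_space_def euclidean_product_topology)

lemma closed_topspace_Euclidean_space: "closed (topspace (Euclidean_space n))"
  using closedin_Euclidean_imp_closed[OF closedin_topspace] .

lemma closedin_prod_Euclidean_imp_closed:
  assumes "closedin (prod_topology (Euclidean_space m) (Euclidean_space n)) S"
  shows "closed S"
proof -
  have "closedin (top_of_set (topspace (Euclidean_space m) \<times> topspace (Euclidean_space n))) S"
    using assms by (subst (asm) Euclidean_space_eq, subst (asm) (2) Euclidean_space_eq) simp
  then show ?thesis
    by (rule closedin_closed_trans) (intro closed_Times closed_topspace_Euclidean_space)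
qed

lemma closedin_prod_Euclidean_real_imp_closed:
  assumes "closedin (prod_topology (Euclidean_space m) euclideanreal) S"
  shows "closed S"
proof -
  have "closedin (prod_topology (top_of_set (topspace (Euclidean_space m))) (top_of_set UNIV)) S"
    using assms by (subst (asm) Euclidean_space_eq) simp
  then have "closedin (top_of_set (topspace (Euclidean_space m) \<times> UNIV)) S"
    by (simp only: prod_topology_subtopology_eu)
  then show ?thesis
    by (rule closedin_closed_trans) (intro closed_Times closed_topspace_Euclidean_space closed_UNIV)
qed

text \<open>Points whose values lie below a common height \<open>a\<close> belong to the epigraph at
  that height, and closedness puts their limit there too.\<close>

lemma random_lsc_imp_seq_lsc_on:
  assumes f: "random_lsc n M f" and x: "x \<in> space M"
  shows "seq_lsc_on (topspace (Euclidean_space n)) (\<lambda>u. ereal (f u x))"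
  unfolding seq_lsc_on_def
proof (intro allI impI)
  let ?D = "topspace (Euclidean_space n)" and ?f = "\<lambda>u. ereal (f u x)"
  fix z u assume z: "\<forall>k. z k \<in> ?D" and u: "u \<in> ?D" and lim: "z \<longlonglongrightarrow> u"
  show "?f u \<le> liminf (\<lambda>k. ?f (z k))"
  proof (rule ccontr)
    assume "\<not> ?thesis"
    then obtain a where a: "liminf (\<lambda>k. ?f (z k)) < ereal a" "a < f u x"
      by (metis ereal_dense2 less_ereal.simps(1) not_le)
    obtain r where r: "strict_mono r" "((\<lambda>k. ?f (z k)) \<circ> r) \<longlonglongrightarrow> liminf (\<lambda>k. ?f (z k))"
      using liminf_subseq_lim by blast
    have "\<forall>\<^sub>F k in sequentially. ((\<lambda>k. ?f (z k)) \<circ> r) k < ereal a"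
      using r(2) a(1) by (rule order_tendstoD(2))
    then have "\<forall>\<^sub>F k in sequentially. (z (r k), a) \<in> epi ?D (\<lambda>u. f u x)"
      using z by (auto simp: epi_def elim!: eventually_mono)
    moreover have "(\<lambda>k. (z (r k), a)) \<longlonglongrightarrow> (u, a)"
      using LIMSEQ_subseq_LIMSEQ[OF lim r(1)] by (intro tendsto_Pair) (auto simp: comp_def)
    moreover have "closed (epi ?D (\<lambda>u. f u x))"
      using f x unfolding random_lsc_def by (intro closedin_prod_Euclidean_real_imp_closed) blast
    ultimately have "(u, a) \<in> epi ?D (\<lambda>u. f u x)"
      by (intro Lim_in_closed_set) auto
    then show False using a(2) by (simp add: epi_def)
  qed
qed

text \<open>The strict sublevel condition says that the epigraph hits the open set
  \<open>V \<times> {..<\<alpha>}\<close>, which is the kind of event that measurability of the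
  epigraph multifunction controls.\<close>

lemma measurable_INF_epi:
  assumes f: "random_lsc n M f" and V: "openin (Euclidean_space n) V"
  shows "(\<lambda>x. INF u\<in>V. ereal (f u x)) \<in> borel_measurable M"
proof (rule borel_measurableI_less)
  let ?D = "topspace (Euclidean_space n)"
  fix a :: ereal
  have V_D: "V \<subseteq> ?D" using V by (rule openin_subset)
  show "{x \<in> space M. (INF u\<in>V. ereal (f u x)) < a} \<in> sets M"
  proof (cases a)
    case (real \<alpha>)
    have eq: "(INF u\<in>V. ereal (f u x)) < a \<longleftrightarrow> epi ?D (\<lambda>u. f u x) \<inter> V \<times> {..<\<alpha>} \<noteq> {}" for x
    proof
      assume "(INF u\<in>V. ereal (f u x)) < a"
      then obtain u where u: "u \<in> V" "f u x < \<alpha>" by (auto simp: real INF_less_iff)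
      then have "(u, f u x) \<in> epi ?D (\<lambda>u. f u x) \<inter> V \<times> {..<\<alpha>}"
        using V_D by (auto simp: epi_def)
      then show "epi ?D (\<lambda>u. f u x) \<inter> V \<times> {..<\<alpha>} \<noteq> {}" by blast
    next
      assume "epi ?D (\<lambda>u. f u x) \<inter> V \<times> {..<\<alpha>} \<noteq> {}"
      then obtain u \<beta> where "u \<in> V" "f u x \<le> \<beta>" "\<beta> < \<alpha>" by (auto simp: epi_def)
      then show "(INF u\<in>V. ereal (f u x)) < a"
        unfolding real INF_less_iff by (intro bexI[of _ u]) auto
    qed
    have "openin (prod_topology (Euclidean_space n) euclideanreal) (V \<times> {..<\<alpha>})"
      using V by (simp add: openin_prod_Times_iff)
    then show ?thesis
      using f unfolding eq random_lsc_def measurable_multifunction_def by blast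
  next
    case PInf
    show ?thesis
    proof (cases "V = {}")
      case False
      then obtain u where "u \<in> V" by blast
      then have "(INF u\<in>V. ereal (f u x)) < a" for x
        unfolding PInf INF_less_iff by (intro bexI[of _ u]) auto
      then show ?thesis by simp
    qed (simp add: PInf top_ereal_def)
  qed simp
qed

text \<open>\<open>f\<close> is accessible through infima over open sets and \<open>C\<close>
  through the open sets it hits. Both are tested on basic open sets whose diameters tend to 0, and
  compactness brings the test points back to one feasible point.\<close>

lemma borel_measurable_INF_multifunction:
  assumes f: "random_lsc n M f"
    and f_lower: "\<And>u x. u \<in> topspace (Euclidean_space n) \<Longrightarrow> x \<in> space M \<Longrightarrow> a0 \<le> f u x"
    and C: "measurable_multifunction M (Euclidean_space n) C"
    and C_closed: "\<And>x. x \<in> space M \<Longrightarrow> closed (C x)"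
    and K: "compact K" and C_K: "\<And>x. x \<in> space M \<Longrightarrow> C x \<subseteq> K"
    and h: "seq_lsc_on (topspace (Euclidean_space n)) h"
    and h_lower: "\<And>u. u \<in> topspace (Euclidean_space n) \<Longrightarrow> ereal b0 \<le> h u"
  shows "(\<lambda>x. INF u\<in>C x. ereal (f u x) + h u) \<in> borel_measurable M"
proof -
  let ?D = "topspace (Euclidean_space n)"
  let ?F = "\<lambda>x u. ereal (f u x) + h u"
  have C_D: "C x \<subseteq> ?D" if "x \<in> space M" for x
    using C that by (auto simp: measurable_multifunction_def)
  obtain \<B> :: "(nat \<Rightarrow> real) set set" where \<B>: "countable \<B>" "topological_basis \<B>"
    using ex_countable_basis by blast
  define \<B>' where "\<B>' m = {B \<in> \<B>. \<forall>y\<in>B. \<forall>y'\<in>B. dist y y' \<le> 1 / real (Suc m)}" for m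
  have \<B>'_countable: "countable (\<B>' m)" for m
    using \<B>(1) by (rule countable_subset[rotated]) (auto simp: \<B>'_def)
  have \<B>'_ex: "\<exists>B\<in>\<B>' m. u \<in> B" for u m
  proof -
    define e where "e = 1 / real (Suc m) / 2"
    have "e > 0" by (simp add: e_def)
    then obtain B where B: "B \<in> \<B>" "u \<in> B" "B \<subseteq> ball u e"
      using topological_basisE[OF \<B>(2), of "ball u e" u] by auto
    have "dist y y' \<le> 1 / real (Suc m)" if "y \<in> B" "y' \<in> B" for y y'
    proof -
      have "dist u y < e" "dist u y' < e"
        using that B(3) by auto
      then have "dist y y' < e + e"
        using dist_triangle3[of y y' u] by simp
      moreover have "e + e = 1 / real (Suc m)" unfolding e_def by (rule field_sum_of_halves)
      ultimately show ?thesis by linarith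
    qed
    then show ?thesis using B by (auto simp: \<B>'_def)
  qed
  have open_B: "openin (Euclidean_space n) (?D \<inter> B)" if "B \<in> \<B>' m" for B m
    using that topological_basis_open[OF \<B>(2)]
    by (subst Euclidean_space_eq) (auto simp: \<B>'_def intro: openin_open_Int)
  \<comment> \<open>The two infima over the same small set are taken separately, so that the
    dependence on \<open>x\<close> sits in \<open>\<phi> B\<close> alone and \<open>\<eta> B\<close>
    is a constant. Their approximate minimisers differ, but by at most the diameter of
    \<open>B\<close>.\<close>
  define \<phi> where "\<phi> B x = (INF u\<in>?D \<inter> B. ereal (f u x))" for B x
  define \<eta> where "\<eta> B = (INF u\<in>?D \<inter> B. h u)" for B
  have \<phi>_lower: "ereal a0 \<le> \<phi> B x" if "x \<in> space M" for B x
    unfolding \<phi>_def using f_lower that by (auto intro!: INF_greatest)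
  have \<eta>_lower: "ereal b0 \<le> \<eta> B" for B
    unfolding \<eta>_def using h_lower by (auto intro!: INF_greatest)
  have key: "(INF u\<in>C x. ?F x u) \<le> ereal a \<longleftrightarrow>
      (\<forall>m. \<exists>B\<in>\<B>' m. C x \<inter> (?D \<inter> B) \<noteq> {} \<and> \<phi> B x + \<eta> B < ereal (a + 1 / real (Suc m)))"
    if x: "x \<in> space M" for x a
  proof
    assume le: "(INF u\<in>C x. ?F x u) \<le> ereal a"
    show "\<forall>m. \<exists>B\<in>\<B>' m. C x \<inter> (?D \<inter> B) \<noteq> {} \<and> \<phi> B x + \<eta> B < ereal (a + 1 / real (Suc m))"
    proof
      fix m
      have "ereal a < ereal (a + 1 / real (Suc m))" by simp
      with le have "(INF u\<in>C x. ?F x u) < ereal (a + 1 / real (Suc m))"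
        by (rule le_less_trans)
      then obtain u where u: "u \<in> C x" "?F x u < ereal (a + 1 / real (Suc m))"
        unfolding INF_less_iff by blast
      obtain B where B: "B \<in> \<B>' m" "u \<in> B" using \<B>'_ex by blast
      have uB: "u \<in> ?D \<inter> B" using u(1) C_D[OF x] B(2) by blast
      have "\<phi> B x + \<eta> B \<le> ?F x u"
        unfolding \<phi>_def \<eta>_def using uB by (intro add_mono INF_lower)
      then show "\<exists>B\<in>\<B>' m. C x \<inter> (?D \<inter> B) \<noteq> {} \<and> \<phi> B x + \<eta> B < ereal (a + 1 / real (Suc m))"
        using B(1) uB u by (intro bexI[of _ B]) auto
    qed
  next
    assume *: "\<forall>m. \<exists>B\<in>\<B>' m. C x \<inter> (?D \<inter> B) \<noteq> {} \<and> \<phi> B x + \<eta> B < ereal (a + 1 / real (Suc m))"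
    have "\<exists>u w w'. u \<in> C x \<and> w \<in> ?D \<and> w' \<in> ?D \<and> dist w u \<le> 1 / real (Suc m) \<and> dist w' u \<le> 1 / real (Suc m) \<and>
        ereal (f w x) + h w' < ereal (a + 1 / real (Suc m))" for m
    proof -
      obtain B u where B: "B \<in> \<B>' m" and u: "u \<in> C x" "u \<in> B" and less: "\<phi> B x + \<eta> B < ereal (a + 1 / real (Suc m))"
        using *[rule_format, of m] by blast
      obtain p q where p: "\<phi> B x = ereal p" and q: "\<eta> B = ereal q"
        using less \<phi>_lower[OF x, of B] \<eta>_lower[of B] by (cases "\<phi> B x"; cases "\<eta> B") auto
      \<comment> \<open>Half of the strict gap is given to each of the two infima.\<close>
      define e where "e = (a + 1 / real (Suc m) - p - q) / 2"
      have "e > 0" using less by (simp add: p q e_def)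
      then have "\<phi> B x < ereal (p + e)" "\<eta> B < ereal (q + e)" by (auto simp: p q)
      then obtain w w' where w: "w \<in> ?D \<inter> B" "ereal (f w x) < ereal (p + e)"
        and w': "w' \<in> ?D \<inter> B" "h w' < ereal (q + e)"
        unfolding \<phi>_def \<eta>_def INF_less_iff by blast
      have "ereal (f w x) + h w' < ereal (p + e) + ereal (q + e)"
        using w(2) w'(2) by (rule ereal_add_strict_mono2)
      also have "\<dots> = ereal (a + 1 / real (Suc m))"
      proof -
        have "2 * e = a + 1 / real (Suc m) - p - q" by (simp add: e_def)
        then have "p + e + (q + e) = a + 1 / real (Suc m)" by linarith
        then show ?thesis by (simp only: plus_ereal.simps)
      qed
      finally show ?thesis
        using u w(1) w'(1) B by (intro exI[of _ u] exI[of _ w] exI[of _ w']) (auto simp: \<B>'_def)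
    qed
    then obtain u w w' where u: "\<And>m. u m \<in> C x" and w: "\<And>m. w m \<in> ?D" "\<And>m. w' m \<in> ?D"
      and d: "\<And>m. dist (w m) (u m) \<le> 1 / real (Suc m)" "\<And>m. dist (w' m) (u m) \<le> 1 / real (Suc m)"
      and le: "\<And>m. ereal (f (w m) x) + h (w' m) < ereal (a + 1 / real (Suc m))"
      by metis
    have "\<forall>m. u m \<in> K" using u C_K[OF x] by blast
    then obtain l r where r: "strict_mono r" "(u \<circ> r) \<longlonglongrightarrow> l"
      using K unfolding compact_eq_seq_compact_metric seq_compact_def by metis
    have l: "l \<in> C x"
      using u by (intro closed_sequentially[OF C_closed[OF x] _ r(2)]) simp
    have inv: "(\<lambda>m. 1 / real (Suc m)) \<longlonglongrightarrow> 0"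
      using LIMSEQ_inverse_real_of_nat by (simp add: inverse_eq_divide)
    \<comment> \<open>The approximate minimisers of \<open>f\<close> and of \<open>h\<close> stay
      within \<open>1 / real (Suc m)\<close> of the feasible point \<open>u m\<close>, so both
      follow it to the limit \<open>l\<close>.\<close>
    have conv: "(\<lambda>k. y (r k)) \<longlonglongrightarrow> l" if y: "\<And>m. dist (y m) (u m) \<le> 1 / real (Suc m)" for y
    proof -
      have "(\<lambda>m. dist (y m) (u m)) \<longlonglongrightarrow> 0"
        using y by (intro tendsto_sandwich[OF _ _ tendsto_const inv]) auto
      from LIMSEQ_subseq_LIMSEQ[OF this r(1)]
      have 1: "(\<lambda>k. dist (y (r k)) (u (r k))) \<longlonglongrightarrow> 0" by (simp add: comp_def)
      have "(\<lambda>k. u (r k)) \<longlonglongrightarrow> l" using r(2) by (simp only: comp_def)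
      then have 2: "(\<lambda>k. dist (u (r k)) l) \<longlonglongrightarrow> 0" by (rule tendsto_dist_iff[THEN iffD1])
      have "(\<lambda>k. dist (y (r k)) (u (r k)) + dist (u (r k)) l) \<longlonglongrightarrow> 0"
        using tendsto_add[OF 1 2] by simp
      then have "(\<lambda>k. dist (y (r k)) l) \<longlonglongrightarrow> 0"
        by (rule tendsto_sandwich[OF always_eventually[OF allI[OF zero_le_dist]]
              always_eventually[OF allI[OF dist_triangle]] tendsto_const])
      then show ?thesis by (subst tendsto_dist_iff)
    qed
    have "?F x l \<le> liminf (\<lambda>k. ereal (f (w (r k)) x)) + liminf (\<lambda>k. h (w' (r k)))"
      using l C_D[OF x] w conv[OF d(1)] conv[OF d(2)]
      by (intro add_mono seq_lsc_onD[OF random_lsc_imp_seq_lsc_on[OF f x]] seq_lsc_onD[OF h]) auto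
    also have "\<dots> \<le> liminf (\<lambda>k. ereal (f (w (r k)) x) + h (w' (r k)))"
      using f_lower h_lower w x by (intro liminf_add_ge[of a0 _ b0]) auto
    also have "\<dots> \<le> liminf (\<lambda>k. ereal (a + 1 / real (Suc (r k))))"
      using le by (intro Liminf_mono always_eventually) (auto intro: less_imp_le)
    also have "\<dots> = ereal (a + 0)"
      using LIMSEQ_subseq_LIMSEQ[OF inv r(1)]
      by (intro lim_imp_Liminf tendsto_ereal tendsto_add tendsto_const) (auto simp: comp_def)
    finally have "?F x l \<le> ereal a" by simp
    then show "(INF u\<in>C x. ?F x u) \<le> ereal a"
      using l by (rule INF_lower2[rotated])
  qed
  have \<phi>_meas: "\<phi> B \<in> borel_measurable M" if "B \<in> \<B>' m" for B m
    unfolding \<phi>_def using f open_B[OF that] by (rule measurable_INF_epi)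
  have le_real: "{x \<in> space M. (INF u\<in>C x. ?F x u) \<le> ereal a} \<in> sets M" for a
  proof -
    define Y where "Y m B = {x \<in> space M. C x \<inter> (?D \<inter> B) \<noteq> {}} \<inter>
        {x \<in> space M. \<phi> B x + \<eta> B < ereal (a + 1 / real (Suc m))}" for m B
    have Y_sets: "Y m B \<in> sets M" if B: "B \<in> \<B>' m" for m B
      unfolding Y_def
    proof (rule sets.Int)
      show "{x \<in> space M. C x \<inter> (?D \<inter> B) \<noteq> {}} \<in> sets M"
        using C open_B[OF B] unfolding measurable_multifunction_def by blast
      have [measurable]: "\<phi> B \<in> borel_measurable M" using B by (rule \<phi>_meas)
      show "{x \<in> space M. \<phi> B x + \<eta> B < ereal (a + 1 / real (Suc m))} \<in> sets M"
        by measurable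
    qed
    have "{x \<in> space M. (INF u\<in>C x. ?F x u) \<le> ereal a} = (\<Inter>m. \<Union>B\<in>\<B>' m. Y m B)"
    proof (rule set_eqI)
      fix x
      show "x \<in> {x \<in> space M. (INF u\<in>C x. ?F x u) \<le> ereal a} \<longleftrightarrow> x \<in> (\<Inter>m. \<Union>B\<in>\<B>' m. Y m B)"
      proof (cases "x \<in> space M")
        case True
        then show ?thesis
          unfolding mem_Collect_eq key[OF True] Y_def by blast
      qed (simp add: Y_def)
    qed
    also have "\<dots> \<in> sets M"
      using \<B>'_countable Y_sets by (intro sets.countable_INT image_subsetI sets.countable_UN') auto
    finally show ?thesis .
  qed
  show ?thesis
  proof (rule borel_measurableI_le)
    fix y
    show "{x \<in> space M. (INF u\<in>C x. ?F x u) \<le> y} \<in> sets M"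
    proof (cases y)
      case (real a)
      then show ?thesis using le_real by simp
    next
      \<comment> \<open>The common lower bound \<open>a0 + b0\<close> rules out the value minus
        infinity.\<close>
      case MInf
      have "ereal (a0 + b0) \<le> (INF u\<in>C x. ?F x u)" if x: "x \<in> space M" for x
      proof (rule INF_greatest)
        fix u assume "u \<in> C x"
        then have "u \<in> ?D" using C_D[OF x] by blast
        then have "ereal a0 + ereal b0 \<le> ?F x u"
          using f_lower[OF _ x] h_lower by (intro add_mono) auto
        then show "ereal (a0 + b0) \<le> ?F x u" by simp
      qed
      then have "{x \<in> space M. (INF u\<in>C x. ?F x u) \<le> y} = {}"
        using MInf by fastforce
      then show ?thesis by (simp only: sets.empty_sets)
    qed simp
  qed
qed

section \<open>Semicontinuity of suprema and expectations\<close>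

lemma seq_lsc_on_cong: "(\<And>u. u \<in> D \<Longrightarrow> f u = g u) \<Longrightarrow> seq_lsc_on D f \<longleftrightarrow> seq_lsc_on D g"
  unfolding seq_lsc_on_def by simp

lemma seq_lsc_on_SUP:
  assumes "\<And>i. i \<in> I \<Longrightarrow> seq_lsc_on D (h i)"
  shows "seq_lsc_on D (\<lambda>u. SUP i\<in>I. h i u)"
  unfolding seq_lsc_on_def
proof (intro allI impI SUP_least)
  fix z u i assume z: "\<forall>k. z k \<in> D" "u \<in> D" "z \<longlonglongrightarrow> u" and i: "i \<in> I"
  have "h i u \<le> liminf (\<lambda>k. h i (z k))"
    using z by (intro seq_lsc_onD[OF assms[OF i]]) auto
  also have "\<dots> \<le> liminf (\<lambda>k. SUP i\<in>I. h i (z k))"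
    using i by (intro Liminf_mono always_eventually allI SUP_upper)
  finally show "h i u \<le> liminf (\<lambda>k. SUP i\<in>I. h i (z k))" .
qed

text \<open>This is Fatou's lemma for the integrand raised by \<open>B\<close>; the conversions
  between \<open>ereal\<close> and \<open>ennreal\<close> are monotone and continuous and hence pass
  through \<open>liminf\<close>.\<close>

lemma seq_lsc_on_expect:
  assumes P: "prob_space P" and "B \<ge> 0"
    and q: "\<And>u. u \<in> D \<Longrightarrow> q u \<in> borel_measurable P"
    and lower: "\<And>u y. u \<in> D \<Longrightarrow> y \<in> space P \<Longrightarrow> ereal (- B) \<le> q u y"
    and lsc: "\<And>y. y \<in> space P \<Longrightarrow> seq_lsc_on D (\<lambda>u. q u y)"
  shows "seq_lsc_on D (\<lambda>u. expect P (q u))"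
  unfolding seq_lsc_on_def
proof (intro allI impI)
  fix z u assume z: "\<forall>k. z k \<in> D" and u: "u \<in> D" and lim: "z \<longlonglongrightarrow> u"
  define g where "g u y = e2ennreal (q u y + ereal B)" for u y
  have expect: "expect P (q u) = enn2ereal (\<integral>\<^sup>+ y. g u y \<partial>P) - ereal B" if "u \<in> D" for u
    unfolding g_def using that by (intro expect_lower_bounded P q lower \<open>B \<ge> 0\<close>)
  have g_meas: "g (z k) \<in> borel_measurable P" for k
  proof -
    have [measurable]: "q (z k) \<in> borel_measurable P" using z by (intro q) simp
    show ?thesis unfolding g_def by measurable
  qed
  have "g u y \<le> liminf (\<lambda>k. g (z k) y)" if y: "y \<in> space P" for y
  proof -
    have "q u y + ereal B \<le> liminf (\<lambda>k. q (z k) y) + liminf (\<lambda>k. ereal B)"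
      using z u lim by (intro add_mono seq_lsc_onD[OF lsc[OF y]]) (auto simp: Liminf_const)
    also have "\<dots> \<le> liminf (\<lambda>k. q (z k) y + ereal B)"
      using z lower[OF _ y] by (intro liminf_add_ge[of "- B" _ B]) auto
    finally have "g u y \<le> e2ennreal (liminf (\<lambda>k. q (z k) y + ereal B))"
      unfolding g_def by (rule e2ennreal_mono)
    also have "\<dots> = liminf (\<lambda>k. g (z k) y)"
      unfolding g_def by (intro Liminf_compose_continuous_mono[symmetric] continuous_on_e2ennreal)
        (auto simp: mono_def e2ennreal_mono)
    finally show ?thesis .
  qed
  then have "(\<integral>\<^sup>+ y. g u y \<partial>P) \<le> (\<integral>\<^sup>+ y. liminf (\<lambda>k. g (z k) y) \<partial>P)"
    by (intro nn_integral_mono)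
  also have "\<dots> \<le> liminf (\<lambda>k. \<integral>\<^sup>+ y. g (z k) y \<partial>P)"
    using g_meas by (rule nn_integral_liminf)
  finally have "enn2ereal (\<integral>\<^sup>+ y. g u y \<partial>P) \<le> enn2ereal (liminf (\<lambda>k. \<integral>\<^sup>+ y. g (z k) y \<partial>P))"
    by (simp only: less_eq_ennreal.rep_eq)
  also have "\<dots> = liminf (\<lambda>k. enn2ereal (\<integral>\<^sup>+ y. g (z k) y \<partial>P))"
    by (intro Liminf_compose_continuous_mono[symmetric] continuous_on_enn2ereal)
      (auto simp: mono_def less_eq_ennreal.rep_eq)
  finally have "expect P (q u) \<le> liminf (\<lambda>k. enn2ereal (\<integral>\<^sup>+ y. g (z k) y \<partial>P)) + liminf (\<lambda>k. ereal (- B))"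
    unfolding expect[OF u] by (simp add: Liminf_const minus_ereal_def add_right_mono)
  also have "\<dots> \<le> liminf (\<lambda>k. enn2ereal (\<integral>\<^sup>+ y. g (z k) y \<partial>P) + ereal (- B))"
    by (intro liminf_add_ge[of 0 _ "- B"]) (auto simp flip: zero_ereal_def)
  also have "\<dots> = liminf (\<lambda>k. expect P (q (z k)))"
    using z by (simp add: expect minus_ereal_def)
  finally show "expect P (q u) \<le> liminf (\<lambda>k. expect P (q (z k)))" .
qed

text \<open>The invariant of the backward induction. Measurability is asked for each fixed decision,
  which is how the duality is applied; semicontinuity in the decision serves the minimisation at the
  preceding stage.\<close>

definition regular_value :: "nat \<Rightarrow> 'a topology \<Rightarrow> ((nat \<Rightarrow> real) \<Rightarrow> 'a \<Rightarrow> ereal) \<Rightarrow> real \<Rightarrow> bool" where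
  "regular_value m X q B \<longleftrightarrow> B \<ge> 0 \<and>
     (\<forall>v\<in>topspace (Euclidean_space m). q v \<in> borel_measurable (borel_of X) \<and> (\<forall>x\<in>topspace X. ereal (- B) \<le> q v x)) \<and>
     (\<forall>x\<in>topspace X. seq_lsc_on (topspace (Euclidean_space m)) (\<lambda>v. q v x))"

lemma compact_L2_bounded_superset:
  obtains K where "compact K" "\<And>u. u \<in> topspace (Euclidean_space n) \<Longrightarrow> L2_set u {..<n} \<le> r \<Longrightarrow> u \<in> K"
proof
  \<comment> \<open>Coordinates from \<open>n\<close> on are pinned to 0, as in
    \<open>Euclidean_space n\<close>, so the infinite box is a product of compact sets.\<close>
  let ?S = "\<lambda>i. if i < n then {- r..r} else {0 :: real}"
  have "compactin (product_topology (\<lambda>i. euclideanreal) UNIV) (PiE UNIV ?S)"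
    by (subst compactin_PiE) auto
  then show "compact (PiE UNIV ?S)"
    by (simp add: euclidean_product_topology)
  fix u assume u: "u \<in> topspace (Euclidean_space n)" "L2_set u {..<n} \<le> r"
  have "- r \<le> u i \<and> u i \<le> r" if "i < n" for i
  proof -
    \<comment> \<open>\<open>member_le_L2_set\<close> bounds \<open>u i\<close> from above; the
      negated vector gives the bound from below.\<close>
    have "L2_set (\<lambda>i. - u i) {..<n} = L2_set u {..<n}" by (simp add: L2_set_def)
    then show ?thesis
      using member_le_L2_set[of "{..<n}" i u] member_le_L2_set[of "{..<n}" i "\<lambda>i. - u i"] u(2) that by simp
  qed
  then show "u \<in> PiE UNIV ?S"
    using u(1) by (auto simp: topspace_Euclidean_space PiE_def)
qed

text \<open>One backward step, with \<open>h\<close> standing for the worst-case cost of the later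
  stages. Measurability in \<open>x\<close> comes from sections of the multifunction, semicontinuity
  in \<open>v\<close> from the closed graph and the common bounded set.\<close>

lemma regular_value_stage:
  assumes f_lsc: "random_lsc n (borel_of X) f"
    and f_lower: "\<forall>u\<in>topspace (Euclidean_space n). \<forall>x\<in>topspace X. a \<le> f u x"
    and U_meas: "measurable_multifunction (borel_of (Euclidean_space m) \<Otimes>\<^sub>M borel_of X) (Euclidean_space n) (\<lambda>(v, x). U v x)"
    and U_graph: "\<And>x. x \<in> topspace X \<Longrightarrow> closedin (prod_topology (Euclidean_space m) (Euclidean_space n))
        {(v, u). v \<in> topspace (Euclidean_space m) \<and> u \<in> U v x}"
    and U_bounded: "\<forall>v\<in>topspace (Euclidean_space m). \<forall>x\<in>topspace X. \<forall>u\<in>U v x. L2_set u {..<n} \<le> r"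
    and h: "seq_lsc_on (topspace (Euclidean_space n)) h"
    and h_lower: "\<And>u. u \<in> topspace (Euclidean_space n) \<Longrightarrow> ereal b \<le> h u"
    and q: "\<And>v x. v \<in> topspace (Euclidean_space m) \<Longrightarrow> x \<in> topspace X \<Longrightarrow> q v x = (INF u\<in>U v x. ereal (f u x) + h u)"
  shows "\<exists>B. regular_value m X q B"
proof -
  let ?E = "topspace (Euclidean_space m)" and ?D = "topspace (Euclidean_space n)"
  have U_D: "U v x \<subseteq> ?D" if "v \<in> ?E" "x \<in> topspace X" for v x
    using U_meas that by (auto simp: measurable_multifunction_def space_pair_measure)
  have closed_graph: "closed {(v, u). v \<in> ?E \<and> u \<in> U v x}" if "x \<in> topspace X" for x
    using U_graph[OF that] by (rule closedin_prod_Euclidean_imp_closed)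
  have graph: "u \<in> U v x"
    if x: "x \<in> topspace X" and z: "\<And>k. z k \<in> ?E" "z \<longlonglongrightarrow> v" and w: "\<And>k. w k \<in> U (z k) x" "w \<longlonglongrightarrow> u" for x z v w u
  proof -
    have "(\<lambda>k. (z k, w k)) \<longlonglongrightarrow> (v, u)" using z(2) w(2) by (rule tendsto_Pair)
    then have "(v, u) \<in> {(v, u). v \<in> ?E \<and> u \<in> U v x}"
      by (rule closed_sequentially[OF closed_graph[OF x], rotated]) (simp add: z(1) w(1))
    then show ?thesis by simp
  qed
  \<comment> \<open>A constant sequence in the first argument turns the closed graph into closed
    values.\<close>
  have closed_U: "closed (U v x)" if "v \<in> ?E" "x \<in> topspace X" for v x
    unfolding closed_sequential_limits using that graph[of x "\<lambda>_. v" v] by auto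
  obtain K where K: "compact K" "\<And>u. u \<in> ?D \<Longrightarrow> L2_set u {..<n} \<le> r \<Longrightarrow> u \<in> K"
    using compact_L2_bounded_superset[of n r] by metis
  have U_K: "U v x \<subseteq> K" if "v \<in> ?E" "x \<in> topspace X" for v x
    using K(2) U_D[OF that] U_bounded that by blast
  \<comment> \<open>The absolute value secures \<open>B \<ge> 0\<close>, and \<open>- B\<close> is
    still at most \<open>a + b\<close>.\<close>
  define B where "B = \<bar>a + b\<bar>"
  have meas: "q v \<in> borel_measurable (borel_of X)" if v: "v \<in> ?E" for v
  proof -
    have "(\<lambda>x. INF u\<in>U v x. ereal (f u x) + h u) \<in> borel_measurable (borel_of X)"
    proof (rule borel_measurable_INF_multifunction[OF f_lsc _ _ _ K(1) _ h h_lower])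
      show "measurable_multifunction (borel_of X) (Euclidean_space n) (U v)"
        unfolding measurable_multifunction_def
      proof (intro conjI ballI allI impI)
        show "U v x \<subseteq> ?D" if "x \<in> space (borel_of X)" for x
          using U_D[OF v] that by simp
        fix V assume "openin (Euclidean_space n) V"
        then have "{z \<in> space (borel_of (Euclidean_space m) \<Otimes>\<^sub>M borel_of X). (case z of (v, x) \<Rightarrow> U v x) \<inter> V \<noteq> {}}
            \<in> sets (borel_of (Euclidean_space m) \<Otimes>\<^sub>M borel_of X)"
          using U_meas unfolding measurable_multifunction_def by blast
        from sets_Pair1[OF this, of v]
        show "{x \<in> space (borel_of X). U v x \<inter> V \<noteq> {}} \<in> sets (borel_of X)"
          using v by (simp add: space_pair_measure vimage_def)
      qed
    qed (use f_lower closed_U[OF v] U_K[OF v] in auto)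
    then show ?thesis
      using q[OF v] by (subst measurable_cong) auto
  qed
  have lower: "ereal (- B) \<le> q v x" if "v \<in> ?E" "x \<in> topspace X" for v x
    unfolding q[OF that]
  proof (rule INF_greatest)
    fix u assume "u \<in> U v x"
    then have u: "u \<in> ?D" using U_D[OF that] by blast
    have "ereal (- B) \<le> ereal a + ereal b" by (simp add: B_def)
    also have "\<dots> \<le> ereal (f u x) + h u"
      using f_lower h_lower u that by (intro add_mono) auto
    finally show "ereal (- B) \<le> ereal (f u x) + h u" .
  qed
  have lsc: "seq_lsc_on ?E (\<lambda>v. q v x)" if x: "x \<in> topspace X" for x
  proof -
    have "seq_lsc_on ?D (\<lambda>u. ereal (f u x))"
      using x by (intro random_lsc_imp_seq_lsc_on[OF f_lsc]) simp
    then have "seq_lsc_on ?D (\<lambda>u. ereal (f u x) + h u)"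
      using f_lower x h_lower by (intro seq_lsc_on_add[of _ _ a _ b] h) auto
    then have "seq_lsc_on ?E (\<lambda>v. INF u\<in>U v x. ereal (f u x) + h u)"
      using U_K U_D x graph[OF x] by (intro seq_lsc_on_INF[OF K(1), where D = ?D]) blast+
    then show ?thesis
      using q[OF _ x] by (subst seq_lsc_on_cong) auto
  qed
  have "regular_value m X q B"
    unfolding regular_value_def using meas lower lsc by (auto simp: B_def)
  then show ?thesis ..
qed

section \<open>The backward recursion\<close>

lemma INF_Times:
  fixes g :: "_ \<Rightarrow> _ \<Rightarrow> _ :: complete_lattice"
  shows "(INF u\<in>A. INF l\<in>B. g u l) = (INF (u, l)\<in>A \<times> B. g u l)"
proof (rule antisym)
  have "(INF u\<in>A. INF l\<in>B. g u l) \<le> g u l" if "u \<in> A" "l \<in> B" for u l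
    using that by (intro INF_lower2[OF that(1)] INF_lower)
  then show "(INF u\<in>A. INF l\<in>B. g u l) \<le> (INF (u, l)\<in>A \<times> B. g u l)"
    by (auto intro!: INF_greatest)
  have "(INF (u, l)\<in>A \<times> B. g u l) \<le> g u l" if "u \<in> A" "l \<in> B" for u l
    using INF_lower[of "(u, l)" "A \<times> B" "\<lambda>(u, l). g u l"] that by simp
  then show "(INF (u, l)\<in>A \<times> B. g u l) \<le> (INF u\<in>A. INF l\<in>B. g u l)"
    by (intro INF_greatest)
qed

text \<open>Semicontinuity survives expectations by Fatou and then suprema. The lower bound also
  needs a member of the ambiguity set, since an empty supremum is minus infinity.\<close>

lemma ambiguity_supremum_regular:
  assumes X: "Suslin_space X" "prob_space \<mu>" "sets \<mu> = sets (borel_of X)"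
    and c: "(\<lambda>z. c (fst z) (snd z)) \<in> borel_measurable (borel_of X \<Otimes>\<^sub>M borel_of X)"
      "\<And>x. x \<in> topspace X \<Longrightarrow> c x x = 0"
    and q: "regular_value n X q B"
  shows "seq_lsc_on (topspace (Euclidean_space n)) (\<lambda>u. SUP P\<in>ambiguity_set X c \<mu> \<rho>. expect P (q u))"
    and "u \<in> topspace (Euclidean_space n) \<Longrightarrow> ereal (- B) \<le> (SUP P\<in>ambiguity_set X c \<mu> \<rho>. expect P (q u))"
proof -
  let ?D = "topspace (Euclidean_space n)"
  have B: "B \<ge> 0" and q_meas: "\<And>u. u \<in> ?D \<Longrightarrow> q u \<in> borel_measurable (borel_of X)"
    and q_lower: "\<And>u x. u \<in> ?D \<Longrightarrow> x \<in> topspace X \<Longrightarrow> ereal (- B) \<le> q u x"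
    and q_lsc: "\<And>x. x \<in> topspace X \<Longrightarrow> seq_lsc_on ?D (\<lambda>u. q u x)"
    using q by (auto simp: regular_value_def)
  have P: "prob_space P" "space P = topspace X" "u \<in> ?D \<Longrightarrow> q u \<in> borel_measurable P"
    if "P \<in> ambiguity_set X c \<mu> \<rho>" for P u
  proof -
    have sets_P: "sets P = sets (borel_of X)" using that by (simp add: ambiguity_set_def)
    show "prob_space P" using that by (simp add: ambiguity_set_def)
    show "space P = topspace X" using sets_eq_imp_space_eq[OF sets_P] by simp
    show "q u \<in> borel_measurable P" if "u \<in> ?D"
      using q_meas[OF that] measurable_cong_sets[OF sets_P refl] by blast
  qed
  show "seq_lsc_on ?D (\<lambda>u. SUP P\<in>ambiguity_set X c \<mu> \<rho>. expect P (q u))"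
    using P B q_lower q_lsc by (intro seq_lsc_on_SUP seq_lsc_on_expect) auto
  show "ereal (- B) \<le> (SUP P\<in>ambiguity_set X c \<mu> \<rho>. expect P (q u))" if u: "u \<in> ?D"
  proof -
    \<comment> \<open>The gain 0 merely instantiates the locale, to reach non-emptiness of the
      ambiguity set.\<close>
    interpret transport_problem \<mu> X c "\<lambda>_. 0"
      using X c by (intro transport_problemI) auto
    obtain P0 where P0: "P0 \<in> ambiguity_set X c \<mu> \<rho>"
      using ambiguity_set_nonempty by blast
    have "expect P0 (q u) = enn2ereal (\<integral>\<^sup>+ y. e2ennreal (q u y + ereal B) \<partial>P0) - ereal B"
      using P[OF P0] B q_lower u by (intro expect_lower_bounded) auto
    also have "\<dots> \<ge> 0 - ereal B" by (intro ereal_minus_mono) auto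
    finally show ?thesis using P0 by (auto intro: SUP_upper2)
  qed
qed

text \<open>The duality is applied under the infimum, for one decision \<open>u\<close> at a time,
  once backward induction has made the next value function regular.\<close>

theorem mainTheorem4:
  fixes T :: nat
    and X :: "nat \<Rightarrow> 'a topology"
    and Phat :: "nat \<Rightarrow> 'a measure"
    and c :: "nat \<Rightarrow> 'a \<Rightarrow> 'a \<Rightarrow> ennreal"
    and \<rho> :: "nat \<Rightarrow> real"
    and x1 :: 'a
    and d :: "nat \<Rightarrow> nat"
    and f :: "nat \<Rightarrow> (nat \<Rightarrow> real) \<Rightarrow> 'a \<Rightarrow> real"
    and U :: "nat \<Rightarrow> (nat \<Rightarrow> real) \<Rightarrow> 'a \<Rightarrow> (nat \<Rightarrow> real) set"
    and Q :: "nat \<Rightarrow> (nat \<Rightarrow> real) \<Rightarrow> 'a \<Rightarrow> ereal"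
  assumes T: "T \<ge> 1"
    and Suslin: "\<And>t. t \<in> {1..T} \<Longrightarrow> Suslin_space (X t)"
    and Phat_prob: "\<And>t. t \<in> {1..T} \<Longrightarrow> prob_space (Phat t)"
    and Phat_sets: "\<And>t. t \<in> {1..T} \<Longrightarrow> sets (Phat t) = sets (borel_of (X t))"
    and c_measurable: "\<And>t. t \<in> {1..T} \<Longrightarrow>
          (\<lambda>z. c t (fst z) (snd z)) \<in> borel_measurable (borel_of (X t) \<Otimes>\<^sub>M borel_of (X t))"
    and c_diag: "\<And>t x. t \<in> {1..T} \<Longrightarrow> x \<in> topspace (X t) \<Longrightarrow> c t x x = 0"
    and rho_pos: "\<And>t. t \<in> {2..T} \<Longrightarrow> \<rho> t > 0"
    and rho_1: "\<rho> 1 = 0"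
    and x1: "x1 \<in> topspace (X 1)"
    and Phat_1: "Phat 1 = return (borel_of (X 1)) x1"
    and d_0: "d 0 = 0"
    and f_bdd_below: "\<And>t. t \<in> {1..T} \<Longrightarrow>
          \<exists>b. \<forall>u\<in>topspace (Euclidean_space (d t)). \<forall>x\<in>topspace (X t). b \<le> f t u x"
    and f_random_lsc: "\<And>t. t \<in> {1..T} \<Longrightarrow> random_lsc (d t) (borel_of (X t)) (f t)"
    and U_measurable: "\<And>t. t \<in> {1..T} \<Longrightarrow>
          measurable_multifunction (borel_of (Euclidean_space (d (t - 1))) \<Otimes>\<^sub>M borel_of (X t))
            (Euclidean_space (d t)) (\<lambda>(v, x). U t v x)"
    and U_nonempty: "\<And>t v x. t \<in> {1..T} \<Longrightarrow> v \<in> topspace (Euclidean_space (d (t - 1))) \<Longrightarrow>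
          x \<in> topspace (X t) \<Longrightarrow> U t v x \<noteq> {}"
    and U_closed_graph: "\<And>t x. t \<in> {1..T} \<Longrightarrow> x \<in> topspace (X t) \<Longrightarrow>
          closedin (prod_topology (Euclidean_space (d (t - 1))) (Euclidean_space (d t)))
            {(v, u). v \<in> topspace (Euclidean_space (d (t - 1))) \<and> u \<in> U t v x}"
    and U_bounded: "\<And>t. t \<in> {1..T} \<Longrightarrow>
          \<exists>r. \<forall>v\<in>topspace (Euclidean_space (d (t - 1))). \<forall>x\<in>topspace (X t).
            \<forall>u\<in>U t v x. L2_set u {..<d t} \<le> r"
    and Q_T: "\<And>v x. v \<in> topspace (Euclidean_space (d (T - 1))) \<Longrightarrow> x \<in> topspace (X T) \<Longrightarrow>
          Q T v x = (INF u\<in>U T v x. ereal (f T u x))"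
    and Q_step: "\<And>t v x. t \<in> {1..<T} \<Longrightarrow> v \<in> topspace (Euclidean_space (d (t - 1))) \<Longrightarrow>
          x \<in> topspace (X t) \<Longrightarrow>
          Q t v x = (INF u\<in>U t v x. ereal (f t u x) +
            (SUP P\<in>ambiguity_set (X (t + 1)) (c (t + 1)) (Phat (t + 1)) (\<rho> (t + 1)).
               expect P (\<lambda>y. Q (t + 1) u y)))"
  shows "\<forall>t\<in>{1..<T}. \<forall>v\<in>topspace (Euclidean_space (d (t - 1))). \<forall>x\<in>topspace (X t).
          Q t v x = (INF (u, l)\<in>U t v x \<times> {0::real..}.
            ereal (f t u x) + ereal (l * \<rho> (t + 1)) +
            expect (Phat (t + 1)) (\<lambda>xhat. SUP y\<in>topspace (X (t + 1)).
              penalized (Q (t + 1) u y) l (c (t + 1) xhat y)))"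
proof (intro ballI)
  fix t v x
  assume t: "t \<in> {1..<T}" and v: "v \<in> topspace (Euclidean_space (d (t - 1)))" and x: "x \<in> topspace (X t)"
  \<comment> \<open>\<open>inc_induct\<close> runs from \<open>T\<close> downwards.
    \<open>Q s\<close> takes the decision of stage \<open>s - 1\<close>, whence the dimension
    \<open>d (s - 1)\<close>.\<close>
  have regular: "\<exists>B. regular_value (d (s - 1)) (X s) (Q s) B" if "1 \<le> s" "s \<le> T" for s
    using that(2,1)
  proof (induction rule: inc_induct)
    case base
    then have s: "T \<in> {1..T}" by simp
    obtain a0 r where "\<forall>u\<in>topspace (Euclidean_space (d T)). \<forall>x\<in>topspace (X T). a0 \<le> f T u x"
      "\<forall>v\<in>topspace (Euclidean_space (d (T - 1))). \<forall>x\<in>topspace (X T). \<forall>u\<in>U T v x. L2_set u {..<d T} \<le> r"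
      using f_bdd_below[OF s] U_bounded[OF s] by blast
    \<comment> \<open>The last stage fits the general step with cost-to-go 0.\<close>
    moreover have "seq_lsc_on (topspace (Euclidean_space (d T))) (\<lambda>_. 0)"
      by (simp add: seq_lsc_on_def Liminf_const)
    moreover have "Q T v x = (INF u\<in>U T v x. ereal (f T u x) + 0)"
      if "v \<in> topspace (Euclidean_space (d (T - 1)))" "x \<in> topspace (X T)" for v x
      using Q_T[OF that] by simp
    ultimately show ?case
      by (intro regular_value_stage[OF f_random_lsc[OF s] _ U_measurable[OF s] U_closed_graph[OF s], where h = "\<lambda>_. 0" and b = 0]) auto
  next
    case (step s)
    then have s: "s \<in> {1..T}" "s + 1 \<in> {1..T}" "s \<in> {1..<T}" by auto
    obtain B where B: "regular_value (d s) (X (s + 1)) (Q (s + 1)) B"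
      using step by auto
    obtain a0 r where "\<forall>u\<in>topspace (Euclidean_space (d s)). \<forall>x\<in>topspace (X s). a0 \<le> f s u x"
      "\<forall>v\<in>topspace (Euclidean_space (d (s - 1))). \<forall>x\<in>topspace (X s). \<forall>u\<in>U s v x. L2_set u {..<d s} \<le> r"
      using f_bdd_below[OF s(1)] U_bounded[OF s(1)] by blast
    from regular_value_stage[OF f_random_lsc[OF s(1)] this(1) U_measurable[OF s(1)] U_closed_graph[OF s(1)] this(2)
        ambiguity_supremum_regular[OF Suslin[OF s(2)] Phat_prob[OF s(2)] Phat_sets[OF s(2)]
          c_measurable[OF s(2)] c_diag[OF s(2)] B] Q_step[OF s(3)]]
    show ?case by blast
  qed
  define E where "E u l = expect (Phat (t + 1)) (\<lambda>xhat. SUP y\<in>topspace (X (t + 1)).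
      penalized (Q (t + 1) u y) l (c (t + 1) xhat y))" for u l
  have t': "t \<in> {1..T}" "t + 1 \<in> {1..T}" "t + 1 \<in> {2..T}" using t by auto
  obtain B where B: "regular_value (d t) (X (t + 1)) (Q (t + 1)) B"
    using regular[of "t + 1"] t by auto
  have U_D: "U t v x \<subseteq> topspace (Euclidean_space (d t))"
    using U_measurable[OF t'(1)] v x by (auto simp: measurable_multifunction_def space_pair_measure)
  have "Q t v x = (INF u\<in>U t v x. ereal (f t u x) + (INF l\<in>{0..}. ereal (l * \<rho> (t + 1)) + E u l))"
    unfolding Q_step[OF t v x] E_def
  proof (intro INF_cong refl arg_cong2[where f = "(+)"])
    fix u assume "u \<in> U t v x"
    then have u: "u \<in> topspace (Euclidean_space (d t))" using U_D by blast
    show "(SUP P\<in>ambiguity_set (X (t + 1)) (c (t + 1)) (Phat (t + 1)) (\<rho> (t + 1)). expect P (\<lambda>y. Q (t + 1) u y)) =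
      (INF l\<in>{0..}. ereal (l * \<rho> (t + 1)) + expect (Phat (t + 1)) (\<lambda>xhat. SUP y\<in>topspace (X (t + 1)).
        penalized (Q (t + 1) u y) l (c (t + 1) xhat y)))"
      using B u
      by (intro expect_duality[OF Suslin[OF t'(2)] Phat_prob[OF t'(2)] Phat_sets[OF t'(2)]
          c_measurable[OF t'(2)] c_diag[OF t'(2)], of _ B] rho_pos[OF t'(3)])
        (auto simp: regular_value_def)
  qed
  also have "\<dots> = (INF u\<in>U t v x. INF l\<in>{0..}. ereal (f t u x) + (ereal (l * \<rho> (t + 1)) + E u l))"
  proof (rule INF_cong)
    \<comment> \<open>Adding a real number can be undone, so it commutes with the infimum even when
      the latter is infinite.\<close>
    have shift: "ereal a + (INF l\<in>A. g l) = (INF l\<in>A. ereal a + g l)" for a and A :: "real set" and g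
    proof (rule antisym)
      show "ereal a + (INF l\<in>A. g l) \<le> (INF l\<in>A. ereal a + g l)"
        by (intro INF_greatest add_left_mono INF_lower)
      have "(INF l\<in>A. ereal a + g l) - ereal a \<le> (INF l\<in>A. g l)"
      proof (rule INF_greatest)
        fix l assume "l \<in> A"
        then have "(INF l\<in>A. ereal a + g l) \<le> ereal a + g l" by (rule INF_lower)
        then show "(INF l\<in>A. ereal a + g l) - ereal a \<le> g l"
          by (simp add: ereal_minus_le add.commute)
      qed
      then show "(INF l\<in>A. ereal a + g l) \<le> ereal a + (INF l\<in>A. g l)"
        by (simp add: ereal_minus_le add.commute)
    qed
    show "ereal (f t u x) + (INF l\<in>{0..}. ereal (l * \<rho> (t + 1)) + E u l) =
        (INF l\<in>{0..}. ereal (f t u x) + (ereal (l * \<rho> (t + 1)) + E u l))" for u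
      by (rule shift)
  qed simp
  also have "\<dots> = (INF (u, l)\<in>U t v x \<times> {0..}. ereal (f t u x) + ereal (l * \<rho> (t + 1)) + E u l)"
    by (simp only: INF_Times add.assoc)
  finally show "Q t v x = (INF (u, l)\<in>U t v x \<times> {0::real..}.
      ereal (f t u x) + ereal (l * \<rho> (t + 1)) +
      expect (Phat (t + 1)) (\<lambda>xhat. SUP y\<in>topspace (X (t + 1)).
        penalized (Q (t + 1) u y) l (c (t + 1) xhat y)))"
    unfolding E_def .
qed

end
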